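(* Let $\sigma$ be an automorphism of an algebra $\mathcal{A}$ and let $(\mathcal{A},\mathfrak{H},D)$ be a graded $\sigma$-spectral triple such that $D^{-1}\in\mathcal{L}^{n,\infty}$ for some even $n\in\mathbb{N}$. For any idempotent $e^2=e\in M_N(\mathcal{A})$ one has $$\mathrm{Index}^{\pm}_{D,\sigma}[e]=\Phi^{\pm}_{D,\sigma}(e,\ldots,e).$$ If in addition $\mathcal{A}$ is an involutive algebra with involutive representation, $\sigma$ satisfies $\sigma(a^* )=(\sigma^{-1}(a))^*$ for all $a\in\mathcal{A}$, and $e^*=\sigma(e)$, then $$\mathrm{Index}^{+}_{D,\sigma}[e]=-\,\mathrm{Index}^{-}_{D,\sigma}[e].$$
   Context: Let $\sigma$ be an automorphism of the algebra $\mathcal{A}$. A graded $\sigma$-spectral triple $(\mathcal{A},\mathfrak{H},D)$ is given by an action of $\mathcal{A}$ by bounded operators on a Hilbert space $\mathfrak{H}$, a self-adjoint operator $D$ on $\mathfrak{H}$ with compact resolvent such that $Da-\sigma(a)D$ is bounded for all $a\in\mathcal{A}$ (that is, $a$ preserves $\mathrm{Dom}(D)$ and $Da-\sigma(a)D$ extends to a bounded operator), and a grading operator $\gamma=\gamma^*$, $\gamma^2=I$, which commutes with the action of $\mathcal{A}$ and satisfies $D\gamma=-\gamma D$. Writing $D^{-1}\in\mathcal{L}^{n,\infty}$ includes the assumption that $D$ is invertible; for $n>1$, $\mathcal{L}^{n,\infty}$ is the ideal of compact operators whose decreasing singular values satisfy $\mu_k(T)=O(k^{-1/n})$. According to the grading,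 $\mathfrak{H}=\mathfrak{H}_+\oplus\mathfrak{H}_-$, $D=\begin{pmatrix}0&D_-\\ D_+&0\end{pmatrix}$ with $D_\pm$ going from $\mathfrak{H}_\pm$ to $\mathfrak{H}_\mp$, each $a\in\mathcal{A}$ acts as $\begin{pmatrix}a_+&0\\0&a_-\end{pmatrix}$, and $\sigma(a)_\mp$ is the component of $\sigma(a)$ on $\mathfrak{H}_\mp$. Matrices: for $e\in M_N(\mathcal{A})$ one replaces $\mathfrak{H}$ by $\mathfrak{H}\otimes\mathbb{C}^N$, $D$ by $D\otimes I_N$, and $\sigma$ by its entrywise extension to $M_N(\mathcal{A})$. Index maps: for $e^2=e\in M_N(\mathcal{A})$ let $f_\pm$ be the bounded closure of $D_\pm^{-1}\sigma(e)_\mp D_\pm$ (defined on $\mathrm{Dom}\,D_\pm$); $f_\pm$ is an idempotent, $f_\pm e_\pm:e_\pm\mathfrak{H}_\pm\to f_\pm\mathfrak{H}_\pm$ is Fredholm, and $\mathrm{Index}^\pm_{D,\sigma}[e]:=\mathrm{Index}(f_\pm e_\pm)$, which depends only on the $K$-theory class $[e]\in K_0(\mathcal{A})$. Cocycles: $$\Phi^{\pm}_{D,\sigma}(a^0,\ldots,a^n):=\mathrm{Tr}\Big(D_\pm^{-1}\big(D_\pm a^0_\pm-\sigma(a^0)_\mp D_\pm\big)\cdots D_\pm^{-1}\big(D_\pm a^n_\pm-\sigma(a^n)_\mp D_\pm\big)\Big),$$ applied to matrices $a^0,\ldots,a^n\in M_N(\mathcal{A})$ by replacing $\mathfrak{H}$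 by $\mathfrak{H}\otimes\mathbb{C}^N$, $D$ by $D\otimes I_N$, and $\sigma$ by its entrywise extension to $M_N(\mathcal{A})$. *)

theory Defs
  imports "HOL-Analysis.Analysis" "HOL-Library.Landau_Symbols"
begin

section \<open>Complex vector spaces, algebras and Hilbert spaces\<close>

class scaleC =
  fixes scaleC :: "complex \<Rightarrow> 'a \<Rightarrow> 'a"  (infixr "*\<^sub>C" 75)

class complex_vector = scaleC + ab_group_add +
  assumes scaleC_add_right: "c *\<^sub>C (x + y) = c *\<^sub>C x + c *\<^sub>C y"
    and scaleC_add_left: "(c + d) *\<^sub>C x = c *\<^sub>C x + d *\<^sub>C x"
    and scaleC_scaleC: "c *\<^sub>C d *\<^sub>C x = (c * d) *\<^sub>C x"
    and scaleC_one: "1 *\<^sub>C x = x"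

interpretation complex_vector:
  vector_space "scaleC :: complex \<Rightarrow> 'a \<Rightarrow> 'a::complex_vector"
  by unfold_locales
    (simp_all add: scaleC_add_right scaleC_add_left scaleC_scaleC scaleC_one)

text \<open>Associative algebras over the complex numbers; a unit is not required.\<close>

class complex_algebra = complex_vector + ring +
  assumes mult_scaleC_left: "(c *\<^sub>C x) * y = c *\<^sub>C (x * y)"
    and mult_scaleC_right: "x * (c *\<^sub>C y) = c *\<^sub>C (x * y)"

text \<open>The inner product is antilinear in the first and linear in the second argument.
  Separability is not required.\<close>

class chilbert_space = complex_vector + banach +
  fixes cinner :: "'a \<Rightarrow> 'a \<Rightarrow> complex"
  assumes scaleR_scaleC: "r *\<^sub>R x = complex_of_real r *\<^sub>C x"
    and cinner_commute: "cinner x y = cnj (cinner y x)"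
    and cinner_add_right: "cinner x (y + z) = cinner x y + cinner x z"
    and cinner_scaleC_right: "cinner x (c *\<^sub>C y) = c * cinner x y"
    and cinner_self: "cinner x x = complex_of_real ((norm x)\<^sup>2)"

text \<open>The Hilbert space \<open>H \<otimes> \<complex>\<^sup>N\<close> is rendered as \<open>'h ^ 'n\<close>.\<close>

instantiation vec :: (complex_vector, finite) complex_vector
begin

definition scaleC_vec :: "complex \<Rightarrow> 'a ^ 'b \<Rightarrow> 'a ^ 'b" where
  "c *\<^sub>C x = (\<chi> i. c *\<^sub>C (x $ i))"

instance
  by standard
    (simp_all add: scaleC_vec_def vec_eq_iff scaleC_add_right scaleC_add_left
      scaleC_scaleC scaleC_one)

end

instantiation vec :: (chilbert_space, finite) chilbert_space
begin

definition cinner_vec :: "'a ^ 'b \<Rightarrow> 'a ^ 'b \<Rightarrow> complex" where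
  "cinner x y = (\<Sum>i\<in>UNIV. cinner (x $ i) (y $ i))"

instance
proof
  fix x y z :: "'a ^ 'b" and c :: complex and r :: real
  show "r *\<^sub>R x = complex_of_real r *\<^sub>C x"
    by (simp add: vec_eq_iff scaleC_vec_def scaleR_scaleC)
  show "cinner x y = cnj (cinner y x)"
    unfolding cinner_vec_def cnj_sum by (rule sum.cong[OF refl], rule cinner_commute)
  show "cinner x (y + z) = cinner x y + cinner x z"
    by (simp add: cinner_vec_def cinner_add_right sum.distrib)
  show "cinner x (c *\<^sub>C y) = c * cinner x y"
    by (simp add: cinner_vec_def scaleC_vec_def cinner_scaleC_right sum_distrib_left)
  show "cinner x x = complex_of_real ((norm x)\<^sup>2)"
    by (simp add: cinner_vec_def norm_vec_def L2_set_def cinner_self sum_nonneg)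
qed

end

section \<open>Bounded, compact and trace class operators\<close>

definition bounded_clinear ::
    "('a::{complex_vector,real_normed_vector} \<Rightarrow> 'b::{complex_vector,real_normed_vector}) \<Rightarrow> bool"
  where "bounded_clinear T \<longleftrightarrow> bounded_linear T \<and> (\<forall>c x. T (c *\<^sub>C x) = c *\<^sub>C T x)"

definition compact_operator :: "('h::chilbert_space \<Rightarrow> 'h) \<Rightarrow> bool" where
  "compact_operator T \<longleftrightarrow> bounded_clinear T \<and> compact (closure (T ` cball 0 1))"

definition adjoint_operator :: "('h::chilbert_space \<Rightarrow> 'h) \<Rightarrow> 'h \<Rightarrow> 'h" where
  "adjoint_operator T = (THE S. \<forall>x y. cinner (T x) y = cinner x (S y))"

text \<open>\<open>\<mu>\<close> lists in decreasing order, with multiplicity, the square roots of the non-zero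
  eigenvalues of \<open>T\<^sup>*T\<close>, followed by zeros if there are only finitely many of them.
  Finiteness of the level sets has to be stated since \<open>card\<close> of an infinite set is \<open>0\<close>.\<close>

definition singular_values :: "('h::chilbert_space \<Rightarrow> 'h) \<Rightarrow> (nat \<Rightarrow> real) \<Rightarrow> bool" where
  "singular_values T \<mu> \<longleftrightarrow> decseq \<mu> \<and> (\<forall>k. \<mu> k \<ge> 0) \<and>
     (\<forall>l>0. finite {k. \<mu> k = l} \<and>
        card {k. \<mu> k = l} =
          complex_vector.dim {x. adjoint_operator T (T x) = complex_of_real (l\<^sup>2) *\<^sub>C x})"

definition weak_schatten :: "real \<Rightarrow> ('h::chilbert_space \<Rightarrow> 'h) set" where
  "weak_schatten p = {T. compact_operator T \<and>
     (\<exists>\<mu>. singular_values T \<mu> \<and> \<mu> \<in> O(\<lambda>k. real k powr (- 1 / p)))}"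

definition orthonormal_basis :: "'h::chilbert_space set \<Rightarrow> bool" where
  "orthonormal_basis B \<longleftrightarrow>
     (\<forall>x\<in>B. \<forall>y\<in>B. cinner x y = (if x = y then 1 else 0)) \<and>
     closure (complex_vector.span B) = UNIV"

text \<open>The description determines a value exactly when the sums over all orthonormal bases
  converge absolutely and agree, as they do for trace class operators; otherwise nothing can be
  said about \<open>trace_operator T\<close>.\<close>

definition trace_operator :: "('h::chilbert_space \<Rightarrow> 'h) \<Rightarrow> complex" where
  "trace_operator T =
     (THE t. \<forall>B. orthonormal_basis B \<longrightarrow> ((\<lambda>x. cinner x (T x)) has_sum t) B)"

section \<open>Fredholm operators between subspaces\<close>

definition finite_dimensional :: "'v::complex_vector set \<Rightarrow> bool" where
  "finite_dimensional V \<longleftrightarrow> (\<exists>B. finite B \<and> complex_vector.span B = V)"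

definition kernel_on :: "('v::complex_vector \<Rightarrow> 'v) \<Rightarrow> 'v set \<Rightarrow> 'v set" where
  "kernel_on T V = {x \<in> V. T x = 0}"

text \<open>An algebraic complement of \<open>U\<close> in \<open>W\<close>: a subspace isomorphic to the quotient \<open>W / U\<close>.\<close>

definition quotient_complement ::
    "'v::complex_vector set \<Rightarrow> 'v set \<Rightarrow> 'v set" where
  "quotient_complement W U = (SOME C. complex_vector.subspace C \<and> U \<inter> C = {0} \<and>
     {u + c |u c. u \<in> U \<and> c \<in> C} = W)"

definition cokernel_on :: "('v::complex_vector \<Rightarrow> 'v) \<Rightarrow> 'v set \<Rightarrow> 'v set \<Rightarrow> 'v set" where
  "cokernel_on T V W = quotient_complement W (T ` V)"

definition fredholm_on :: "('h::chilbert_space \<Rightarrow> 'h) \<Rightarrow> 'h set \<Rightarrow> 'h set \<Rightarrow> bool" where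
  "fredholm_on T V W \<longleftrightarrow>
     complex_vector.subspace V \<and> complex_vector.subspace W \<and> T ` V \<subseteq> W \<and>
     (\<forall>x\<in>V. \<forall>y\<in>V. T (x + y) = T x + T y) \<and> (\<forall>c. \<forall>x\<in>V. T (c *\<^sub>C x) = c *\<^sub>C T x) \<and>
     (\<exists>K. \<forall>x\<in>V. norm (T x) \<le> K * norm x) \<and>
     finite_dimensional (kernel_on T V) \<and> finite_dimensional (cokernel_on T V W)"

definition fredholm_index :: "('h::chilbert_space \<Rightarrow> 'h) \<Rightarrow> 'h set \<Rightarrow> 'h set \<Rightarrow> int" where
  "fredholm_index T V W =
     (if fredholm_on T V W
      then int (complex_vector.dim (kernel_on T V)) - int (complex_vector.dim (cokernel_on T V W))
      else undefined)"

section \<open>Unbounded operators\<close>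

text \<open>An unbounded operator is given by its domain and a function, whose values outside the
  domain are irrelevant.\<close>

text \<open>The last conjunct says that the adjoint of \<open>D\<close>, as a partial operator, is \<open>D\<close> itself.\<close>

definition self_adjoint_on :: "'h::chilbert_space set \<Rightarrow> ('h \<Rightarrow> 'h) \<Rightarrow> bool" where
  "self_adjoint_on Dom D \<longleftrightarrow>
     complex_vector.subspace Dom \<and> closure Dom = UNIV \<and>
     (\<forall>x\<in>Dom. \<forall>y\<in>Dom. D (x + y) = D x + D y) \<and> (\<forall>c. \<forall>x\<in>Dom. D (c *\<^sub>C x) = c *\<^sub>C D x) \<and>
     (\<forall>y z. (\<forall>x\<in>Dom. cinner (D x) y = cinner x z) \<longleftrightarrow> y \<in> Dom \<and> z = D y)"

definition compact_resolvent :: "'h::chilbert_space set \<Rightarrow> ('h \<Rightarrow> 'h) \<Rightarrow> bool" where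
  "compact_resolvent Dom D \<longleftrightarrow> (\<exists>l. bij_betw (\<lambda>x. D x - l *\<^sub>C x) Dom UNIV \<and>
     compact_operator (inv_into Dom (\<lambda>x. D x - l *\<^sub>C x)))"

text \<open>The operator whose graph is the closure of the graph of \<open>T\<close> on \<open>Dom\<close>.\<close>

definition operator_closure ::
    "'h::chilbert_space set \<Rightarrow> ('h \<Rightarrow> 'h) \<Rightarrow> 'h \<Rightarrow> 'h" where
  "operator_closure Dom T x = (THE y. (x, y) \<in> closure ((\<lambda>z. (z, T z)) ` Dom))"

section \<open>Graded twisted spectral triples\<close>

definition algebra_automorphism :: "('a::complex_algebra \<Rightarrow> 'a) \<Rightarrow> bool" where
  "algebra_automorphism \<sigma> \<longleftrightarrow> bij \<sigma> \<and> (\<forall>a b. \<sigma> (a + b) = \<sigma> a + \<sigma> b) \<and>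
     (\<forall>c a. \<sigma> (c *\<^sub>C a) = c *\<^sub>C \<sigma> a) \<and> (\<forall>a b. \<sigma> (a * b) = \<sigma> a * \<sigma> b)"

definition bounded_action ::
    "('a::complex_algebra \<Rightarrow> 'h::chilbert_space \<Rightarrow> 'h) \<Rightarrow> bool" where
  "bounded_action \<pi> \<longleftrightarrow> (\<forall>a. bounded_clinear (\<pi> a)) \<and>
     (\<forall>a b x. \<pi> (a + b) x = \<pi> a x + \<pi> b x) \<and> (\<forall>c a x. \<pi> (c *\<^sub>C a) x = c *\<^sub>C \<pi> a x) \<and>
     (\<forall>a b x. \<pi> (a * b) x = \<pi> a (\<pi> b x))"

locale graded_twisted_spectral_triple =
  fixes \<sigma> :: "'a::complex_algebra \<Rightarrow> 'a"
    and \<pi> :: "'a \<Rightarrow> 'h::chilbert_space \<Rightarrow> 'h"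
    and Dom :: "'h set"
    and D :: "'h \<Rightarrow> 'h"
    and \<gamma> :: "'h \<Rightarrow> 'h"
  assumes automorphism: "algebra_automorphism \<sigma>"
    and action: "bounded_action \<pi>"
    and self_adjoint: "self_adjoint_on Dom D"
    and resolvent: "compact_resolvent Dom D"
    and preserves_domain: "x \<in> Dom \<Longrightarrow> \<pi> a x \<in> Dom"
    and bounded_twisted_commutator:
      "\<exists>T. bounded_clinear T \<and> (\<forall>x\<in>Dom. T x = D (\<pi> a x) - \<pi> (\<sigma> a) (D x))"
    and grading_bounded: "bounded_clinear \<gamma>"
    and grading_self_adjoint: "cinner (\<gamma> x) y = cinner x (\<gamma> y)"
    and grading_involutive: "\<gamma> (\<gamma> x) = x"
    and grading_commutes: "\<gamma> (\<pi> a x) = \<pi> a (\<gamma> x)"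
    and grading_preserves_domain: "x \<in> Dom \<Longrightarrow> \<gamma> x \<in> Dom"
    and grading_anticommutes: "x \<in> Dom \<Longrightarrow> D (\<gamma> x) = - \<gamma> (D x)"

text \<open>In the following \<open>\<epsilon>\<close> is \<open>1\<close> or \<open>-1\<close> and selects \<open>H\<^sub>+\<close> or \<open>H\<^sub>-\<close>. The operators
  \<open>D\<^sub>\<plusminus>\<close>, \<open>a\<^sub>\<plusminus>\<close> and \<open>\<sigma>(a)\<^sub>\<mp>\<close> are restrictions of \<open>D\<close>, \<open>a\<close> and \<open>\<sigma>(a)\<close>, so they are written by
  the same symbols and applied to elements of the appropriate eigenspace of \<open>\<gamma>\<close>.\<close>

definition graded_part :: "('h::chilbert_space \<Rightarrow> 'h) \<Rightarrow> real \<Rightarrow> 'h set" where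
  "graded_part \<gamma> \<epsilon> = {x. \<gamma> x = \<epsilon> *\<^sub>R x}"

definition graded_proj :: "('h::chilbert_space \<Rightarrow> 'h) \<Rightarrow> real \<Rightarrow> 'h \<Rightarrow> 'h" where
  "graded_proj \<gamma> \<epsilon> x = (1 / 2) *\<^sub>R (x + \<epsilon> *\<^sub>R \<gamma> x)"

definition graded_inverse ::
    "'h::chilbert_space set \<Rightarrow> ('h \<Rightarrow> 'h) \<Rightarrow> ('h \<Rightarrow> 'h) \<Rightarrow> real \<Rightarrow> 'h \<Rightarrow> 'h" where
  "graded_inverse Dom D \<gamma> \<epsilon> = inv_into (Dom \<inter> graded_part \<gamma> \<epsilon>) D"

text \<open>\<open>A\<close> and \<open>S\<close> below are the operators by which \<open>a\<close> and \<open>\<sigma>(a)\<close> act.\<close>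

definition conjugated_operator ::
    "'h::chilbert_space set \<Rightarrow> ('h \<Rightarrow> 'h) \<Rightarrow> ('h \<Rightarrow> 'h) \<Rightarrow> real \<Rightarrow> ('h \<Rightarrow> 'h) \<Rightarrow> 'h \<Rightarrow> 'h" where
  "conjugated_operator Dom D \<gamma> \<epsilon> S =
     operator_closure (Dom \<inter> graded_part \<gamma> \<epsilon>) (\<lambda>x. graded_inverse Dom D \<gamma> \<epsilon> (S (D x)))"

definition twisted_commutator ::
    "'h::chilbert_space set \<Rightarrow> ('h \<Rightarrow> 'h) \<Rightarrow> ('h \<Rightarrow> 'h) \<Rightarrow> real \<Rightarrow>
     ('h \<Rightarrow> 'h) \<Rightarrow> ('h \<Rightarrow> 'h) \<Rightarrow> 'h \<Rightarrow> 'h" where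
  "twisted_commutator Dom D \<gamma> \<epsilon> A S =
     operator_closure (Dom \<inter> graded_part \<gamma> \<epsilon>) (\<lambda>x. D (A x) - S (D x))"

section \<open>Matrix amplification\<close>

definition amplify :: "('h \<Rightarrow> 'h) \<Rightarrow> 'h ^ 'n \<Rightarrow> 'h ^ 'n" where
  "amplify T x = (\<chi> i. T (x $ i))"

definition amplify_dom :: "'h set \<Rightarrow> ('h ^ 'n) set" where
  "amplify_dom Dom = {x. \<forall>i. x $ i \<in> Dom}"

definition matrix_action ::
    "('a \<Rightarrow> 'h \<Rightarrow> 'h::chilbert_space) \<Rightarrow> 'a ^ 'n ^ 'n \<Rightarrow> 'h ^ 'n \<Rightarrow> 'h ^ 'n" where
  "matrix_action \<pi> a x = (\<chi> i. \<Sum>j\<in>UNIV. \<pi> (a $ i $ j) (x $ j))"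

definition matrix_map :: "('a \<Rightarrow> 'a) \<Rightarrow> 'a ^ 'n ^ 'n \<Rightarrow> 'a ^ 'n ^ 'n" where
  "matrix_map \<sigma> a = (\<chi> i j. \<sigma> (a $ i $ j))"

text \<open>The library product of matrices requires entries from a ring with unit.\<close>

definition matrix_product :: "'a::ring ^ 'n ^ 'n \<Rightarrow> 'a ^ 'n ^ 'n \<Rightarrow> 'a ^ 'n ^ 'n" where
  "matrix_product a b = (\<chi> i j. \<Sum>k\<in>UNIV. a $ i $ k * b $ k $ j)"

definition matrix_star :: "('a \<Rightarrow> 'a) \<Rightarrow> 'a ^ 'n ^ 'n \<Rightarrow> 'a ^ 'n ^ 'n" where
  "matrix_star star a = (\<chi> i j. star (a $ j $ i))"

section \<open>Index maps and cocycles\<close>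

definition index_map ::
    "('a::complex_algebra \<Rightarrow> 'a) \<Rightarrow> ('a \<Rightarrow> 'h \<Rightarrow> 'h) \<Rightarrow> 'h::chilbert_space set \<Rightarrow> ('h \<Rightarrow> 'h) \<Rightarrow>
     ('h \<Rightarrow> 'h) \<Rightarrow> real \<Rightarrow> 'a ^ 'n ^ 'n \<Rightarrow> int" where
  "index_map \<sigma> \<pi> Dom D \<gamma> \<epsilon> e =
     (let E = matrix_action \<pi> e;
          H = graded_part (amplify \<gamma>) \<epsilon>;
          f = conjugated_operator (amplify_dom Dom) (amplify D) (amplify \<gamma>) \<epsilon>
                (matrix_action \<pi> (matrix_map \<sigma> e))
      in fredholm_index (\<lambda>x. f (E x)) (E ` H) (f ` H))"

definition cocycle_factor ::
    "('a::complex_algebra \<Rightarrow> 'a) \<Rightarrow> ('a \<Rightarrow> 'h \<Rightarrow> 'h) \<Rightarrow> 'h::chilbert_space set \<Rightarrow> ('h \<Rightarrow> 'h) \<Rightarrow>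
     ('h \<Rightarrow> 'h) \<Rightarrow> real \<Rightarrow> 'a ^ 'n ^ 'n \<Rightarrow> 'h ^ 'n \<Rightarrow> 'h ^ 'n" where
  "cocycle_factor \<sigma> \<pi> Dom D \<gamma> \<epsilon> a =
     (\<lambda>x. graded_inverse (amplify_dom Dom) (amplify D) (amplify \<gamma>) \<epsilon>
            (twisted_commutator (amplify_dom Dom) (amplify D) (amplify \<gamma>) \<epsilon>
               (matrix_action \<pi> a) (matrix_action \<pi> (matrix_map \<sigma> a)) x))"

text \<open>The product of the factors for \<open>a 0, \<dots>, a n\<close> is an operator on \<open>H\<^sub>\<plusminus>\<close>; its trace is that
  of its extension by zero to \<open>H\<close>, obtained by composing with the projection onto \<open>H\<^sub>\<plusminus>\<close>.\<close>

definition index_cocycle ::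
    "('a::complex_algebra \<Rightarrow> 'a) \<Rightarrow> ('a \<Rightarrow> 'h \<Rightarrow> 'h) \<Rightarrow> 'h::chilbert_space set \<Rightarrow> ('h \<Rightarrow> 'h) \<Rightarrow>
     ('h \<Rightarrow> 'h) \<Rightarrow> real \<Rightarrow> nat \<Rightarrow> (nat \<Rightarrow> 'a ^ 'n ^ 'n) \<Rightarrow> complex" where
  "index_cocycle \<sigma> \<pi> Dom D \<gamma> \<epsilon> n a =
     trace_operator
       (foldr (\<lambda>k T. cocycle_factor \<sigma> \<pi> Dom D \<gamma> \<epsilon> (a k) \<circ> T) [0..<Suc n]
          (graded_proj (amplify \<gamma>) \<epsilon>))"

section \<open>Involutions\<close>

definition algebra_involution :: "('a::complex_algebra \<Rightarrow> 'a) \<Rightarrow> bool" where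
  "algebra_involution star \<longleftrightarrow> (\<forall>a. star (star a) = a) \<and>
     (\<forall>a b. star (a + b) = star a + star b) \<and> (\<forall>c a. star (c *\<^sub>C a) = cnj c *\<^sub>C star a) \<and>
     (\<forall>a b. star (a * b) = star b * star a)"

definition involutive_action ::
    "('a \<Rightarrow> 'a) \<Rightarrow> ('a \<Rightarrow> 'h::chilbert_space \<Rightarrow> 'h) \<Rightarrow> bool" where
  "involutive_action star \<pi> \<longleftrightarrow> (\<forall>a x y. cinner (\<pi> a x) y = cinner x (\<pi> (star a) y))"

end

theory Submission
  imports Defs
begin

text \<open>Let \<open>P = e\<close> and let \<open>Q\<close> be the bounded closure of \<open>D\<inverse> \<sigma>(e) D\<close> on \<open>H\<^sub>\<plusminus>\<close>. Then \<open>A = P - Q = D\<inverse> [D, e]\<^sub>\<sigma>\<close> is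
  the factor of the cocycle, so that the theorem reads \<open>Index (Q P) = Tr A\<^bsup>n+1\<^esup>\<close>. Its approximation
  numbers are \<open>O(k\<^bsup>-1/n\<^esup>)\<close>, hence those of \<open>A\<^bsup>n+1\<^esup>\<close> are summable and \<open>A\<^bsup>n+1\<^esup>\<close> is nuclear. Since
  \<open>P - P Q P = A\<^sup>2 P\<close> and \<open>Q - Q P Q = A\<^sup>2 Q\<close>, the operator \<open>P Q\<close> is a parametrix of \<open>Q P\<close>, and Fedosov's
  formula gives \<open>Index (Q P) = Tr (A\<^bsup>2m\<^esup> P) - Tr (A\<^bsup>2m\<^esup> Q) = Tr A\<^bsup>2m+1\<^esup>\<close> for large \<open>m\<close>. With \<open>B = 1 - P - Q\<close>
  one has \<open>A B = - B A\<close> and \<open>A\<^sup>2 + B\<^sup>2 = 1\<close>, so that cyclicity of the trace lowers the exponent to \<open>n + 1\<close>.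
  If \<open>e\<^sup>* = \<sigma>(e)\<close>, then \<open>(D\<inverse> T)\<^sup>* = - T D\<inverse>\<close> for \<open>T = [D, e]\<^sub>\<sigma>\<close>, so taking adjoints and using
  cyclicity exchanges the two traces up to sign and complex conjugation.\<close>

section \<open>Inner products and orthonormal sets\<close>

text \<open>Three definitions decide the route. \<open>trace_operator\<close> demands one value for
  all orthonormal bases of a space that may be non-separable, so operators are handled through
  expansions into rank one operators, for which the sums over a basis and over the expansion can be
  interchanged. \<open>singular_values\<close> speaks only of eigenspaces, so its decay is first
  converted into approximation by operators of finite rank, a notion that passes easily to products
  and to matrix amplifications. The index is a difference of algebraic dimensions; it is first tied
  to traces for a parametrix with finite rank defects, where all reduces to finite dimensional
  subspaces, and the difference of the two defect traces is then shown to survive the passage to the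
  Neumann sum with nuclear defects. Each of these defects is an even power of A, and n + 2 is the
  first even exponent for which the decay gives nuclearity; hence the detour through
  A^{n+3}.\<close>

lemma cinner_add_left: "cinner (x + y) z = cinner x z + cinner y (z::'h::chilbert_space)"
  by (metis cinner_add_right cinner_commute complex_cnj_add)

lemma cinner_scaleC_left: "cinner (c *\<^sub>C x) y = cnj c * cinner x (y::'h::chilbert_space)"
  by (metis cinner_scaleC_right cinner_commute complex_cnj_mult)

lemma norm_scaleC: "norm (c *\<^sub>C (x::'h::chilbert_space)) = cmod c * norm x"
proof -
  have "complex_of_real ((norm (c *\<^sub>C x))\<^sup>2) = cnj c * (c * complex_of_real ((norm x)\<^sup>2))"
    by (metis cinner_self cinner_scaleC_left cinner_scaleC_right)
  also have "\<dots> = complex_of_real ((cmod c * norm x)\<^sup>2)"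
    using complex_norm_square[of c] by (simp add: power_mult_distrib mult.commute mult.left_commute)
  finally have "(norm (c *\<^sub>C x))\<^sup>2 = (cmod c * norm x)\<^sup>2"
    using of_real_eq_iff by blast
  then show ?thesis by (simp add: power2_eq_iff_nonneg)
qed

lemma cinner_zero_right [simp]: "cinner x (0::'h::chilbert_space) = 0"
  using cinner_add_right[of x 0 0] by simp

lemma cinner_zero_left [simp]: "cinner (0::'h::chilbert_space) x = 0"
  using cinner_add_left[of 0 0 x] by simp

lemma cinner_minus_right [simp]: "cinner x (- y) = - cinner x (y::'h::chilbert_space)"
  using cinner_add_right[of x y "- y"] by (simp add: eq_neg_iff_add_eq_0 add.commute)

lemma cinner_minus_left [simp]: "cinner (- x) y = - cinner x (y::'h::chilbert_space)"
  using cinner_add_left[of x "- x" y] by (simp add: eq_neg_iff_add_eq_0 add.commute)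

lemma cinner_diff_right: "cinner x (y - z) = cinner x y - cinner x (z::'h::chilbert_space)"
  using cinner_add_right[of x y "- z"] by simp

lemma cinner_diff_left: "cinner (x - y) z = cinner x z - cinner y (z::'h::chilbert_space)"
  using cinner_add_left[of x "- y" z] by simp

lemma cinner_sum_right: "cinner x (\<Sum>i\<in>I. f i) = (\<Sum>i\<in>I. cinner x (f i :: 'h::chilbert_space))"
  by (induction I rule: infinite_finite_induct) (auto simp: cinner_add_right)

lemma cinner_sum_left: "cinner (\<Sum>i\<in>I. f i) x = (\<Sum>i\<in>I. cinner (f i :: 'h::chilbert_space) x)"
  by (induction I rule: infinite_finite_induct) (auto simp: cinner_add_left)

lemma cinner_eq_0_commute: "cinner x y = 0 \<longleftrightarrow> cinner y (x::'h::chilbert_space) = 0"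
  by (metis cinner_commute complex_cnj_zero)

lemma cinner_self_eq_0 [simp]: "cinner x x = 0 \<longleftrightarrow> x = (0::'h::chilbert_space)"
  by (simp add: cinner_self)

lemma cinner_ext:
  assumes "\<And>y. cinner y u = cinner y (v::'h::chilbert_space)"
  shows "u = v"
proof -
  have "cinner (u - v) (u - v) = 0"
    using assms by (simp add: cinner_diff_right)
  then show ?thesis by simp
qed

lemma norm_pythagoras:
  assumes "cinner x (y::'h::chilbert_space) = 0"
  shows "(norm (x + y))\<^sup>2 = (norm x)\<^sup>2 + (norm y)\<^sup>2"
proof -
  have "complex_of_real ((norm (x + y))\<^sup>2) = of_real ((norm x)\<^sup>2 + (norm y)\<^sup>2)"
    using assms cinner_eq_0_commute[of x y]
    by (simp only: cinner_self[symmetric] of_real_add cinner_add_left cinner_add_right) simp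
  then show ?thesis using of_real_eq_iff by blast
qed

lemma cinner_cauchy_schwarz: "cmod (cinner x y) \<le> norm x * norm (y::'h::chilbert_space)"
proof (cases "x = 0")
  case False
  define c where "c = cinner x y / of_real ((norm x)\<^sup>2)"
  have "cinner x (y - c *\<^sub>C x) = 0"
    using False by (simp add: cinner_diff_right cinner_scaleC_right cinner_self c_def)
  then have "cinner (c *\<^sub>C x) (y - c *\<^sub>C x) = 0"
    by (simp add: cinner_scaleC_left)
  from norm_pythagoras[OF this] have "(norm (c *\<^sub>C x))\<^sup>2 \<le> (norm y)\<^sup>2" by simp
  then have "norm (c *\<^sub>C x) \<le> norm y" by (simp add: power2_le_iff_abs_le)
  then have "cmod c * norm x \<le> norm y" by (simp add: norm_scaleC)
  moreover have "cmod c = cmod (cinner x y) / (norm x)\<^sup>2"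
    by (simp add: c_def norm_divide norm_power)
  ultimately show ?thesis using False
    by (simp add: field_simps power2_eq_square)
qed simp

lemma bounded_bilinear_cinner: "bounded_bilinear (cinner :: 'h::chilbert_space \<Rightarrow> 'h \<Rightarrow> complex)"
proof
  show "\<exists>K. \<forall>a b. norm (cinner a (b::'h)) \<le> norm a * norm b * K"
    by (rule exI[of _ 1]) (simp add: cinner_cauchy_schwarz)
qed (simp_all add: cinner_add_left cinner_add_right scaleR_scaleC cinner_scaleC_left
    cinner_scaleC_right scaleR_conv_of_real)

lemma bounded_bilinear_scaleC:
  "bounded_bilinear (scaleC :: complex \<Rightarrow> 'h::chilbert_space \<Rightarrow> 'h)"
proof
  show "\<exists>K. \<forall>a b. norm (a *\<^sub>C (b::'h)) \<le> norm a * norm b * K"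
    by (rule exI[of _ 1]) (simp add: norm_scaleC)
qed (simp_all add: scaleC_add_left scaleC_add_right scaleR_scaleC scaleC_scaleC
    scaleR_conv_of_real mult.commute)

lemmas bounded_linear_cinner_right = bounded_bilinear.bounded_linear_right[OF bounded_bilinear_cinner]
lemmas bounded_linear_scaleC_right = bounded_bilinear.bounded_linear_right[OF bounded_bilinear_scaleC]

section \<open>Finite orthonormal sets and the projections onto their spans\<close>

definition orthonormal :: "'h::chilbert_space set \<Rightarrow> bool" where
  "orthonormal B \<longleftrightarrow> (\<forall>x\<in>B. \<forall>y\<in>B. cinner x y = (if x = y then 1 else 0))"

text \<open>Intended for finite orthonormal \<open>F\<close>, where it is the orthogonal projection
  onto the span; for infinite \<open>F\<close> the sum defaults to 0.\<close>

definition orthonormal_proj :: "'h::chilbert_space set \<Rightarrow> 'h \<Rightarrow> 'h" where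
  "orthonormal_proj F x = (\<Sum>u\<in>F. cinner u x *\<^sub>C u)"

lemma orthonormalD: "orthonormal B \<Longrightarrow> x \<in> B \<Longrightarrow> y \<in> B \<Longrightarrow> cinner x y = (if x = y then 1 else 0)"
  by (auto simp: orthonormal_def)

lemma orthonormal_subset: "orthonormal B \<Longrightarrow> F \<subseteq> B \<Longrightarrow> orthonormal F"
  unfolding orthonormal_def by blast

lemma orthonormal_norm: "orthonormal B \<Longrightarrow> x \<in> B \<Longrightarrow> norm x = 1"
  using orthonormalD[of B x x] cinner_self[of x] of_real_eq_1_iff[of "(norm x)\<^sup>2"]
  by (simp add: power2_eq_1_iff del: of_real_power) (smt (verit) norm_ge_zero)

lemma orthonormal_proj_in_span: "orthonormal_proj F x \<in> complex_vector.span F"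
  unfolding orthonormal_proj_def
  by (intro complex_vector.span_sum complex_vector.span_scale complex_vector.span_base)

lemma cinner_orthonormal_proj:
  assumes "finite F" "orthonormal F" "u \<in> F"
  shows "cinner u (orthonormal_proj F x) = cinner u x"
proof -
  have "cinner u (orthonormal_proj F x) = (\<Sum>v\<in>F. if v = u then cinner u x else 0)"
    unfolding orthonormal_proj_def cinner_sum_right cinner_scaleC_right
    by (rule sum.cong) (auto simp: orthonormalD[OF assms(2)] assms)
  then show ?thesis using assms by simp
qed

lemma cinner_span_eq_0:
  assumes "\<And>u. u \<in> F \<Longrightarrow> cinner u x = 0" "y \<in> complex_vector.span F"
  shows "cinner y (x::'h::chilbert_space) = 0"
proof -
  have "complex_vector.span F \<subseteq> {y. cinner y x = 0}"
  proof (rule complex_vector.span_minimal)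
    show "complex_vector.subspace {y. cinner y x = 0}"
      by (auto simp: complex_vector.subspace_def cinner_add_left cinner_scaleC_left)
  qed (use assms in auto)
  then show ?thesis using assms by auto
qed

lemma cinner_diff_orthonormal_proj:
  assumes "finite F" "orthonormal F" "y \<in> complex_vector.span F"
  shows "cinner y (x - orthonormal_proj F x) = 0"
  by (rule cinner_span_eq_0[OF _ assms(3)]) (simp add: cinner_diff_right cinner_orthonormal_proj assms)

text \<open>The residual is orthogonal to the span, so any other point of the span adds a leg to a
  right triangle. This inequality later turns density of a span into convergence of orthonormal
  expansions.\<close>

lemma orthonormal_proj_best:
  assumes "finite F" "orthonormal F" "y \<in> complex_vector.span F"
  shows "norm (x - orthonormal_proj F x) \<le> norm (x - y)"
proof -
  have "cinner (orthonormal_proj F x - y) (x - orthonormal_proj F x) = 0"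
    by (intro cinner_diff_orthonormal_proj assms complex_vector.span_diff orthonormal_proj_in_span)
  from norm_pythagoras[OF this]
  have "(norm (x - orthonormal_proj F x))\<^sup>2 \<le> (norm (x - y))\<^sup>2" by simp
  then show ?thesis by (simp add: power2_le_iff_abs_le)
qed

lemma orthonormal_proj_id:
  assumes "finite F" "orthonormal F" "x \<in> complex_vector.span F"
  shows "orthonormal_proj F x = x"
  using orthonormal_proj_best[OF assms, of x] by simp

lemma norm_orthonormal_sum:
  assumes "finite F" "orthonormal F"
  shows "(norm (\<Sum>u\<in>F. c u *\<^sub>C u))\<^sup>2 = (\<Sum>u\<in>F. (cmod (c u))\<^sup>2)"
proof -
  define S where "S = (\<Sum>u\<in>F. c u *\<^sub>C u)"
  have coeff: "cinner u S = c u" if "u \<in> F" for u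
  proof -
    have "cinner u S = (\<Sum>v\<in>F. if v = u then c u else 0)"
      unfolding S_def cinner_sum_right cinner_scaleC_right
      by (rule sum.cong) (auto simp: orthonormalD[OF assms(2)] that)
    then show ?thesis using assms that by simp
  qed
  have "complex_of_real ((norm S)\<^sup>2) = (\<Sum>u\<in>F. cnj (c u) * cinner u S)"
    unfolding cinner_self[symmetric] by (subst (1) S_def) (simp add: cinner_sum_left cinner_scaleC_left)
  also have "\<dots> = (\<Sum>u\<in>F. cnj (c u) * c u)"
    by (rule sum.cong) (simp_all add: coeff)
  also have "\<dots> = of_real (\<Sum>u\<in>F. (cmod (c u))\<^sup>2)"
    unfolding of_real_sum by (rule sum.cong) (simp_all only: complex_norm_square mult.commute)
  finally show ?thesis unfolding S_def using of_real_eq_iff by blast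
qed

lemma orthonormal_proj_pythagoras:
  assumes "finite F" "orthonormal F"
  shows "(norm x)\<^sup>2 = (norm (orthonormal_proj F x))\<^sup>2 + (norm (x - orthonormal_proj F x))\<^sup>2"
  using norm_pythagoras[OF cinner_diff_orthonormal_proj[OF assms orthonormal_proj_in_span, of x x]]
  by simp

lemma norm_orthonormal_proj_le:
  assumes "finite F" "orthonormal F"
  shows "norm (orthonormal_proj F x) \<le> norm x"
proof -
  have "(norm (orthonormal_proj F x))\<^sup>2 \<le> (norm x)\<^sup>2"
    using orthonormal_proj_pythagoras[OF assms, of x] by simp
  then show ?thesis by (simp add: power2_le_iff_abs_le)
qed

lemma norm_diff_orthonormal_proj_le:
  assumes "finite F" "orthonormal F"
  shows "norm (x - orthonormal_proj F x) \<le> norm x"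
  using orthonormal_proj_best[OF assms complex_vector.span_zero, of x] by simp

lemma bessel_inequality:
  assumes "finite F" "orthonormal F"
  shows "(\<Sum>u\<in>F. (cmod (cinner u x))\<^sup>2) \<le> (norm x)\<^sup>2"
  using orthonormal_proj_pythagoras[OF assms, of x] norm_orthonormal_sum[OF assms]
  by (simp add: orthonormal_proj_def)

lemma orthonormal_independent:
  assumes "orthonormal B"
  shows "complex_vector.independent B"
proof -
  have "u v = 0"
    if "finite t" "t \<subseteq> B" "(\<Sum>v\<in>t. u v *\<^sub>C v) = 0" "v \<in> t" for t u v
  proof -
    have "(\<Sum>v\<in>t. (cmod (u v))\<^sup>2) = 0"
      using norm_orthonormal_sum[OF that(1) orthonormal_subset[OF assms that(2)], of u] that(3) by simp
    then show ?thesis using that by (simp add: sum_nonneg_eq_0_iff)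
  qed
  then show ?thesis unfolding complex_vector.independent_explicit_module by blast
qed

lemma orthonormal_insert:
  assumes "orthonormal F" "norm x = 1" "\<And>u. u \<in> F \<Longrightarrow> cinner u x = 0"
  shows "orthonormal (insert x F)"
proof -
  have "x \<notin> F"
    using assms(2,3) by force
  then show ?thesis
    using assms cinner_eq_0_commute[of x] by (auto simp: orthonormal_def cinner_self)
qed

lemma norm_normalize:
  assumes "x \<noteq> (0::'h::chilbert_space)"
  shows "norm (complex_of_real (inverse (norm x)) *\<^sub>C x) = 1"
  using assms by (simp add: norm_scaleC norm_inverse del: of_real_inverse)

text \<open>Each new vector loses its projection onto the earlier ones and is normalised, or dropped
  if nothing remains. The cardinality is tracked because it bounds the rank of operators
  later.\<close>

lemma gram_schmidt:
  assumes "finite B"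
  shows "\<exists>F. finite F \<and> orthonormal F \<and> card F \<le> card B \<and>
    complex_vector.span F = complex_vector.span (B :: 'h::chilbert_space set)"
  using assms
proof (induction B)
  case empty
  then show ?case by (intro exI[of _ "{}"]) (auto simp: orthonormal_def)
next
  case (insert b B)
  then obtain F where F: "finite F" "orthonormal F" "card F \<le> card B"
      "complex_vector.span F = complex_vector.span B"
    by auto
  define y where "y = b - orthonormal_proj F b"
  show ?case
  proof (cases "y = 0")
    case True
    then have "b \<in> complex_vector.span B"
      using orthonormal_proj_in_span[of F b] F by (simp add: y_def)
    then have "complex_vector.span (insert b B) = complex_vector.span B"
      by (rule complex_vector.span_redundant)
    then show ?thesis using F insert.hyps by (intro exI[of _ F]) auto
  next
    case False
    define c where "c = complex_of_real (inverse (norm y))"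
    have c: "c \<noteq> 0" using False by (simp add: c_def)
    have "orthonormal (insert (c *\<^sub>C y) F)"
    proof (rule orthonormal_insert)
      show "norm (c *\<^sub>C y) = 1" unfolding c_def by (rule norm_normalize[OF False])
      fix u assume "u \<in> F"
      then show "cinner u (c *\<^sub>C y) = 0"
        using cinner_diff_orthonormal_proj[OF F(1,2), of u b]
        by (simp add: cinner_scaleC_right y_def complex_vector.span_base)
    qed (use F in auto)
    moreover have "complex_vector.span (insert (c *\<^sub>C y) F) = complex_vector.span (insert b B)"
    proof (rule complex_vector.span_eq[THEN iffD2], intro conjI subsetI)
      fix x assume "x \<in> insert (c *\<^sub>C y) F"
      moreover have "complex_vector.span F \<subseteq> complex_vector.span (insert b B)"
        unfolding F(4) by (rule complex_vector.span_mono) auto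
      moreover have "c *\<^sub>C y \<in> complex_vector.span (insert b B)"
        unfolding y_def
        by (intro complex_vector.span_scale complex_vector.span_diff)
          (use calculation orthonormal_proj_in_span[of F b] in \<open>auto intro: complex_vector.span_base\<close>)
      ultimately show "x \<in> complex_vector.span (insert b B)"
        using complex_vector.span_base[of x F] by auto
    next
      fix x assume "x \<in> insert b B"
      moreover have *: "complex_vector.span F \<subseteq> complex_vector.span (insert (c *\<^sub>C y) F)"
        by (rule complex_vector.span_mono) auto
      moreover have "inverse c *\<^sub>C (c *\<^sub>C y) + orthonormal_proj F b \<in> complex_vector.span (insert (c *\<^sub>C y) F)"
      proof (rule complex_vector.span_add)
        show "inverse c *\<^sub>C c *\<^sub>C y \<in> complex_vector.span (insert (c *\<^sub>C y) F)"
          by (rule complex_vector.span_scale, rule complex_vector.span_base) simp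
        show "orthonormal_proj F b \<in> complex_vector.span (insert (c *\<^sub>C y) F)"
          using * orthonormal_proj_in_span[of F b] by blast
      qed
      moreover have "inverse c *\<^sub>C (c *\<^sub>C y) + orthonormal_proj F b = b"
        using c by (simp add: y_def)
      ultimately show "x \<in> complex_vector.span (insert (c *\<^sub>C y) F)"
        using complex_vector.span_base[of x B] F(4) by auto
    qed
    moreover have "card (insert (c *\<^sub>C y) F) \<le> card (insert b B)"
      using F insert.hyps by (metis card_insert_disjoint card_insert_le_m1 Suc_le_mono card_insert_if le_SucI)
    ultimately show ?thesis using F by (intro exI[of _ "insert (c *\<^sub>C y) F"]) auto
  qed
qed


section \<open>Orthonormal bases\<close>

lemma orthonormal_basis_iff:
  "orthonormal_basis B \<longleftrightarrow> orthonormal B \<and> closure (complex_vector.span B) = UNIV"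
  by (simp add: orthonormal_basis_def orthonormal_def)

lemma span_finite_subset:
  assumes "y \<in> complex_vector.span B"
  shows "\<exists>F. finite F \<and> F \<subseteq> B \<and> y \<in> complex_vector.span (F :: 'h::complex_vector set)"
proof -
  obtain t r where t: "finite t" "t \<subseteq> B" "y = (\<Sum>a\<in>t. r a *\<^sub>C a)"
    using assms unfolding complex_vector.span_explicit by blast
  then have "y \<in> complex_vector.span t"
    by (auto intro!: complex_vector.span_sum complex_vector.span_scale intro: complex_vector.span_base)
  then show ?thesis using t by blast
qed

text \<open>A point y of the span near x already lies in the span of a finite \<open>F\<close>, and
  by \<open>orthonormal_proj_best\<close> the partial sum over any larger finite set is at least as
  close to x as y is.\<close>

lemma orthonormal_expansion:
  assumes "orthonormal B" "x \<in> closure (complex_vector.span B)"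
  shows "((\<lambda>u. cinner u x *\<^sub>C u) has_sum x) B"
  unfolding has_sum_def tendsto_iff eventually_finite_subsets_at_top
proof (intro allI impI)
  fix e :: real assume "e > 0"
  then obtain y where y: "y \<in> complex_vector.span B" "dist y x < e"
    using assms(2) closure_approachable by blast
  obtain F where F: "finite F" "F \<subseteq> B" "y \<in> complex_vector.span F"
    using span_finite_subset[OF y(1)] by blast
  show "\<exists>X. finite X \<and> X \<subseteq> B \<and>
      (\<forall>Y. finite Y \<and> X \<subseteq> Y \<and> Y \<subseteq> B \<longrightarrow> dist (\<Sum>u\<in>Y. cinner u x *\<^sub>C u) x < e)"
  proof (intro exI[of _ F] conjI allI impI F)
    fix Y assume Y: "finite Y \<and> F \<subseteq> Y \<and> Y \<subseteq> B"
    then have "y \<in> complex_vector.span Y"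
      using F(3) complex_vector.span_mono by blast
    then have "norm (x - orthonormal_proj Y x) \<le> norm (x - y)"
      using Y orthonormal_subset[OF assms(1)] by (intro orthonormal_proj_best) auto
    then show "dist (\<Sum>u\<in>Y. cinner u x *\<^sub>C u) x < e"
      using y(2) by (simp add: orthonormal_proj_def dist_norm norm_minus_commute)
  qed
qed

lemma orthonormal_summable:
  assumes B: "orthonormal (B :: 'h::chilbert_space set)"
  shows "(\<lambda>u. cinner u x *\<^sub>C u) summable_on B"
proof -
  define g where "g F = (\<Sum>u\<in>F. (cmod (cinner u x))\<^sup>2)" for F
  define f where "f = (\<lambda>F. \<Sum>u\<in>F. cinner u x *\<^sub>C u)"
  define S where "S = Sup (g ` {F. F \<subseteq> B \<and> finite F})"
  have bdd: "bdd_above (g ` {F. F \<subseteq> B \<and> finite F})"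
    unfolding g_def using bessel_inequality[OF _ orthonormal_subset[OF B]] by (auto intro!: bdd_aboveI2)
  have le_S: "g F \<le> S" if "F \<subseteq> B" "finite F" for F
    unfolding S_def using that by (intro cSup_upper bdd) auto
  have "\<exists>P. eventually P (finite_subsets_at_top B) \<and>
              (\<forall>F F'. P F \<and> P F' \<longrightarrow> dist (f F) (f F') < e)" if "e > 0" for e
  proof -
    \<comment> \<open>\<open>F0\<close> nearly attains the supremum of the sums of squared
      coefficients, so any finite sum of terms outside \<open>F0\<close> has norm below e/2.\<close>
    have "S - (e / 2)\<^sup>2 < S" using that by simp
    then have "\<exists>y\<in>g ` {F. F \<subseteq> B \<and> finite F}. S - (e / 2)\<^sup>2 < y"
      by (subst less_cSup_iff[OF _ bdd, symmetric]) (auto simp flip: S_def)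
    then obtain F0 where F0: "F0 \<subseteq> B" "finite F0" "S - (e / 2)\<^sup>2 < g F0"
      by blast
    have near: "dist (f F) (f F0) < e / 2" if F: "finite F" "F0 \<subseteq> F" "F \<subseteq> B" for F
    proof -
      have "f F - f F0 = (\<Sum>u\<in>F - F0. cinner u x *\<^sub>C u)"
        unfolding f_def by (rule sum_diff[symmetric]) (rule F)+
      then have "(norm (f F - f F0))\<^sup>2 = g (F - F0)"
        unfolding g_def using F
        by (simp add: norm_orthonormal_sum[OF _ orthonormal_subset[OF B, of "F - F0"]] le_supI1 Diff_subset[THEN subset_trans])
      also have "\<dots> = g F - g F0"
        unfolding g_def by (rule sum_diff) (rule F)+
      also have "\<dots> < (e / 2)\<^sup>2" using le_S[of F] F F0 by simp
      finally have "norm (f F - f F0) < e / 2"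
        by (rule power_less_imp_less_base) (use \<open>e > 0\<close> in simp)
      then show ?thesis by (simp add: dist_norm)
    qed
    show ?thesis
    proof (intro exI[of _ "\<lambda>F. finite F \<and> F0 \<subseteq> F \<and> F \<subseteq> B"] conjI allI impI)
      show "eventually (\<lambda>F. finite F \<and> F0 \<subseteq> F \<and> F \<subseteq> B) (finite_subsets_at_top B)"
        unfolding eventually_finite_subsets_at_top using F0 by blast
      fix F F' assume "(finite F \<and> F0 \<subseteq> F \<and> F \<subseteq> B) \<and> (finite F' \<and> F0 \<subseteq> F' \<and> F' \<subseteq> B)"
      then show "dist (f F) (f F') < e"
        using near[of F] near[of F'] dist_triangle2[of "f F" "f F'" "f F0"] by simp
    qed
  qed
  then have "cauchy_filter (filtermap f (finite_subsets_at_top B))"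
    by (simp add: cauchy_filter_metric_filtermap)
  \<comment> \<open>The finite subsets of a possibly uncountable \<open>B\<close> form a net rather
    than a sequence, so completeness enters through Cauchy filters.\<close>
  moreover have "complete (UNIV::'h set)"
    by (meson Cauchy_convergent UNIV_I complete_def convergent_def)
  ultimately obtain L where "(f \<longlongrightarrow> L) (finite_subsets_at_top B)"
    using complete_uniform[where S=UNIV] by (force simp add: filterlim_def)
  then show ?thesis
    unfolding f_def summable_on_def has_sum_def by blast
qed

text \<open>Zorn's lemma gives a maximal orthonormal set, and the normalised residual of a vector
  outside its closed span could be adjoined to it. Existence matters for traces: without any basis,
  \<open>has_trace\<close> would hold vacuously for every value.\<close>

lemma orthonormal_basis_exists: "\<exists>B. orthonormal_basis (B :: 'h::chilbert_space set)"
proof -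
  have "\<exists>M\<in>Collect orthonormal. \<forall>X\<in>Collect orthonormal. M \<subseteq> X \<longrightarrow> X = (M :: 'h set)"
  proof (rule subset_Zorn')
    fix C assume "subset.chain (Collect orthonormal) (C :: 'h set set)"
    then have C: "\<And>F. F \<in> C \<Longrightarrow> orthonormal F" "\<And>F G. F \<in> C \<Longrightarrow> G \<in> C \<Longrightarrow> F \<subseteq> G \<or> G \<subseteq> F"
      by (auto simp: subset_chain_def)
    show "\<Union>C \<in> Collect orthonormal"
      unfolding mem_Collect_eq orthonormal_def
    proof (intro ballI)
      fix x y assume "x \<in> \<Union>C" "y \<in> \<Union>C"
      then obtain F G where "F \<in> C" "G \<in> C" "x \<in> F" "y \<in> G" by blast
      then obtain H where "H \<in> C" "x \<in> H" "y \<in> H" using C(2)[of F G] by blast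
      then show "cinner x y = (if x = y then 1 else 0)" by (intro orthonormalD[OF C(1)])
    qed
  qed
  then obtain B :: "'h set" where B: "orthonormal B"
      "\<And>X. orthonormal X \<Longrightarrow> B \<subseteq> X \<Longrightarrow> X = B"
    by auto
  have "x \<in> closure (complex_vector.span B)" for x
  proof -
    let ?f = "\<lambda>u. cinner u x *\<^sub>C u"
    obtain p where p: "(?f has_sum p) B"
      using orthonormal_summable[OF B(1), of x] by (auto simp: summable_on_def)
    have orth: "cinner u (x - p) = 0" if "u \<in> B" for u
    proof -
      have "((\<lambda>v. cinner u (?f v)) has_sum cinner u p) B"
        using has_sum_bounded_linear[OF bounded_linear_cinner_right p] by (simp add: o_def)
      moreover have "((\<lambda>v. cinner u (?f v)) has_sum cinner u x) B \<longleftrightarrow>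
          ((\<lambda>v. cinner u x) has_sum cinner u x) {u}"
        using that by (intro has_sum_cong_neutral) (auto simp: cinner_scaleC_right orthonormalD[OF B(1)])
      moreover have "((\<lambda>v. cinner u x) has_sum cinner u x) {u}"
        by (rule has_sum_finiteI) auto
      ultimately have "cinner u p = cinner u x"
        using has_sum_unique by blast
      then show ?thesis
        by (simp add: cinner_diff_right)
    qed
    have "x - p = 0"
    proof (rule ccontr)
      assume nz: "x - p \<noteq> 0"
      define y where "y = complex_of_real (inverse (norm (x - p))) *\<^sub>C (x - p)"
      have "orthonormal (insert y B)"
        using B(1) norm_normalize[OF nz] orth
        by (intro orthonormal_insert) (auto simp: y_def cinner_scaleC_right)
      then have "y \<in> B" using B(2)[of "insert y B"] by auto
      then have "cinner y (x - p) = 0" by (rule orth)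
      then show False using nz by (simp add: y_def cinner_scaleC_left)
    qed
    moreover have "p \<in> closure (complex_vector.span B)"
      unfolding closure_approachable
    proof (intro allI impI)
      fix e :: real assume "e > 0"
      then obtain F where "finite F" "F \<subseteq> B" "dist (sum ?f F) p \<le> e / 2"
        using has_sum_finite_approximation[OF p, of "e / 2"] by auto
      then show "\<exists>y\<in>complex_vector.span B. dist y p < e"
        using \<open>e > 0\<close>
        by (intro bexI[of _ "sum ?f F"])
          (auto intro!: complex_vector.span_sum complex_vector.span_scale intro: complex_vector.span_base)
    qed
    ultimately show ?thesis by simp
  qed
  then show ?thesis using B(1) by (auto simp: orthonormal_basis_iff)
qed

section \<open>Bounded operators\<close>

lemma bounded_clinearI:
  assumes "\<And>x y. T (x + y) = T x + T y" "\<And>c x. T (c *\<^sub>C x) = c *\<^sub>C T x"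
    and "\<And>x. norm (T x) \<le> K * norm x"
  shows "bounded_clinear (T :: 'a::chilbert_space \<Rightarrow> 'b::chilbert_space)"
  unfolding bounded_clinear_def
proof
  show "bounded_linear T"
    by (rule bounded_linear_intro[where K=K]) (simp_all add: assms scaleR_scaleC mult.commute)
qed (use assms in blast)

lemma bounded_clinear_bounded_linear: "bounded_clinear T \<Longrightarrow> bounded_linear T"
  by (simp add: bounded_clinear_def)

lemma bounded_clinear_scaleC: "bounded_clinear T \<Longrightarrow> T (c *\<^sub>C x) = c *\<^sub>C T x"
  by (simp add: bounded_clinear_def)

lemmas bounded_clinear_add = linear_add[OF bounded_linear.linear[OF bounded_clinear_bounded_linear]]
lemmas bounded_clinear_diff = linear_diff[OF bounded_linear.linear[OF bounded_clinear_bounded_linear]]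
lemmas bounded_clinear_minus = linear_neg[OF bounded_linear.linear[OF bounded_clinear_bounded_linear]]
lemmas bounded_clinear_0 = linear_0[OF bounded_linear.linear[OF bounded_clinear_bounded_linear]]
lemmas bounded_clinear_sum = linear_sum[OF bounded_linear.linear[OF bounded_clinear_bounded_linear]]
lemmas bounded_clinear_simps = bounded_clinear_add bounded_clinear_diff bounded_clinear_minus
  bounded_clinear_0 bounded_clinear_scaleC

lemma bounded_clinear_bound:
  assumes "bounded_clinear T"
  obtains K where "K > 0" "\<And>x. norm (T x) \<le> K * norm x"
  using bounded_linear.pos_bounded[OF bounded_clinear_bounded_linear[OF assms]]
  by (metis mult.commute)

lemma bounded_clinear_linear:
  assumes "bounded_clinear T"
  shows "Vector_Spaces.linear scaleC scaleC T"
  using bounded_clinear_add[OF assms] bounded_clinear_scaleC[OF assms]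
  by unfold_locales auto

lemma bounded_clinear_compose:
  assumes "bounded_clinear S" "bounded_clinear T"
  shows "bounded_clinear (S \<circ> T)"
  using assms bounded_linear_compose[of S T] by (auto simp: bounded_clinear_def o_def)

lemma bounded_clinear_plus:
  assumes "bounded_clinear S" "bounded_clinear T"
  shows "bounded_clinear (\<lambda>x. S x + T x)"
  using assms bounded_linear_add[of S T] by (auto simp: bounded_clinear_def scaleC_add_right)

lemma bounded_clinear_uminus:
  assumes "bounded_clinear T"
  shows "bounded_clinear (\<lambda>x. - T x)"
  using assms bounded_linear_minus[of T] by (auto simp: bounded_clinear_def)

lemma bounded_clinear_minus_op:
  assumes "bounded_clinear S" "bounded_clinear T"
  shows "bounded_clinear (\<lambda>x. S x - T x)"
  using bounded_clinear_plus[OF assms(1) bounded_clinear_uminus[OF assms(2)]] by simp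

lemma bounded_clinear_zero: "bounded_clinear (\<lambda>x. 0)"
  by (simp add: bounded_clinear_def bounded_linear_zero)

lemma bounded_clinear_ident: "bounded_clinear (\<lambda>x. x)"
  by (simp add: bounded_clinear_def bounded_linear_ident)

lemma bounded_clinear_funpow:
  "bounded_clinear (T :: 'h::chilbert_space \<Rightarrow> 'h) \<Longrightarrow> bounded_clinear (T ^^ n)"
  by (induction n) (simp_all add: id_def bounded_clinear_compose bounded_clinear_ident)

lemma bounded_clinear_scale_vector: "bounded_clinear (\<lambda>x. c *\<^sub>C (x::'h::chilbert_space))"
  unfolding bounded_clinear_def
  by (simp add: bounded_linear_scaleC_right scaleC_scaleC mult.commute)

lemma bounded_clinear_orthonormal_proj:
  assumes "finite F" "orthonormal F"
  shows "bounded_clinear (orthonormal_proj F)"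
proof (rule bounded_clinearI[where K=1])
  show "norm (orthonormal_proj F x) \<le> 1 * norm x" for x
    using norm_orthonormal_proj_le[OF assms] by simp
qed (simp_all add: orthonormal_proj_def cinner_add_right scaleC_add_left sum.distrib
    cinner_scaleC_right complex_vector.scale_sum_right)

lemma span_image_bounded_clinear:
  assumes "bounded_clinear T"
  shows "complex_vector.span (T ` F) = T ` complex_vector.span F"
proof -
  interpret vector_space_pair "scaleC :: complex \<Rightarrow> 'a \<Rightarrow> 'a" "scaleC :: complex \<Rightarrow> 'b \<Rightarrow> 'b" ..
  show ?thesis by (rule linear_span_image[OF bounded_clinear_linear[OF assms]])
qed

section \<open>Operators of finite rank\<close>

definition rank_at_most :: "nat \<Rightarrow> ('h::chilbert_space \<Rightarrow> 'h) \<Rightarrow> bool" where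
  "rank_at_most k X \<longleftrightarrow> bounded_clinear X \<and>
     (\<exists>F. finite F \<and> card F \<le> k \<and> range X \<subseteq> complex_vector.span F)"

lemma rank_at_mostE:
  assumes "rank_at_most k X"
  obtains F where "finite F" "orthonormal F" "card F \<le> k" "range X \<subseteq> complex_vector.span F"
proof -
  obtain B where "finite B" "card B \<le> k" "range X \<subseteq> complex_vector.span B"
    using assms by (auto simp: rank_at_most_def)
  then show ?thesis using gram_schmidt[of B] that by (metis le_trans)
qed

lemma rank_at_most_bounded: "rank_at_most k X \<Longrightarrow> bounded_clinear X"
  by (simp add: rank_at_most_def)

lemma rank_at_most_mono: "rank_at_most k X \<Longrightarrow> k \<le> m \<Longrightarrow> rank_at_most m X"
  unfolding rank_at_most_def using le_trans by blast

lemma rank_at_most_zero: "rank_at_most k (\<lambda>x. 0)"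
  unfolding rank_at_most_def by (auto intro!: bounded_clinear_zero exI[of _ "{}"])

lemma rank_at_most_orthonormal_proj:
  "finite F \<Longrightarrow> orthonormal F \<Longrightarrow> rank_at_most (card F) (orthonormal_proj F)"
  unfolding rank_at_most_def using orthonormal_proj_in_span bounded_clinear_orthonormal_proj by blast

lemma rank_at_most_comp_right:
  assumes "rank_at_most k X" "bounded_clinear S"
  shows "rank_at_most k (X \<circ> S)"
proof -
  have "range (X \<circ> S) \<subseteq> range X" by auto
  then show ?thesis
    using assms bounded_clinear_compose[of X S] unfolding rank_at_most_def by blast
qed

lemma rank_at_most_comp_left:
  assumes "rank_at_most k X" "bounded_clinear S"
  shows "rank_at_most k (S \<circ> X)"
proof -
  obtain F where F: "finite F" "card F \<le> k" "range X \<subseteq> complex_vector.span F"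
    using assms by (auto simp: rank_at_most_def)
  then have "range (S \<circ> X) \<subseteq> complex_vector.span (S ` F)"
    by (auto simp: span_image_bounded_clinear[OF assms(2)])
  moreover have "card (S ` F) \<le> k"
    using F card_image_le le_trans by blast
  ultimately show ?thesis
    using F assms bounded_clinear_compose[of S X] unfolding rank_at_most_def by blast
qed

lemma rank_at_most_add:
  assumes "rank_at_most k X" "rank_at_most m Y"
  shows "rank_at_most (k + m) (\<lambda>x. X x + Y x)"
proof -
  obtain F G where FG: "finite F" "card F \<le> k" "range X \<subseteq> complex_vector.span F"
      "finite G" "card G \<le> m" "range Y \<subseteq> complex_vector.span G"
    using assms by (auto simp: rank_at_most_def)
  have "X x + Y x \<in> complex_vector.span (F \<union> G)" for x
    using FG complex_vector.span_mono[of F "F \<union> G"] complex_vector.span_mono[of G "F \<union> G"]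
    by (intro complex_vector.span_add) auto
  moreover have "card (F \<union> G) \<le> k + m"
    using FG card_Un_le[of F G] by linarith
  ultimately show ?thesis
    using FG assms bounded_clinear_plus[of X Y] unfolding rank_at_most_def by blast
qed

lemma rank_at_most_uminus: "rank_at_most k X \<Longrightarrow> rank_at_most k (\<lambda>x. - X x)"
  unfolding rank_at_most_def
  by (auto intro: bounded_clinear_uminus complex_vector.span_neg)

lemma rank_at_most_diff:
  "rank_at_most k X \<Longrightarrow> rank_at_most m Y \<Longrightarrow> rank_at_most (k + m) (\<lambda>x. X x - Y x)"
  using rank_at_most_add[OF _ rank_at_most_uminus] by fastforce

section \<open>The trace of nuclear operators\<close>

text \<open>The predicate inside the definite description of \<open>trace_operator\<close>. As a
  relation it can be added, negated and compared before the description is known to denote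
  anything.\<close>

definition has_trace :: "('h::chilbert_space \<Rightarrow> 'h) \<Rightarrow> complex \<Rightarrow> bool" where
  "has_trace X t \<longleftrightarrow> (\<forall>B. orthonormal_basis B \<longrightarrow> ((\<lambda>x. cinner x (X x)) has_sum t) B)"

lemma has_trace_unique:
  assumes "has_trace X t" "has_trace (X :: 'h::chilbert_space \<Rightarrow> 'h) s"
  shows "t = s"
proof -
  obtain B :: "'h set" where "orthonormal_basis B" using orthonormal_basis_exists by blast
  then show ?thesis using assms has_sum_unique unfolding has_trace_def by blast
qed

lemma trace_operator_eq: "has_trace X t \<Longrightarrow> trace_operator X = t"
  unfolding trace_operator_def
  by (rule the_equality) (use has_trace_unique in \<open>auto simp: has_trace_def\<close>)

lemma has_trace_add: "has_trace X t \<Longrightarrow> has_trace Y s \<Longrightarrow> has_trace (\<lambda>x. X x + Y x) (t + s)"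
  unfolding has_trace_def cinner_add_right using has_sum_add by blast

lemma has_trace_uminus: "has_trace X t \<Longrightarrow> has_trace (\<lambda>x. - X x) (- t)"
  unfolding has_trace_def by (simp add: has_sum_uminus)

lemma has_trace_diff: "has_trace X t \<Longrightarrow> has_trace Y s \<Longrightarrow> has_trace (\<lambda>x. X x - Y x) (t - s)"
  using has_trace_add[OF _ has_trace_uminus] by fastforce

lemma has_trace_adjoint:
  assumes "has_trace X t" "\<And>x y. cinner (X x) y = cinner x (Y y)"
  shows "has_trace Y (cnj t)"
  unfolding has_trace_def
proof (intro allI impI)
  fix B :: "'a set" assume "orthonormal_basis B"
  then have "((\<lambda>x. cnj (cinner x (X x))) has_sum cnj t) B"
    using assms(1) has_sum_bounded_linear[OF bounded_linear_cnj] by (auto simp: has_trace_def)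
  moreover have "cnj (cinner x (X x)) = cinner x (Y x)" for x
    using assms(2) cinner_commute by metis
  ultimately show "((\<lambda>x. cinner x (Y x)) has_sum cnj t) B" by simp
qed

text \<open>\<open>X\<close> is a sum of rank one operators whose norms are bounded by the summable
  numbers c i M. The coefficients are functionals rather than inner products with vectors, so that
  composition with a bounded operator on the right calls for no adjoint.\<close>

definition nuclear_expansion ::
    "'i set \<Rightarrow> ('i \<Rightarrow> 'h::chilbert_space \<Rightarrow> complex) \<Rightarrow> ('i \<Rightarrow> 'h) \<Rightarrow> ('h \<Rightarrow> 'h) \<Rightarrow> bool" where
  "nuclear_expansion I \<phi> b X \<longleftrightarrow> (\<exists>c M. c summable_on I \<and> (\<forall>i\<in>I. c i \<ge> 0) \<and> M \<ge> (0::real) \<and>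
     (\<forall>i\<in>I. \<forall>x y. \<phi> i (x + y) = \<phi> i x + \<phi> i y) \<and> (\<forall>i\<in>I. \<forall>a x. \<phi> i (a *\<^sub>C x) = a * \<phi> i x) \<and>
     (\<forall>i\<in>I. \<forall>x. cmod (\<phi> i x) \<le> c i * norm x) \<and> (\<forall>i\<in>I. norm (b i) \<le> M) \<and>
     (\<forall>x. ((\<lambda>i. \<phi> i x *\<^sub>C b i) has_sum X x) I))"

text \<open>Evaluating \<open>\<phi>\<close> at the sum y of the vectors
  \<open>cnj (\<phi> u) *\<^sub>C u\<close> gives the left side s, while y has norm sqrt s; hence s
  \<le> c sqrt s. This is Bessel's inequality without a vector representing the functional.\<close>

lemma bessel_functional:
  assumes F: "finite F" "orthonormal (F :: 'h::chilbert_space set)"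
    and \<phi>: "\<And>x y. \<phi> (x + y) = \<phi> x + \<phi> y" "\<And>a x. \<phi> (a *\<^sub>C x) = a * \<phi> x"
      "\<And>x. cmod (\<phi> x) \<le> c * norm x" and "c \<ge> 0"
  shows "(\<Sum>u\<in>F. (cmod (\<phi> u))\<^sup>2) \<le> c\<^sup>2"
proof -
  define s where "s = (\<Sum>u\<in>F. (cmod (\<phi> u))\<^sup>2)"
  define y where "y = (\<Sum>u\<in>F. cnj (\<phi> u) *\<^sub>C u)"
  have "\<phi> 0 = 0" using \<phi>(1)[of 0 0] by simp
  then have "\<phi> (sum g F) = (\<Sum>u\<in>F. \<phi> (g u))" for g
    using sum_comp_morphism[of \<phi> g F] \<phi>(1) by (simp add: o_def)
  then have "\<phi> y = (\<Sum>u\<in>F. cnj (\<phi> u) * \<phi> u)"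
    by (simp add: y_def \<phi>)
  also have "\<dots> = of_real s"
    unfolding s_def of_real_sum by (rule sum.cong) (simp_all only: complex_norm_square mult.commute)
  finally have "cmod (\<phi> y) = s"
    by (simp add: norm_of_real) (simp add: s_def sum_nonneg)
  then have "s \<le> c * norm y" using \<phi>(3)[of y] by simp
  then have "s\<^sup>2 \<le> (c * norm y)\<^sup>2"
    by (intro power_mono) (auto simp: s_def sum_nonneg)
  moreover have "(norm y)\<^sup>2 = s"
    unfolding y_def s_def using norm_orthonormal_sum[OF F] by simp
  ultimately have "s * s \<le> c\<^sup>2 * s" by (simp add: power2_eq_square power_mult_distrib mult_ac)
  moreover have "s \<ge> 0" by (simp add: s_def sum_nonneg)
  ultimately show ?thesis
    unfolding s_def[symmetric] by (cases "s = 0") auto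
qed

text \<open>Cauchy-Schwarz and the two Bessel inequalities bound the sum over a basis of the
  absolute values of \<open>\<phi> i x * cinner x (b i)\<close> by c i M, which is summable over i.
  So the order of summation may be exchanged; summing over the basis first leaves
  \<open>\<phi> i (b i)\<close>, in which the basis no longer occurs.\<close>

lemma nuclear_expansion_trace:
  assumes "nuclear_expansion I \<phi> b X"
  shows "has_trace X (infsum (\<lambda>i. \<phi> i (b i)) I)"
  unfolding has_trace_def
proof (intro allI impI)
  fix B :: "'b set" assume "orthonormal_basis B"
  then have B: "orthonormal B" "closure (complex_vector.span B) = UNIV"
    by (auto simp: orthonormal_basis_iff)
  obtain c M where *: "c summable_on I" "\<forall>i\<in>I. c i \<ge> 0" "M \<ge> 0"
     "\<forall>i\<in>I. \<forall>x y. \<phi> i (x + y) = \<phi> i x + \<phi> i y" "\<forall>i\<in>I. \<forall>a x. \<phi> i (a *\<^sub>C x) = a * \<phi> i x"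
     "\<forall>i\<in>I. \<forall>x. cmod (\<phi> i x) \<le> c i * norm x" "\<forall>i\<in>I. norm (b i) \<le> M"
     "\<forall>x. ((\<lambda>i. \<phi> i x *\<^sub>C b i) has_sum X x) I"
    using assms unfolding nuclear_expansion_def by blast
  then have c: "c summable_on I" "\<And>i. i \<in> I \<Longrightarrow> c i \<ge> 0" and M: "M \<ge> 0"
    and \<phi>: "\<And>i x y. i \<in> I \<Longrightarrow> \<phi> i (x + y) = \<phi> i x + \<phi> i y"
      "\<And>i a x. i \<in> I \<Longrightarrow> \<phi> i (a *\<^sub>C x) = a * \<phi> i x"
      "\<And>i x. i \<in> I \<Longrightarrow> cmod (\<phi> i x) \<le> c i * norm x"
    and b: "\<And>i. i \<in> I \<Longrightarrow> norm (b i) \<le> M"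
    and X: "\<And>x. ((\<lambda>i. \<phi> i x *\<^sub>C b i) has_sum X x) I"
    by simp_all
  define f where "f i x = \<phi> i x * cinner x (b i)" for i x
  have fin: "(\<Sum>x\<in>F. norm (f i x)) \<le> c i * M" if i: "i \<in> I" and F: "F \<subseteq> B" "finite F" for i F
  proof -
    have "(\<Sum>x\<in>F. norm (f i x)) = (\<Sum>x\<in>F. \<bar>cmod (\<phi> i x)\<bar> * \<bar>cmod (cinner x (b i))\<bar>)"
      by (simp add: f_def norm_mult)
    also have "\<dots> \<le> L2_set (\<lambda>x. cmod (\<phi> i x)) F * L2_set (\<lambda>x. cmod (cinner x (b i))) F"
      by (rule L2_set_mult_ineq)
    also have "\<dots> \<le> c i * M"
    proof (intro mult_mono)
      show "L2_set (\<lambda>x. cmod (\<phi> i x)) F \<le> c i"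
        unfolding L2_set_def using bessel_functional[OF F(2) orthonormal_subset[OF B(1) F(1)], of "\<phi> i" "c i"]
          \<phi> c(2) i by (intro real_le_lsqrt) (auto simp: sum_nonneg)
      have "L2_set (\<lambda>x. cmod (cinner x (b i))) F \<le> norm (b i)"
        unfolding L2_set_def using bessel_inequality[OF F(2) orthonormal_subset[OF B(1) F(1)]]
        by (intro real_le_lsqrt) (auto simp: sum_nonneg)
      then show "L2_set (\<lambda>x. cmod (cinner x (b i))) F \<le> M" using b[OF i] by simp
    qed (use c i in auto)
    finally show ?thesis .
  qed
  have abs: "(\<lambda>x. norm (f i x)) summable_on B" "infsum (\<lambda>x. norm (f i x)) B \<le> c i * M"
    if i: "i \<in> I" for i
  proof -
    show "(\<lambda>x. norm (f i x)) summable_on B"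
      using fin[OF i] by (intro nonneg_bdd_above_summable_on bdd_aboveI2) auto
    then show "infsum (\<lambda>x. norm (f i x)) B \<le> c i * M"
      using fin[OF i] by (intro infsum_le_finite_sums) auto
  qed
  have "(\<lambda>i. norm (c i * M)) summable_on I"
    using summable_on_cmult_left[OF c(1), of M] by (subst (asm) summable_on_iff_abs_summable_on_real)
  then have "(\<lambda>i. norm (infsum (\<lambda>x. norm (f i x)) B)) summable_on I"
  proof (rule Infinite_Sum.abs_summable_on_comparison_test)
    fix i assume i: "i \<in> I"
    have "0 \<le> infsum (\<lambda>x. norm (f i x)) B" by (rule infsum_nonneg) simp
    then show "norm (infsum (\<lambda>x. norm (f i x)) B) \<le> norm (c i * M)"
      using abs(2)[OF i] by simp
  qed
  then have "(\<lambda>z. norm ((\<lambda>(i, x). f i x) z)) summable_on (I \<times> B)"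
    unfolding Infinite_Sum.abs_summable_on_Sigma_iff using abs(1) by simp
  then have sm: "(\<lambda>(i, x). f i x) summable_on (I \<times> B)"
    by (rule Infinite_Sum.abs_summable_summable)
  then have sm': "(\<lambda>(x, i). f i x) summable_on (B \<times> I)"
    using summable_on_reindex_bij_betw[of prod.swap "B \<times> I" "I \<times> B" "\<lambda>(i, x). f i x"]
    by (auto simp: case_prod_unfold bij_betw_def product_swap)
  have 1: "infsum (\<lambda>i. f i x) I = cinner x (X x)" for x
  proof -
    have "((\<lambda>i. cinner x (\<phi> i x *\<^sub>C b i)) has_sum cinner x (X x)) I"
      by (rule has_sum_bounded_linear[OF bounded_linear_cinner_right X])
    then show ?thesis by (intro infsumI) (simp add: f_def cinner_scaleC_right)
  qed
  have 2: "infsum (f i) B = \<phi> i (b i)" if i: "i \<in> I" for i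
  proof -
    have "bounded_linear (\<phi> i)"
      using \<phi>[OF i] by (intro bounded_linear_intro[where K="c i"])
        (auto simp: scaleR_scaleC scaleR_conv_of_real mult.commute)
    moreover have "((\<lambda>u. cinner u (b i) *\<^sub>C u) has_sum b i) B"
      using B by (intro orthonormal_expansion) auto
    ultimately have "((\<lambda>u. \<phi> i (cinner u (b i) *\<^sub>C u)) has_sum \<phi> i (b i)) B"
      by (rule has_sum_bounded_linear)
    then show ?thesis using \<phi>(2)[OF i] by (intro infsumI) (simp add: f_def[abs_def] mult.commute)
  qed
  have "(\<lambda>x. cinner x (X x)) summable_on B"
    using summable_on_Sigma_banach[OF sm'] by (simp add: 1)
  moreover have "infsum (\<lambda>x. cinner x (X x)) B = infsum (\<lambda>i. \<phi> i (b i)) I"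
    using infsum_swap_banach[OF sm] by (simp add: 1 2 cong: infsum_cong)
  ultimately show "((\<lambda>x. cinner x (X x)) has_sum infsum (\<lambda>i. \<phi> i (b i)) I) B"
    using has_sum_infsum by metis
qed

text \<open>A definition cannot quantify over the type of the indices, so one type is fixed; pairs
  of a level and a vector serve all the expansions built below.\<close>

definition nuclear :: "('h::chilbert_space \<Rightarrow> 'h) \<Rightarrow> bool" where
  "nuclear X \<longleftrightarrow> (\<exists>(I :: (nat \<times> 'h) set) \<phi> b. nuclear_expansion I \<phi> b X)"

lemma nuclear_expansion_comp_left:
  assumes "nuclear_expansion I \<phi> b X" "bounded_clinear S"
  shows "nuclear_expansion I \<phi> (\<lambda>i. S (b i)) (S \<circ> X)"
proof -
  obtain K where K: "K > 0" "\<And>x. norm (S x) \<le> K * norm x"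
    using bounded_clinear_bound[OF assms(2)] by blast
  obtain c M where *: "c summable_on I" "\<forall>i\<in>I. c i \<ge> 0" "M \<ge> 0"
     "\<forall>i\<in>I. \<forall>x y. \<phi> i (x + y) = \<phi> i x + \<phi> i y" "\<forall>i\<in>I. \<forall>a x. \<phi> i (a *\<^sub>C x) = a * \<phi> i x"
     "\<forall>i\<in>I. \<forall>x. cmod (\<phi> i x) \<le> c i * norm x" "\<forall>i\<in>I. norm (b i) \<le> M"
     "\<forall>x. ((\<lambda>i. \<phi> i x *\<^sub>C b i) has_sum X x) I"
    using assms unfolding nuclear_expansion_def by blast
  have "norm (S (b i)) \<le> K * M" if "i \<in> I" for i
    using *(7) K that by (meson mult_left_mono less_imp_le order_trans)
  moreover have "((\<lambda>i. \<phi> i x *\<^sub>C S (b i)) has_sum (S \<circ> X) x) I" for x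
    using has_sum_bounded_linear[OF bounded_clinear_bounded_linear[OF assms(2)] *(8)[rule_format, of x]]
    by (simp add: bounded_clinear_scaleC[OF assms(2)])
  ultimately show ?thesis
    unfolding nuclear_expansion_def using * K by (intro exI[of _ c] exI[of _ "K * M"]) auto
qed

lemma nuclear_expansion_comp_right:
  assumes "nuclear_expansion I \<phi> b X" "bounded_clinear S"
  shows "nuclear_expansion I (\<lambda>i x. \<phi> i (S x)) b (X \<circ> S)"
proof -
  obtain K where K: "K > 0" "\<And>x. norm (S x) \<le> K * norm x"
    using bounded_clinear_bound[OF assms(2)] by blast
  obtain c M where *: "c summable_on I" "\<forall>i\<in>I. c i \<ge> 0" "M \<ge> 0"
     "\<forall>i\<in>I. \<forall>x y. \<phi> i (x + y) = \<phi> i x + \<phi> i y" "\<forall>i\<in>I. \<forall>a x. \<phi> i (a *\<^sub>C x) = a * \<phi> i x"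
     "\<forall>i\<in>I. \<forall>x. cmod (\<phi> i x) \<le> c i * norm x" "\<forall>i\<in>I. norm (b i) \<le> M"
     "\<forall>x. ((\<lambda>i. \<phi> i x *\<^sub>C b i) has_sum X x) I"
    using assms unfolding nuclear_expansion_def by blast
  have "cmod (\<phi> i (S x)) \<le> c i * K * norm x" if "i \<in> I" for i x
  proof -
    have "cmod (\<phi> i (S x)) \<le> c i * norm (S x)" using *(6) that by blast
    also have "\<dots> \<le> c i * (K * norm x)" using *(2) that K by (intro mult_left_mono) auto
    finally show ?thesis by (simp add: mult.assoc)
  qed
  moreover have "(\<lambda>i. c i * K) summable_on I"
    using *(1) by (rule summable_on_cmult_left)
  ultimately show ?thesis
    unfolding nuclear_expansion_def using * K bounded_clinear_simps[OF assms(2)]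
    by (intro exI[of _ "\<lambda>i. c i * K"] exI[of _ M]) auto
qed

lemma nuclear_comp_left: "nuclear X \<Longrightarrow> bounded_clinear S \<Longrightarrow> nuclear (S \<circ> X)"
  unfolding nuclear_def using nuclear_expansion_comp_left by blast

lemma nuclear_comp_right: "nuclear X \<Longrightarrow> bounded_clinear S \<Longrightarrow> nuclear (X \<circ> S)"
  unfolding nuclear_def using nuclear_expansion_comp_right by blast

lemma nuclear_has_trace: "nuclear X \<Longrightarrow> \<exists>t. has_trace X t"
  unfolding nuclear_def using nuclear_expansion_trace by blast

text \<open>Attaching \<open>S\<close> to the functionals or to the vectors of one expansion of
  \<open>X\<close> leads to the same sum of the terms \<open>\<phi> i (S (b i))\<close>.\<close>

lemma nuclear_trace_commute:
  assumes "nuclear X" "bounded_clinear S"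
  shows "\<exists>t. has_trace (X \<circ> S) t \<and> has_trace (S \<circ> X) t"
proof -
  obtain I :: "(nat \<times> 'a) set" and \<phi> b where "nuclear_expansion I \<phi> b X"
    using assms by (auto simp: nuclear_def)
  from nuclear_expansion_trace[OF nuclear_expansion_comp_left[OF this assms(2)]]
    nuclear_expansion_trace[OF nuclear_expansion_comp_right[OF this assms(2)]]
  show ?thesis by blast
qed

text \<open>The terms are the orthonormal expansion of \<open>X x\<close> in \<open>U\<close>; the
  constant coordinate \<open>n\<close> only fits \<open>U\<close> into the index type of
  \<open>nuclear\<close>.\<close>

lemma finite_expansion:
  assumes "finite U" "orthonormal U" "bounded_clinear X" "range X \<subseteq> complex_vector.span U"
  shows "nuclear_expansion ({n} \<times> U) (\<lambda>i x. cinner (snd i) (X x)) snd X"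
proof -
  obtain K where K: "K > 0" "\<And>x. norm (X x) \<le> K * norm x"
    using bounded_clinear_bound[OF assms(3)] by blast
  have "cmod (cinner u (X x)) \<le> K * norm x" if "u \<in> U" for u x
    using cinner_cauchy_schwarz[of u "X x"] K(2)[of x] orthonormal_norm[OF assms(2) that] by simp
  moreover have "((\<lambda>i. cinner (snd i) (X x) *\<^sub>C snd i) has_sum X x) ({n} \<times> U)" for x
  proof (rule has_sum_finiteI)
    have "X x = orthonormal_proj U (X x)"
      using assms by (subst orthonormal_proj_id) auto
    also have "\<dots> = (\<Sum>i\<in>{n} \<times> U. cinner (snd i) (X x) *\<^sub>C snd i)"
      unfolding orthonormal_proj_def by (rule sum.reindex_bij_witness[of _ snd "Pair n"]) auto
    finally show "X x = (\<Sum>i\<in>{n} \<times> U. cinner (snd i) (X x) *\<^sub>C snd i)" .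
  qed (use assms in simp)
  ultimately show ?thesis
    unfolding nuclear_expansion_def using assms K orthonormal_norm[OF assms(2)]
    by (intro exI[of _ "\<lambda>i. K"] exI[of _ 1])
      (auto simp: bounded_clinear_simps cinner_add_right cinner_scaleC_right)
qed

lemma rank_at_most_nuclear:
  assumes "rank_at_most k X"
  shows "nuclear X"
proof -
  obtain F where "finite F" "orthonormal F" "range X \<subseteq> complex_vector.span F"
    using rank_at_mostE[OF assms] by metis
  from finite_expansion[OF this(1,2) rank_at_most_bounded[OF assms] this(3), of 0]
  show ?thesis unfolding nuclear_def by blast
qed

lemma has_trace_orthonormal_proj:
  assumes "finite F" "orthonormal F"
  shows "has_trace (orthonormal_proj F) (of_nat (card F))"
proof -
  have "nuclear_expansion ({0::nat} \<times> F) (\<lambda>i x. cinner (snd i) (orthonormal_proj F x)) snd (orthonormal_proj F)"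
    using assms orthonormal_proj_in_span
    by (intro finite_expansion bounded_clinear_orthonormal_proj) auto
  from nuclear_expansion_trace[OF this]
  have "has_trace (orthonormal_proj F)
      (\<Sum>i\<in>{0::nat} \<times> F. cinner (snd i) (orthonormal_proj F (snd i)))"
    using assms by simp
  also have "(\<Sum>i\<in>{0::nat} \<times> F. cinner (snd i) (orthonormal_proj F (snd i))) = (\<Sum>i\<in>{0::nat} \<times> F. 1)"
    using assms by (intro sum.cong refl)
      (auto simp: orthonormal_proj_id complex_vector.span_base orthonormalD[OF assms(2)])
  finally show ?thesis by (simp add: card_cartesian_product)
qed

section \<open>Approximation by operators of finite rank\<close>

text \<open>Up to constants, the k-th approximation number of \<open>X\<close> is O(k^{-p}). The
  factor \<open>r\<close> in the rank absorbs the sums of ranks that arise in products and in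
  amplifications.\<close>

definition approximable :: "real \<Rightarrow> ('h::chilbert_space \<Rightarrow> 'h) \<Rightarrow> bool" where
  "approximable p X \<longleftrightarrow> bounded_clinear X \<and> (\<exists>C\<ge>0. \<exists>r::nat. \<forall>k\<ge>1. \<exists>F.
     rank_at_most (r * k) F \<and> (\<forall>x. norm (X x - F x) \<le> C * real k powr (- p) * norm x))"

lemma approximable_bounded: "approximable p X \<Longrightarrow> bounded_clinear X"
  by (simp add: approximable_def)

lemma approximable_comp_right:
  assumes "approximable p X" "bounded_clinear S"
  shows "approximable p (X \<circ> S)"
proof -
  obtain C r where C: "C \<ge> 0" "\<And>k. k \<ge> (1::nat) \<Longrightarrow> \<exists>F.
     rank_at_most (r * k) F \<and> (\<forall>x. norm (X x - F x) \<le> C * real k powr (- p) * norm x)"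
    using assms unfolding approximable_def by blast
  obtain K where K: "K > 0" "\<And>x. norm (S x) \<le> K * norm x"
    using bounded_clinear_bound[OF assms(2)] by blast
  have "\<exists>F. rank_at_most (r * k) F \<and>
      (\<forall>x. norm ((X \<circ> S) x - F x) \<le> (C * K) * real k powr (- p) * norm x)" if k: "k \<ge> 1" for k
  proof -
    obtain F where F: "rank_at_most (r * k) F" "\<And>x. norm (X x - F x) \<le> C * real k powr (- p) * norm x"
      using C(2)[OF k] by blast
    have "norm ((X \<circ> S) x - (F \<circ> S) x) \<le> (C * K) * real k powr (- p) * norm x" for x
    proof -
      have "norm ((X \<circ> S) x - (F \<circ> S) x) \<le> C * real k powr (- p) * norm (S x)"
        using F(2)[of "S x"] by simp
      also have "\<dots> \<le> C * real k powr (- p) * (K * norm x)"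
        using K C(1) by (intro mult_left_mono) auto
      finally show ?thesis by (simp add: mult_ac)
    qed
    then show ?thesis using rank_at_most_comp_right[OF F(1) assms(2)] by blast
  qed
  moreover have "0 \<le> C * K" using K C by simp
  ultimately show ?thesis
    using bounded_clinear_compose[OF approximable_bounded[OF assms(1)] assms(2)]
    unfolding approximable_def by blast
qed

text \<open>If \<open>F\<close> and \<open>G\<close> approximate \<open>X\<close> and \<open>Y\<close>, then \<open>X Y - (F Y + (X - F) G) = (X - F) (Y - G)\<close>.\<close>

lemma approximable_compose:
  assumes "approximable p X" "approximable q Y"
  shows "approximable (p + q) (X \<circ> Y)"
proof -
  obtain C r where C: "C \<ge> 0" "\<And>k. k \<ge> (1::nat) \<Longrightarrow> \<exists>F.
     rank_at_most (r * k) F \<and> (\<forall>x. norm (X x - F x) \<le> C * real k powr (- p) * norm x)"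
    using assms(1) unfolding approximable_def by blast
  obtain C' r' where C': "C' \<ge> 0" "\<And>k. k \<ge> (1::nat) \<Longrightarrow> \<exists>F.
     rank_at_most (r' * k) F \<and> (\<forall>x. norm (Y x - F x) \<le> C' * real k powr (- q) * norm x)"
    using assms(2) unfolding approximable_def by blast
  have bX: "bounded_clinear X" and bY: "bounded_clinear Y"
    using assms by (auto intro: approximable_bounded)
  have "\<exists>F. rank_at_most ((r + r') * k) F \<and>
      (\<forall>x. norm ((X \<circ> Y) x - F x) \<le> (C * C') * real k powr (- (p + q)) * norm x)" if k: "k \<ge> 1" for k
  proof -
    obtain F where F: "rank_at_most (r * k) F" "\<And>x. norm (X x - F x) \<le> C * real k powr (- p) * norm x"
      using C(2)[OF k] by blast
    obtain G where G: "rank_at_most (r' * k) G" "\<And>x. norm (Y x - G x) \<le> C' * real k powr (- q) * norm x"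
      using C'(2)[OF k] by blast
    define H where "H = (\<lambda>x. (F \<circ> Y) x + ((\<lambda>x. X x - F x) \<circ> G) x)"
    have "rank_at_most (r * k + r' * k) H"
      unfolding H_def using F(1) G(1) bX bY
      by (intro rank_at_most_add rank_at_most_comp_left rank_at_most_comp_right bounded_clinear_minus_op
          rank_at_most_bounded[OF F(1)])
    moreover have "norm ((X \<circ> Y) x - H x) \<le> (C * C') * real k powr (- (p + q)) * norm x" for x
    proof -
      have "(X \<circ> Y) x - H x = X (Y x - G x) - F (Y x - G x)"
        by (simp add: H_def bounded_clinear_diff[OF bX] bounded_clinear_diff[OF rank_at_most_bounded[OF F(1)]])
      then have "norm ((X \<circ> Y) x - H x) \<le> C * real k powr (- p) * norm (Y x - G x)"
        using F(2) by simp
      also have "\<dots> \<le> C * real k powr (- p) * (C' * real k powr (- q) * norm x)"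
        using G(2) C(1) by (intro mult_left_mono) auto
      also have "\<dots> = (C * C') * real k powr (- (p + q)) * norm x"
        using k by (simp add: powr_add[symmetric] mult_ac)
      finally show ?thesis .
    qed
    ultimately show ?thesis by (auto simp: algebra_simps)
  qed
  moreover have "0 \<le> C * C'" using C C' by simp
  ultimately show ?thesis
    using bounded_clinear_compose[OF bX bY] unfolding approximable_def by blast
qed

lemma approximable_funpow:
  assumes "approximable p X"
  shows "approximable (real (Suc n) * p) (X ^^ Suc n)"
proof (induction n)
  case 0
  then show ?case using assms by simp
next
  case (Suc n)
  from approximable_compose[OF assms Suc]
  show ?case by (simp add: algebra_simps o_def)
qed

lemma approximable_finite_rank:
  assumes "approximable p X" "p > 0" "e > 0"
  shows "\<exists>F k. rank_at_most k F \<and> (\<forall>x. norm (X x - F x) \<le> e * norm x)"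
proof -
  obtain C r where C: "C \<ge> 0" "\<And>k. k \<ge> (1::nat) \<Longrightarrow> \<exists>F.
     rank_at_most (r * k) F \<and> (\<forall>x. norm (X x - F x) \<le> C * real k powr (- p) * norm x)"
    using assms(1) unfolding approximable_def by blast
  have "(\<lambda>k. C * real k powr (- p)) \<longlonglongrightarrow> C * 0"
    using assms(2) by (intro tendsto_intros tendsto_neg_powr filterlim_real_sequentially) auto
  then have "eventually (\<lambda>k. C * real k powr (- p) < e) sequentially"
    using assms(3) by (intro order_tendstoD(2)) auto
  then obtain k where k: "k \<ge> 1" "C * real k powr (- p) < e"
    using eventually_happens[OF eventually_conj[OF _ eventually_ge_at_top[of 1]]] by force
  then obtain F where F: "rank_at_most (r * k) F" "\<And>x. norm (X x - F x) \<le> C * real k powr (- p) * norm x"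
    using C(2)[OF k(1)] by blast
  have "norm (X x - F x) \<le> e * norm x" for x
    using F(2)[of x] mult_right_mono[OF less_imp_le[OF k(2)], of "norm x"] by simp
  then show ?thesis using F(1) by blast
qed

text \<open>The differences \<open>R j\<close> of approximants of rank about \<open>2\<^sup>j\<close> have trace norm of order
  \<open>2\<^bsup>(1 - p) j\<^esup>\<close>.\<close>

lemma approximable_nuclear:
  assumes "approximable p (X :: 'h::chilbert_space \<Rightarrow> 'h)" "p > 1"
  shows "nuclear X"
proof -
  obtain C r where C: "C \<ge> 0" "\<And>k. k \<ge> (1::nat) \<Longrightarrow> \<exists>F.
     rank_at_most (r * k) F \<and> (\<forall>x. norm (X x - F x) \<le> C * real k powr (- p) * norm x)"
    using assms(1) unfolding approximable_def by blast
  obtain F where F: "\<And>k. k \<ge> 1 \<Longrightarrow> rank_at_most (r * k) (F k)"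
      "\<And>k x. k \<ge> 1 \<Longrightarrow> norm (X x - F k x) \<le> C * real k powr (- p) * norm x"
    using C(2) by metis
  obtain K where K: "K > 0" "\<And>x. norm (X x) \<le> K * norm x"
    using bounded_clinear_bound[OF approximable_bounded[OF assms(1)]] by blast
  define q where "q = (2::real) powr (- p)"
  have q: "0 < q" "2 * q < 1"
  proof -
    have "2 * q = 2 powr (1 - p)" by (simp add: q_def powr_diff powr_minus field_simps)
    also have "\<dots> < 2 powr 0" using assms(2) by (intro powr_less_mono) auto
    finally show "2 * q < 1" by simp
  qed (simp add: q_def)
  have pow: "real (2 ^ j) powr (- p) = q ^ j" for j :: nat
    unfolding q_def by (simp add: powr_powr powr_realpow[symmetric] mult.commute)
  \<comment> \<open>Level 0 is the zero operator, so that the differences \<open>R j\<close>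
    telescope from 0 to \<open>X\<close>; the approximant of rank at most r 2^i is moved to level i
    + 1.\<close>
  define G where "G j = (case j of 0 \<Rightarrow> (\<lambda>x. 0) | Suc i \<Rightarrow> F (2 ^ i))" for j :: nat
  \<comment> \<open>\<open>K\<close> covers the zero approximant at level 0, and the division by
    \<open>q\<close> compensates the shift of the levels by one.\<close>
  define C1 where "C1 = max K (C / q)"
  have C1: "C1 \<ge> 0" using K(1) by (simp add: C1_def)
  have rank_G: "rank_at_most (r * 2 ^ j) (G j)" for j
  proof (cases j)
    case 0
    then show ?thesis by (simp add: G_def rank_at_most_zero)
  next
    case (Suc i)
    have "rank_at_most (r * 2 ^ i) (F (2 ^ i))" by (rule F(1)) simp
    then have "rank_at_most (r * 2 ^ j) (F (2 ^ i))"
      by (rule rank_at_most_mono) (simp add: Suc)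
    then show ?thesis by (simp add: Suc G_def)
  qed
  have norm_G: "norm (X x - G j x) \<le> C1 * q ^ j * norm x" for j x
  proof (cases j)
    case 0
    have "norm (X x) \<le> C1 * norm x"
      using K(2)[of x] mult_right_mono[of K C1 "norm x"] by (simp add: C1_def)
    then show ?thesis by (simp add: 0 G_def)
  next
    case (Suc i)
    have "norm (X x - G j x) \<le> C * q ^ i * norm x"
      using F(2)[of "2 ^ i" x] by (simp only: Suc G_def nat.case pow) simp
    also have "C * q ^ i = C / q * q ^ j" using q by (simp add: Suc)
    also have "C / q * q ^ j * norm x \<le> C1 * q ^ j * norm x"
      using q by (intro mult_right_mono) (auto simp: C1_def)
    finally show ?thesis .
  qed
  define R where "R j x = G (Suc j) x - G j x" for j x
  have rank_R: "rank_at_most (r * 2 ^ Suc j + r * 2 ^ j) (R j)" for j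
    unfolding R_def by (intro rank_at_most_diff rank_G)
  have norm_R: "norm (R j x) \<le> 2 * C1 * q ^ j * norm x" for j x
  proof -
    have "norm (R j x) \<le> norm (X x - G j x) + norm (X x - G (Suc j) x)"
      using norm_triangle_ineq4[of "X x - G j x" "X x - G (Suc j) x"] by (simp add: R_def)
    also have "\<dots> \<le> C1 * q ^ j * norm x + C1 * q ^ Suc j * norm x"
      by (intro add_mono norm_G)
    also have "C1 * q ^ Suc j * norm x \<le> C1 * q ^ j * norm x"
      using q C1 by (intro mult_right_mono mult_left_mono power_decreasing) auto
    finally show ?thesis by (simp add: mult_ac)
  qed
  have "\<exists>U. finite U \<and> orthonormal U \<and> card U \<le> r * 2 ^ Suc j + r * 2 ^ j \<and>
      range (R j) \<subseteq> complex_vector.span U" for j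
    using rank_at_mostE[OF rank_R[of j]] by metis
  then obtain U where U: "\<And>j. finite (U j)" "\<And>j. orthonormal (U j)"
      "\<And>j. card (U j) \<le> r * 2 ^ Suc j + r * 2 ^ j" "\<And>j. range (R j) \<subseteq> complex_vector.span (U j)"
    by metis
  define I where "I = Sigma UNIV U"
  define c where "c i = 2 * C1 * q ^ fst i" for i :: "nat \<times> 'h"
  have "(\<lambda>i. norm (c i)) summable_on I"
    unfolding I_def Infinite_Sum.abs_summable_on_Sigma_iff
  proof (intro conjI ballI)
    fix j show "(\<lambda>u. norm (c (j, u))) summable_on U j"
      using U(1) by (rule summable_on_finite)
  next
    \<comment> \<open>\<open>U j\<close> has at most 3 r 2^j elements, each of weight 2 C1 q^j. The
      ratio 2 q is below 1 exactly because p > 1.\<close>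
    have "summable (\<lambda>j. 6 * real r * C1 * (2 * q) ^ j)"
      using q by (intro summable_mult summable_geometric) auto
    then have "(\<lambda>j. norm (6 * real r * C1 * (2 * q) ^ j)) summable_on UNIV"
      using q C1 by (intro summable_nonneg_imp_summable_on) auto
    then show "(\<lambda>j. norm (infsum (\<lambda>u. norm (c (j, u))) (U j))) summable_on UNIV"
    proof (rule Infinite_Sum.abs_summable_on_comparison_test)
      fix j :: nat
      have "norm (infsum (\<lambda>u. norm (c (j, u))) (U j)) = real (card (U j)) * (2 * C1 * q ^ j)"
        using U(1) q C1 by (simp add: c_def)
      also have "\<dots> \<le> real (r * 2 ^ Suc j + r * 2 ^ j) * (2 * C1 * q ^ j)"
        using U(3)[of j] q C1 by (intro mult_right_mono) (simp_all only: of_nat_le_iff, simp)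
      also have "\<dots> = norm (6 * real r * C1 * (2 * q) ^ j)"
        using q C1 by (simp add: power_mult_distrib algebra_simps)
      finally show "norm (infsum (\<lambda>u. norm (c (j, u))) (U j)) \<le> norm (6 * real r * C1 * (2 * q) ^ j)" .
    qed
  qed
  then have c: "c summable_on I"
    by (rule Infinite_Sum.abs_summable_summable)
  have sums: "((\<lambda>i. cinner (snd i) (R (fst i) x) *\<^sub>C snd i) has_sum X x) I" for x
  proof -
    let ?f = "\<lambda>i. cinner (snd i) (R (fst i) x) *\<^sub>C snd i"
    have le: "norm (?f i) \<le> c i * norm x" if "i \<in> I" for i
    proof -
      have "norm (snd i) = 1" using that orthonormal_norm[OF U(2)] by (auto simp: I_def)
      then have "norm (?f i) \<le> norm (R (fst i) x)"
        using cinner_cauchy_schwarz[of "snd i" "R (fst i) x"] by (simp add: norm_scaleC)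
      then show ?thesis using norm_R[of "fst i" x] by (simp add: c_def)
    qed
    have "(\<lambda>i. norm (?f i)) summable_on I"
    proof (rule Infinite_Sum.abs_summable_on_comparison_test)
      show "(\<lambda>i. norm (c i * norm x)) summable_on I"
        using summable_on_cmult_left[OF c, of "norm x"]
        by (subst (asm) summable_on_iff_abs_summable_on_real)
      show "norm (?f i) \<le> norm (c i * norm x)" if "i \<in> I" for i
        using le[OF that] by (smt (verit) real_norm_def)
    qed
    then have sm: "?f summable_on I"
      by (rule Infinite_Sum.abs_summable_summable)
    have inner: "infsum (\<lambda>u. ?f (j, u)) (U j) = R j x" for j
    proof -
      have "R j x = orthonormal_proj (U j) (R j x)"
        using U(1,2,4)[of j] by (subst orthonormal_proj_id) auto
      then show ?thesis using U(1)[of j] by (simp add: orthonormal_proj_def)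
    qed
    have "infsum ?f I = infsum (\<lambda>j. R j x) UNIV"
      using infsum_Sigma_banach[of ?f UNIV U] sm inner by (simp add: I_def)
    also have "\<dots> = X x"
    proof (intro infsumI norm_summable_imp_has_sum)
      show "summable (\<lambda>j. norm (R j x))"
      proof (rule summable_comparison_test)
        show "\<exists>N. \<forall>n\<ge>N. norm (norm (R n x)) \<le> 2 * C1 * norm x * q ^ n"
          using norm_R by (auto simp: mult_ac)
        show "summable (\<lambda>n. 2 * C1 * norm x * q ^ n)"
          using q by (intro summable_mult summable_geometric) auto
      qed
      have "(\<lambda>m. G m x) \<longlonglongrightarrow> X x"
      proof (rule tendsto_norm_zero_cancel[THEN LIM_zero_cancel])
        have "(\<lambda>m. C1 * q ^ m * norm x) \<longlonglongrightarrow> C1 * 0 * norm x"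
          using q by (intro tendsto_intros LIMSEQ_realpow_zero) auto
        then have "(\<lambda>m. C1 * q ^ m * norm x) \<longlonglongrightarrow> 0" by simp
        then show "(\<lambda>m. norm (G m x - X x)) \<longlonglongrightarrow> 0"
          by (rule Lim_null_comparison[rotated])
            (use norm_G in \<open>auto simp: norm_minus_commute intro!: always_eventually\<close>)
      qed
      moreover have "(\<Sum>j<m. R j x) = G m x" for m
        by (induction m) (auto simp: R_def G_def)
      ultimately show "(\<lambda>j. R j x) sums X x" by (simp add: sums_def)
    qed
    finally show ?thesis using sm has_sum_infsum by metis
  qed
  have "nuclear_expansion I (\<lambda>i x. cinner (snd i) (R (fst i) x)) snd X"
    unfolding nuclear_expansion_def
  proof (intro exI conjI ballI allI)
    fix i x assume "i \<in> I"
    then have 1: "norm (snd i) = 1" using orthonormal_norm[OF U(2)] by (auto simp: I_def)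
    then show "norm (snd i) \<le> 1" by simp
    show "cmod (cinner (snd i) (R (fst i) x)) \<le> c i * norm x"
      using cinner_cauchy_schwarz[of "snd i" "R (fst i) x"] 1 norm_R[of "fst i" x] by (simp add: c_def)
    show "0 \<le> c i" using C1 q by (simp add: c_def)
  qed (use c sums bounded_clinear_simps[OF rank_at_most_bounded[OF rank_R]] in
      \<open>auto simp: cinner_add_right cinner_scaleC_right\<close>)
  then show ?thesis unfolding nuclear_def by blast
qed

section \<open>Singular values of a self-adjoint operator\<close>

lemma adjoint_operator_self_adjoint:
  assumes "\<And>x y. cinner (G x) y = cinner x (G y)"
  shows "adjoint_operator G = G"
  unfolding adjoint_operator_def
proof (rule the_equality)
  fix S assume S: "\<forall>x y. cinner (G x) y = cinner x (S y)"
  show "S = G"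
  proof
    fix y show "S y = G y" by (rule cinner_ext) (use S assms in metis)
  qed
qed (use assms in blast)

lemma norm_diff_square:
  "(norm (a - b))\<^sup>2 = (norm a)\<^sup>2 - 2 * Re (cinner a b) + (norm (b :: 'h::chilbert_space))\<^sup>2"
proof -
  have re: "(norm x)\<^sup>2 = Re (cinner x x)" for x :: 'h
    by (simp only: cinner_self Re_complex_of_real)
  have "Re (cinner b a) = Re (cinner a b)"
    by (metis cinner_commute complex_cnj(1) complex.sel(1) cnj.sel(1))
  then show ?thesis
    unfolding re by (simp add: cinner_diff_left cinner_diff_right)
qed

section \<open>Maximal orthonormal sets of eigenvectors\<close>

lemma maximal_orthonormal_spans:
  assumes F: "finite F" "orthonormal F" "F \<subseteq> V" and V: "complex_vector.subspace V"
    and max: "\<And>F'. finite F' \<Longrightarrow> orthonormal F' \<Longrightarrow> F' \<subseteq> V \<Longrightarrow> card F' \<le> card F"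
  shows "V \<subseteq> complex_vector.span (F :: 'h::chilbert_space set)"
proof
  fix x assume x: "x \<in> V"
  define y where "y = x - orthonormal_proj F x"
  have FV: "complex_vector.span F \<subseteq> V"
    using F V by (intro complex_vector.span_minimal)
  have yV: "y \<in> V"
    unfolding y_def using x FV orthonormal_proj_in_span[of F x]
    by (intro complex_vector.subspace_diff[OF V]) auto
  have orth: "cinner u y = 0" if "u \<in> F" for u
    unfolding y_def using cinner_diff_orthonormal_proj[OF F(1,2)] that complex_vector.span_base by blast
  have "y = 0"
  proof (rule ccontr)
    assume nz: "y \<noteq> 0"
    define z where "z = complex_of_real (inverse (norm y)) *\<^sub>C y"
    have z: "norm z = 1" unfolding z_def by (rule norm_normalize[OF nz])
    have orth': "cinner u z = 0" if "u \<in> F" for u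
      using orth[OF that] by (simp add: z_def cinner_scaleC_right)
    then have "z \<notin> F" using z by force
    moreover have "orthonormal (insert z F)"
      using F z orth' by (intro orthonormal_insert)
    moreover have "z \<in> V" unfolding z_def using V yV by (rule complex_vector.subspace_scale)
    ultimately show False using max[of "insert z F"] F by simp
  qed
  then show "x \<in> complex_vector.span F"
    using orthonormal_proj_in_span[of F x] by (simp add: y_def)
qed

lemma ex_max_card:
  assumes "P F" "\<And>F. P F \<Longrightarrow> card F \<le> M"
  shows "\<exists>F. P F \<and> (\<forall>F'. P F' \<longrightarrow> card F' \<le> card F)"
  using ex_has_greatest_nat[of P F card "Suc M"] assms by (auto simp: less_Suc_eq_le)

text \<open>For distinct u, v in such a set, the squared distance of \<open>G u\<close> and
  \<open>G v\<close> is l^2 times that of u and v, hence 2 l^2. So no two images fit into one ball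
  of radius l/2, and a finite cover of the compact image of the unit ball by such balls bounds their
  number.\<close>

lemma compact_eigenspace_card_bound:
  assumes G: "compact_operator G" "\<And>x y. cinner (G x) y = cinner x (G y)" and "l > (0::real)"
  shows "\<exists>M. \<forall>F. finite F \<and> orthonormal F \<and> F \<subseteq> {x. G (G x) = complex_of_real (l\<^sup>2) *\<^sub>C x} \<longrightarrow>
    card F \<le> M"
proof -
  have lin: "bounded_clinear G" using G by (simp add: compact_operator_def)
  obtain k where k: "finite k" "closure (G ` cball 0 1) \<subseteq> (\<Union>x\<in>k. ball x (l / 2))"
    using G(1) assms(3) unfolding compact_operator_def compact_eq_totally_bounded
    by (meson half_gt_zero)
  have "card F \<le> card k" if F: "finite F" "orthonormal F"
      "F \<subseteq> {x. G (G x) = complex_of_real (l\<^sup>2) *\<^sub>C x}" for F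
  proof -
    have "\<exists>z\<in>k. dist z (G u) < l / 2" if "u \<in> F" for u
    proof -
      have "G u \<in> closure (G ` cball 0 1)"
        using orthonormal_norm[OF F(2) that] by (intro closure_subset[THEN subsetD] imageI) simp
      then obtain z where "z \<in> k" "G u \<in> ball z (l / 2)" using k(2) by blast
      then show ?thesis by (auto intro!: bexI[of _ z])
    qed
    then obtain h where h: "\<And>u. u \<in> F \<Longrightarrow> h u \<in> k" "\<And>u. u \<in> F \<Longrightarrow> dist (h u) (G u) < l / 2"
      by metis
    have "inj_on h F"
    proof (rule inj_onI, rule ccontr)
      fix u v assume uv: "u \<in> F" "v \<in> F" "h u = h v" "u \<noteq> v"
      have "dist (G u) (G v) < l"
        using dist_triangle3[of "G u" "G v" "h u"] h(2)[OF uv(1)] h(2)[OF uv(2)] uv(3) by simp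
      then have "(norm (G u - G v))\<^sup>2 < l\<^sup>2"
        by (intro power_strict_mono) (auto simp: dist_norm)
      moreover have "complex_of_real ((norm (G u - G v))\<^sup>2) = cinner (u - v) (G (G (u - v)))"
        unfolding cinner_self[symmetric] by (metis G(2) bounded_clinear_diff[OF lin])
      moreover have "G (G u) = complex_of_real (l\<^sup>2) *\<^sub>C u" "G (G v) = complex_of_real (l\<^sup>2) *\<^sub>C v"
        using F(3) uv by blast+
      then have "G (G (u - v)) = complex_of_real (l\<^sup>2) *\<^sub>C (u - v)"
        by (simp only: bounded_clinear_diff[OF lin] complex_vector.scale_right_diff_distrib)
      ultimately have "(norm (u - v))\<^sup>2 * l\<^sup>2 < l\<^sup>2"
        by (metis cinner_scaleC_right cinner_self mult.commute of_real_eq_iff of_real_mult)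
      then have "(norm (u - v))\<^sup>2 < 1" using assms(3) by simp
      moreover have "(norm (u - v))\<^sup>2 = 2"
        using orthonormal_norm[OF F(2)] orthonormalD[OF F(2)] uv by (simp add: norm_diff_square)
      ultimately show False by simp
    qed
    then show ?thesis using h(1) k(1) by (intro card_inj_on_le) auto
  qed
  then show ?thesis by blast
qed

text \<open>Boundedness of the cardinalities makes a maximal orthonormal set a finite basis. This
  rules out the default value 0 that \<open>dim\<close> takes on infinite dimensional spaces and
  that would make the inequality fail.\<close>

lemma compact_eigenspace_dim:
  assumes G: "compact_operator G" "\<And>x y. cinner (G x) y = cinner x (G y)" and "l > (0::real)"
    and F: "finite F" "orthonormal F" "F \<subseteq> {x. G (G x) = complex_of_real (l\<^sup>2) *\<^sub>C x}"
  shows "card F \<le> complex_vector.dim {x. G (G x) = complex_of_real (l\<^sup>2) *\<^sub>C x}"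
proof -
  let ?E = "{x. G (G x) = complex_of_real (l\<^sup>2) *\<^sub>C x}"
  let ?P = "\<lambda>F. finite F \<and> orthonormal F \<and> F \<subseteq> ?E"
  have lin: "bounded_clinear G" using G by (simp add: compact_operator_def)
  have E: "complex_vector.subspace ?E"
    by (auto simp: complex_vector.subspace_def bounded_clinear_simps[OF lin] scaleC_add_right
        scaleC_scaleC mult.commute)
  obtain M where M: "\<forall>F. ?P F \<longrightarrow> card F \<le> M"
    using compact_eigenspace_card_bound[OF assms(1-3)] by blast
  obtain B where B: "?P B" "\<forall>F. ?P F \<longrightarrow> card F \<le> card B"
    using ex_max_card[of ?P F M] M F by blast
  have "?E \<subseteq> complex_vector.span B"
    using B E by (intro maximal_orthonormal_spans) auto
  then have "card B = complex_vector.dim ?E"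
    using B(1) by (intro complex_vector.basis_card_eq_dim orthonormal_independent) auto
  then show ?thesis using B(2) F by auto
qed

text \<open>Sort \<open>F\<close> by eigenvalue: each class is at most as large as the level set of
  \<open>\<mu>\<close> for that value, and these level sets are disjoint and lie above
  \<open>t\<close>.\<close>

lemma singular_values_card_bound:
  assumes G: "compact_operator G" "\<And>x y. cinner (G x) y = cinner x (G y)"
    and \<mu>: "singular_values G \<mu>" and t: "t > 0" "finite {k. \<mu> k > t}"
    and F: "finite F" "orthonormal F" "\<And>u. u \<in> F \<Longrightarrow> \<exists>l>t. G (G u) = complex_of_real (l\<^sup>2) *\<^sub>C u"
  shows "card F \<le> card {k. \<mu> k > t}"
proof -
  obtain l where l: "\<And>u. u \<in> F \<Longrightarrow> l u > t"
      "\<And>u. u \<in> F \<Longrightarrow> G (G u) = complex_of_real ((l u)\<^sup>2) *\<^sub>C u"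
    using F(3) by metis
  have level: "card {k. \<mu> k = s} = complex_vector.dim {x. G (G x) = complex_of_real (s\<^sup>2) *\<^sub>C x}"
      "finite {k. \<mu> k = s}" if "s > 0" for s
    using \<mu> that unfolding singular_values_def adjoint_operator_self_adjoint[OF G(2)] by blast+
  have "F = (\<Union>s\<in>l ` F. {u \<in> F. l u = s})" by auto
  then have "card F \<le> (\<Sum>s\<in>l ` F. card {u \<in> F. l u = s})"
    using card_UN_le[of "l ` F" "\<lambda>s. {u \<in> F. l u = s}"] F(1) by simp
  also have "\<dots> \<le> (\<Sum>s\<in>l ` F. card {k. \<mu> k = s})"
  proof (rule sum_mono)
    fix s assume "s \<in> l ` F"
    then have s: "s > 0" using l(1) t(1) by fastforce
    have "orthonormal {u \<in> F. l u = s}" using F(2) by (rule orthonormal_subset) auto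
    then show "card {u \<in> F. l u = s} \<le> card {k. \<mu> k = s}"
      unfolding level(1)[OF s] using F(1) l(2) s by (intro compact_eigenspace_dim G) auto
  qed
  also have "\<dots> = card (\<Union>s\<in>l ` F. {k. \<mu> k = s})"
    using F(1) l(1) t(1) level(2) by (intro card_UN_disjoint[symmetric]) fastforce+
  also have "\<dots> \<le> card {k. \<mu> k > t}"
    using l(1) by (intro card_mono t(2)) auto
  finally show ?thesis .
qed

text \<open>A maximal orthonormal set of eigenvectors of \<open>G\<^sup>2\<close> with eigenvalues above \<open>t\<^sup>2\<close> leaves no room
  for larger values of \<open>G\<close> on its orthogonal complement, since the supremum there is attained.\<close>

lemma maximal_eigenvectors_bound:
  assumes G: "compact_operator (G :: 'h::chilbert_space \<Rightarrow> 'h)" "\<And>x y. cinner (G x) y = cinner x (G y)"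
    and t: "t > (0::real)"
    and F: "finite F" "orthonormal F" "\<And>u. u \<in> F \<Longrightarrow> \<exists>l>t. G (G u) = complex_of_real (l\<^sup>2) *\<^sub>C u"
    and max: "\<And>F'. finite F' \<Longrightarrow> orthonormal F' \<Longrightarrow>
      (\<And>u. u \<in> F' \<Longrightarrow> \<exists>l>t. G (G u) = complex_of_real (l\<^sup>2) *\<^sub>C u) \<Longrightarrow> card F' \<le> card F"
    and x0: "\<And>u. u \<in> F \<Longrightarrow> cinner u x0 = 0"
  shows "norm (G x0) \<le> t * norm x0"
proof (rule ccontr)
  assume "\<not> ?thesis"
  then have big: "norm (G x0) > t * norm x0" by simp
  have lin: "bounded_clinear G" using G by (simp add: compact_operator_def)
  note simps = bounded_clinear_simps[OF lin]
  have blin: "bounded_linear G" using lin by (rule bounded_clinear_bounded_linear)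
  obtain K where K: "K > 0" "\<And>x. norm (G x) \<le> K * norm x"
    using bounded_clinear_bound[OF lin] by blast
  define V where "V = {x. \<forall>u\<in>F. cinner u x = 0}"
  define S where "S = (\<lambda>x. norm (G x)) ` {x \<in> V. norm x \<le> 1}"
  define s where "s = Sup S"
  have bdd: "bdd_above S"
    unfolding S_def
  proof (rule bdd_aboveI2)
    fix x assume "x \<in> {x \<in> V. norm x \<le> 1}"
    then show "norm (G x) \<le> K"
      using order_trans[OF K(2)[of x] mult_left_mono[of "norm x" 1 K]] K(1) by simp
  qed
  have V_scale: "c *\<^sub>C x \<in> V" if "x \<in> V" for c x
    using that by (simp add: V_def cinner_scaleC_right)
  have le_s: "norm (G x) \<le> s * norm x" if x: "x \<in> V" for x
  proof (cases "x = 0")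
    case False
    have "norm (G (complex_of_real (inverse (norm x)) *\<^sub>C x)) \<le> s"
      unfolding s_def S_def[symmetric] using V_scale[OF x] norm_normalize[OF False]
      by (intro cSup_upper bdd) (auto simp: S_def)
    then have "norm (G x) * inverse (norm x) \<le> s"
      by (simp add: simps norm_scaleC mult.commute del: of_real_inverse)
    then show ?thesis using False
      by (simp add: field_simps)
  qed (simp add: simps)
  have "x0 \<in> V" using x0 by (simp add: V_def)
  have "x0 \<noteq> 0" using big by (auto simp: simps)
  then have st: "s > t"
    using le_s[OF \<open>x0 \<in> V\<close>] big mult_less_cancel_right_pos[of "norm x0" t s] by fastforce
  have inv: "G (G x) \<in> V" if x: "x \<in> V" for x
    unfolding V_def
  proof (intro CollectI ballI)
    fix u assume u: "u \<in> F"
    then obtain l :: real where "G (G u) = complex_of_real (l\<^sup>2) *\<^sub>C u" using F(3) by blast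
    moreover have "cinner u (G (G x)) = cinner (G (G u)) x" by (simp add: G(2))
    ultimately show "cinner u (G (G x)) = 0" using x u by (simp add: V_def cinner_scaleC_left)
  qed
  \<comment> \<open>By self-adjointness the squared norm of G^2 x is the inner product of G^3 x and
    G x. Since G^2 x stays in \<open>V\<close>, the bound \<open>le_s\<close> applies to it again,
    and one factor \<open>norm (G (G x))\<close> cancels.\<close>
  have GG_le: "norm (G (G x)) \<le> s * norm (G x)" if x: "x \<in> V" for x
  proof -
    have "complex_of_real ((norm (G (G x)))\<^sup>2) = cinner (G (G (G x))) (G x)"
      by (simp only: cinner_self[symmetric] G(2))
    then have "(norm (G (G x)))\<^sup>2 = cmod (cinner (G (G (G x))) (G x))"
      by (metis abs_of_nonneg norm_of_real zero_le_power2)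
    also have "\<dots> \<le> norm (G (G (G x))) * norm (G x)" by (rule cinner_cauchy_schwarz)
    also have "\<dots> \<le> s * norm (G (G x)) * norm (G x)"
      using le_s[OF inv[OF x]] by (intro mult_right_mono) auto
    finally show ?thesis
      using st t by (cases "G (G x) = 0") (simp_all add: power2_eq_square mult_ac)
  qed
  have "\<exists>x. x \<in> V \<and> norm x \<le> 1 \<and> s - 1 / real (Suc j) < norm (G x)" for j
  proof -
    have "0 \<in> {x \<in> V. norm x \<le> 1}" by (simp add: V_def)
    then have "S \<noteq> {}" unfolding S_def by blast
    moreover have "s - 1 / real (Suc j) < Sup S" by (simp add: s_def)
    ultimately obtain y where "y \<in> S" "s - 1 / real (Suc j) < y"
      using less_cSup_iff[OF _ bdd] by blast
    then show ?thesis by (auto simp: S_def)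
  qed
  then obtain x where x: "\<And>j. x j \<in> V" "\<And>j. norm (x j) \<le> 1" "\<And>j. s - 1 / real (Suc j) < norm (G (x j))"
    by metis
  have g_le: "norm (G (x j)) \<le> s" for j
    using order_trans[OF le_s[OF x(1)[of j]] mult_left_mono[OF x(2)[of j], of s]] st t by simp
  have lim_g: "(\<lambda>j. norm (G (x j))) \<longlonglongrightarrow> s"
  proof (rule tendsto_sandwich)
    show "(\<lambda>j. s - 1 / real (Suc j)) \<longlonglongrightarrow> s"
      using tendsto_diff[OF tendsto_const LIMSEQ_inverse_real_of_nat, of s] by (simp add: inverse_eq_divide)
    show "eventually (\<lambda>j. s - 1 / real (Suc j) \<le> norm (G (x j))) sequentially"
      by (intro always_eventually allI less_imp_le x(3))
    show "eventually (\<lambda>j. norm (G (x j)) \<le> s) sequentially"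
      by (intro always_eventually allI g_le)
  qed (rule tendsto_const)
  \<comment> \<open>The almost maximising vectors are approximate eigenvectors of G^2 for the value
    s^2: expanding the square bounds the defect by how far \<open>norm (G (x j))\<close> falls short
    of \<open>s\<close>.\<close>
  let ?d = "\<lambda>j. G (G (x j)) - complex_of_real (s\<^sup>2) *\<^sub>C x j"
  have "(norm (?d j))\<^sup>2 \<le> s\<^sup>2 * (s\<^sup>2 - (norm (G (x j)))\<^sup>2)" for j
  proof -
    have "cinner (G (G (x j))) (x j) = complex_of_real ((norm (G (x j)))\<^sup>2)"
      by (simp only: G(2) cinner_self[symmetric])
    then have "cinner (G (G (x j))) (complex_of_real (s\<^sup>2) *\<^sub>C x j) = of_real (s\<^sup>2 * (norm (G (x j)))\<^sup>2)"
      by (simp only: cinner_scaleC_right of_real_mult)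
    then have "(norm (?d j))\<^sup>2 = (norm (G (G (x j))))\<^sup>2 - 2 * (s\<^sup>2 * (norm (G (x j)))\<^sup>2) + (s\<^sup>2 * norm (x j))\<^sup>2"
      unfolding norm_diff_square by (simp only: norm_scaleC norm_of_real abs_power2 Re_complex_of_real)
    also have "(norm (G (G (x j))))\<^sup>2 \<le> (s * norm (G (x j)))\<^sup>2"
      using GG_le[OF x(1)] by (intro power_mono) auto
    also have "(s\<^sup>2 * norm (x j))\<^sup>2 \<le> (s\<^sup>2 * 1)\<^sup>2"
      using x(2) by (intro power_mono mult_left_mono) auto
    finally show ?thesis by (simp add: algebra_simps power2_eq_square)
  qed
  moreover have "(\<lambda>j. s\<^sup>2 * (s\<^sup>2 - (norm (G (x j)))\<^sup>2)) \<longlonglongrightarrow> s\<^sup>2 * (s\<^sup>2 - s\<^sup>2)"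
    by (intro tendsto_intros lim_g)
  ultimately have "(\<lambda>j. (norm (?d j))\<^sup>2) \<longlonglongrightarrow> 0"
    by (intro Lim_null_comparison[of "\<lambda>j. (norm (?d j))\<^sup>2" "\<lambda>j. s\<^sup>2 * (s\<^sup>2 - (norm (G (x j)))\<^sup>2)"])
      (auto intro: always_eventually)
  then have "(\<lambda>j. norm (?d j)) \<longlonglongrightarrow> 0"
    using tendsto_real_sqrt by fastforce
  then have d: "?d \<longlonglongrightarrow> 0" by (rule tendsto_norm_zero_cancel)
  have "\<forall>j. G (x j) \<in> closure (G ` cball 0 1)"
    using x(2) by (auto intro!: closure_subset[THEN subsetD])
  then obtain z r where r: "strict_mono r" "((\<lambda>j. G (x j)) \<circ> r) \<longlonglongrightarrow> z"
    using G(1)[unfolded compact_operator_def compact_def, THEN conjunct2, THEN spec[of _ "\<lambda>j. G (x j)"]]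
    by blast
  \<comment> \<open>Along the subsequence G^2 x tends to \<open>G z\<close> and differs from s^2 x
    by a null sequence. Hence the vectors x converge themselves, and this is their limit.\<close>
  define w where "w = complex_of_real (inverse (s\<^sup>2)) *\<^sub>C G z"
  have GGx: "(\<lambda>j. G (G (x (r j)))) \<longlonglongrightarrow> G z"
    using bounded_linear.tendsto[OF blin r(2)] by (simp add: o_def)
  have "(\<lambda>j. G (G (x (r j))) - ?d (r j)) \<longlonglongrightarrow> G z - 0"
    using tendsto_diff[OF GGx LIMSEQ_subseq_LIMSEQ[OF d r(1), unfolded o_def]] .
  then have "(\<lambda>j. complex_of_real (inverse (s\<^sup>2)) *\<^sub>C (complex_of_real (s\<^sup>2) *\<^sub>C x (r j))) \<longlonglongrightarrow> w"
    unfolding w_def by (intro bounded_linear.tendsto[OF bounded_linear_scaleC_right]) simp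
  then have xw: "(\<lambda>j. x (r j)) \<longlonglongrightarrow> w"
    using st t by (simp add: scaleC_scaleC complex_vector.scale_one del: of_real_inverse of_real_power flip: of_real_mult)
  have "G (G w) = G z"
    using LIMSEQ_unique[OF bounded_linear.tendsto[OF blin bounded_linear.tendsto[OF blin xw]] GGx] .
  also have "\<dots> = complex_of_real (s\<^sup>2) *\<^sub>C w"
    using st t by (simp add: w_def scaleC_scaleC del: of_real_inverse of_real_power flip: of_real_mult)
  finally have eig: "G (G w) = complex_of_real (s\<^sup>2) *\<^sub>C w" .
  have "norm (G w) = s"
    using LIMSEQ_unique[OF tendsto_norm[OF bounded_linear.tendsto[OF blin xw]]
        LIMSEQ_subseq_LIMSEQ[OF lim_g r(1), unfolded o_def]] .
  then have nz: "w \<noteq> 0" using st t by (auto simp: simps)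
  have wV: "cinner u w = 0" if u: "u \<in> F" for u
  proof -
    have "(\<lambda>j. cinner u (x (r j))) \<longlonglongrightarrow> cinner u w"
      by (rule bounded_linear.tendsto[OF bounded_linear_cinner_right xw])
    moreover have "cinner u (x (r j)) = 0" for j using x(1) u by (auto simp: V_def)
    ultimately show ?thesis by (simp add: LIMSEQ_const_iff)
  qed
  define y where "y = complex_of_real (inverse (norm w)) *\<^sub>C w"
  have y: "norm y = 1" "\<And>u. u \<in> F \<Longrightarrow> cinner u y = 0"
    unfolding y_def using norm_normalize[OF nz] wV by (simp_all add: cinner_scaleC_right)
  then have "y \<notin> F" by force
  moreover have "card (insert y F) \<le> card F"
  proof (rule max)
    fix u assume "u \<in> insert y F"
    moreover have "G (G y) = complex_of_real (s\<^sup>2) *\<^sub>C y"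
      by (simp only: y_def simps eig scaleC_scaleC mult.commute)
    ultimately show "\<exists>l>t. G (G u) = complex_of_real (l\<^sup>2) *\<^sub>C u"
      using F(3) st by auto
  qed (use F y in \<open>auto intro: orthonormal_insert\<close>)
  ultimately show False using F(1) by simp
qed

text \<open>The approximant is \<open>G\<close> after the projection onto a maximal set of
  eigenvectors with values above \<open>t\<close>. Their number is controlled by
  \<open>singular_values_card_bound\<close>, and on the orthogonal complement maximality keeps
  \<open>G\<close> below \<open>t\<close>.\<close>

lemma singular_values_approximation:
  assumes G: "compact_operator G" "\<And>x y. cinner (G x) y = cinner x (G y)"
    and \<mu>: "singular_values G \<mu>" and t: "t > 0" "finite {k. \<mu> k > t}"
  shows "\<exists>F. rank_at_most (card {k. \<mu> k > t}) F \<and> (\<forall>x. norm (G x - F x) \<le> t * norm x)"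
proof -
  let ?P = "\<lambda>F. finite F \<and> orthonormal F \<and> (\<forall>u\<in>F. \<exists>l>t. G (G u) = complex_of_real (l\<^sup>2) *\<^sub>C u)"
  have empty: "?P {}" by (simp add: orthonormal_def)
  have bd: "card F \<le> card {k. \<mu> k > t}" if "?P F" for F
    using that by (intro singular_values_card_bound[OF assms]) auto
  have "\<exists>F. ?P F \<and> (\<forall>F'. ?P F' \<longrightarrow> card F' \<le> card F)"
    by (rule ex_max_card[of ?P, OF empty bd])
  then obtain F where Fmax: "?P F \<and> (\<forall>F'. ?P F' \<longrightarrow> card F' \<le> card F)" ..
  note F = Fmax[THEN conjunct1] and max = Fmax[THEN conjunct2]
  have lin: "bounded_clinear G" using G by (simp add: compact_operator_def)
  have "rank_at_most (card {k. \<mu> k > t}) (G \<circ> orthonormal_proj F)"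
    using F bd[OF F] lin
    by (intro rank_at_most_comp_left rank_at_most_mono[OF rank_at_most_orthonormal_proj]) auto
  moreover have "norm (G x - (G \<circ> orthonormal_proj F) x) \<le> t * norm x" for x
  proof -
    have "norm (G (x - orthonormal_proj F x)) \<le> t * norm (x - orthonormal_proj F x)"
    proof (rule maximal_eigenvectors_bound[OF G t(1), of F])
      show "cinner u (x - orthonormal_proj F x) = 0" if "u \<in> F" for u
        using F that by (intro cinner_diff_orthonormal_proj complex_vector.span_base) auto
      show "card F' \<le> card F" if "finite F'" "orthonormal F'"
          "\<And>u. u \<in> F' \<Longrightarrow> \<exists>l>t. G (G u) = complex_of_real (l\<^sup>2) *\<^sub>C u" for F'
        by (rule max[THEN spec, THEN mp]) (intro conjI ballI that)
    qed (use F in blast)+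
    also have "\<dots> \<le> t * norm x"
      using norm_diff_orthonormal_proj_le[of F x] F t(1) by (intro mult_left_mono) auto
    finally show ?thesis by (simp add: bounded_clinear_diff[OF lin])
  qed
  ultimately show ?thesis by blast
qed

lemma weak_schatten_approximable:
  assumes G: "G \<in> weak_schatten p" "\<And>x y. cinner (G x) y = cinner x (G y)" and "p > 0"
  shows "approximable (1 / p) G"
proof -
  obtain \<mu> where \<mu>: "singular_values G \<mu>" "\<mu> \<in> O(\<lambda>k. real k powr (- 1 / p))"
    and cp: "compact_operator G"
    using G(1) by (auto simp: weak_schatten_def)
  obtain c where c: "c > 0" "eventually (\<lambda>k. norm (\<mu> k) \<le> c * norm (real k powr (- 1 / p))) sequentially"
    using landau_o.bigE[OF \<mu>(2)] by blast
  then obtain j0 where j0: "\<And>j. j \<ge> j0 \<Longrightarrow> norm (\<mu> j) \<le> c * norm (real j powr (- 1 / p))"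
    by (auto simp: eventually_sequentially)
  have "\<exists>F. rank_at_most (Suc j0 * k) F \<and> (\<forall>x. norm (G x - F x) \<le> c * real k powr (- (1 / p)) * norm x)"
    if k: "k \<ge> 1" for k
  proof -
    \<comment> \<open>With this threshold the O-bound, valid from \<open>j0\<close> on, leaves at
      most max j0 k singular values above \<open>t\<close>. This is at most
      \<open>Suc j0 * k\<close>, so the unknown initial segment is absorbed by the rank
      factor.\<close>
    define t where "t = c * real k powr (- (1 / p))"
    have t: "t > 0" using c k by (simp add: t_def)
    have sub: "{j. \<mu> j > t} \<subseteq> {..<max j0 k}"
    proof (rule subsetI, rule ccontr)
      fix j assume j: "j \<in> {j. \<mu> j > t}" "j \<notin> {..<max j0 k}"
      then have "\<mu> j \<le> c * real j powr (- (1 / p))" using j0[of j] by (auto simp: not_less)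
      also have "\<dots> \<le> t"
        unfolding t_def using j(2) k assms(3) c(1)
        by (intro mult_left_mono powr_mono2') auto
      finally show False using j(1) by simp
    qed
    then have fin: "finite {j. \<mu> j > t}" using finite_subset by blast
    obtain F where F: "rank_at_most (card {j. \<mu> j > t}) F" "\<forall>x. norm (G x - F x) \<le> t * norm x"
      using singular_values_approximation[OF cp G(2) \<mu>(1) t fin] by blast
    have "card {j. \<mu> j > t} \<le> max j0 k" using card_mono[OF _ sub] by simp
    also have "\<dots> \<le> Suc j0 * k" using k by (cases k) auto
    finally have "rank_at_most (Suc j0 * k) F" by (rule rank_at_most_mono[OF F(1)])
    then show ?thesis using F(2) unfolding t_def by blast
  qed
  then show ?thesis
    using cp c(1) unfolding approximable_def compact_operator_def by (meson less_imp_le)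
qed

section \<open>Fredholm operators\<close>

lemma vector_space_pair_scaleC:
  "vector_space_pair (scaleC :: complex \<Rightarrow> 'a::complex_vector \<Rightarrow> 'a) (scaleC :: complex \<Rightarrow> 'b::complex_vector \<Rightarrow> 'b)"
  by unfold_locales

section \<open>Finite dimensional subspaces, kernels and complements\<close>

lemma finite_dimensional_subspace_orthonormal:
  assumes "complex_vector.subspace V" "finite B" "V \<subseteq> complex_vector.span (B :: 'h::chilbert_space set)"
  obtains F where "finite F" "orthonormal F" "complex_vector.span F = V"
proof -
  obtain C where C: "C \<subseteq> V" "complex_vector.independent C" "V \<subseteq> complex_vector.span C"
    using complex_vector.maximal_independent_subset[of V] by blast
  then have "finite C"
    using complex_vector.independent_span_bound[OF assms(2)] assms(3) by blast
  moreover have "complex_vector.span C = V"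
    using C assms(1) by (simp add: complex_vector.span_minimal subset_antisym)
  ultimately show ?thesis using gram_schmidt that by metis
qed

lemma dim_orthonormal:
  assumes "orthonormal F" "complex_vector.span F = V"
  shows "complex_vector.dim V = card F"
  using assms complex_vector.dim_span_eq_card_independent[OF orthonormal_independent] by blast

text \<open>The complement consists of the vectors of \<open>V\<close> orthogonal to a basis of
  \<open>K\<close>; orthogonality makes the two bases disjoint, so their sizes add up to the
  dimension.\<close>

lemma orthonormal_relative_complement:
  assumes K: "complex_vector.subspace K" "K \<subseteq> V" and V: "complex_vector.subspace V"
    and B: "finite B" "V \<subseteq> complex_vector.span (B :: 'h::chilbert_space set)"
  obtains F G where "finite F" "finite G" "orthonormal F" "orthonormal G"
    "complex_vector.span F = K" "G \<subseteq> V" "K \<inter> complex_vector.span G = {0}"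
    "V = {x + y |x y. x \<in> K \<and> y \<in> complex_vector.span G}"
    "complex_vector.dim V = card F + card G"
proof -
  obtain F where F: "finite F" "orthonormal F" "complex_vector.span F = K"
    using finite_dimensional_subspace_orthonormal[OF K(1) B(1)] K(2) B(2) by blast
  define L where "L = {x \<in> V. \<forall>u\<in>F. cinner u x = 0}"
  have "complex_vector.subspace L"
    using V by (auto simp: L_def complex_vector.subspace_def cinner_add_right cinner_scaleC_right)
  moreover have "L \<subseteq> complex_vector.span B" using B(2) by (auto simp: L_def)
  ultimately obtain G where G: "finite G" "orthonormal G" "complex_vector.span G = L"
    using finite_dimensional_subspace_orthonormal[OF _ B(1), of L] by blast
  have GL: "G \<subseteq> L" using G(3) complex_vector.span_superset by blast
  have KL: "K \<inter> L = {0}"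
  proof -
    have "x = 0" if "x \<in> K" "x \<in> L" for x
      using cinner_span_eq_0[of F x x] that F(3) by (auto simp: L_def)
    then show ?thesis
      using complex_vector.subspace_0[OF K(1)] complex_vector.span_zero[of G] G(3) by auto
  qed
  have sum: "V = {x + y |x y. x \<in> K \<and> y \<in> L}"
  proof
    show "V \<subseteq> {x + y |x y. x \<in> K \<and> y \<in> L}"
    proof
      fix x assume x: "x \<in> V"
      have p: "orthonormal_proj F x \<in> K" using orthonormal_proj_in_span F(3) by blast
      have "x - orthonormal_proj F x \<in> L"
        unfolding L_def using x p K(2) cinner_diff_orthonormal_proj[OF F(1,2)] complex_vector.span_base
        by (intro CollectI conjI ballI complex_vector.subspace_diff[OF V]) blast+
      moreover have "x = orthonormal_proj F x + (x - orthonormal_proj F x)" by simp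
      ultimately show "x \<in> {x + y |x y. x \<in> K \<and> y \<in> L}"
        using p by blast
    qed
    show "{x + y |x y. x \<in> K \<and> y \<in> L} \<subseteq> V"
      using K(2) complex_vector.subspace_add[OF V] by (auto simp: L_def)
  qed
  have orth: "cinner u v = 0" if "u \<in> F" "v \<in> G" for u v
    using that GL by (auto simp: L_def)
  have disj: "F \<inter> G = {}"
    using orth orthonormal_norm[OF F(2)] by force
  have "orthonormal (F \<union> G)"
    unfolding orthonormal_def
  proof (intro ballI)
    fix x y assume "x \<in> F \<union> G" "y \<in> F \<union> G"
    then show "cinner x y = (if x = y then 1 else 0)"
      using orthonormalD[OF F(2)] orthonormalD[OF G(2)] orth orth[THEN cinner_eq_0_commute[THEN iffD1]] disj
      by (metis IntI UnE empty_iff)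
  qed
  moreover have "complex_vector.span (F \<union> G) = V"
    unfolding complex_vector.span_Un F(3) G(3) sum by blast
  ultimately have "complex_vector.dim V = card (F \<union> G)"
    by (rule dim_orthonormal)
  then have dim: "complex_vector.dim V = card F + card G"
    using disj F(1) G(1) by (simp add: card_Un_disjoint)
  have GV: "G \<subseteq> V" using GL by (auto simp: L_def)
  show ?thesis
    by (rule that[OF F(1) G(1) F(2) G(2) F(3) GV KL[folded G(3)] sum[folded G(3)] dim])
qed

lemma rank_nullity:
  assumes T: "Vector_Spaces.linear scaleC scaleC (T :: 'h \<Rightarrow> 'h)" and V: "complex_vector.subspace V"
    and B: "finite B" "V \<subseteq> complex_vector.span (B :: 'h::chilbert_space set)"
  shows "finite_dimensional (kernel_on T V)"
    and "complex_vector.dim V = complex_vector.dim (kernel_on T V) + complex_vector.dim (T ` V)"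
proof -
  interpret vector_space_pair "scaleC :: complex \<Rightarrow> 'h \<Rightarrow> 'h" "scaleC :: complex \<Rightarrow> 'h \<Rightarrow> 'h"
    by (rule vector_space_pair_scaleC)
  have sub: "complex_vector.subspace (kernel_on T V)"
    using V by (auto simp: kernel_on_def complex_vector.subspace_def linear_0[OF T] linear_add[OF T]
        linear_scale[OF T])
  have le: "kernel_on T V \<subseteq> V" by (auto simp: kernel_on_def)
  obtain F G where FG: "finite F" "finite G" "orthonormal F" "orthonormal G"
    "complex_vector.span F = kernel_on T V" "G \<subseteq> V" "kernel_on T V \<inter> complex_vector.span G = {0}"
    "V = {x + y |x y. x \<in> kernel_on T V \<and> y \<in> complex_vector.span G}"
    "complex_vector.dim V = card F + card G"
    by (rule orthonormal_relative_complement[OF sub le V B])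
  have GV: "complex_vector.span G \<subseteq> V" using FG(6) V by (rule complex_vector.span_minimal)
  have inj: "inj_on T (complex_vector.span G)"
    unfolding linear_inj_on_iff_eq_0[OF T complex_vector.subspace_span]
    using FG(7) GV by (auto simp: kernel_on_def)
  have "T ` V = T ` complex_vector.span G"
  proof
    show "T ` V \<subseteq> T ` complex_vector.span G"
    proof
      fix z assume "z \<in> T ` V"
      then obtain v where v: "z = T v" "v \<in> V" by blast
      then obtain x y where "v = x + y" "x \<in> kernel_on T V" "y \<in> complex_vector.span G"
        using FG(8) by blast
      then have "z = T (x + y)" "x \<in> kernel_on T V" "y \<in> complex_vector.span G"
        using v by simp_all
      then show "z \<in> T ` complex_vector.span G" by (simp add: linear_add[OF T] kernel_on_def)
    qed
  qed (use GV in blast)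
  also have "\<dots> = complex_vector.span (T ` G)" by (rule linear_span_image[OF T, symmetric])
  finally have TV: "T ` V = complex_vector.span (T ` G)" .
  have "complex_vector.independent (T ` G)"
    using orthonormal_independent[OF FG(4)] inj by (rule linear_independent_injective_image[OF T])
  then have "complex_vector.dim (T ` V) = card (T ` G)"
    unfolding TV by (rule complex_vector.dim_span_eq_card_independent)
  also have "\<dots> = card G"
    using inj complex_vector.span_superset by (intro card_image) (rule inj_on_subset)
  finally show "complex_vector.dim V = complex_vector.dim (kernel_on T V) + complex_vector.dim (T ` V)"
    using dim_orthonormal[OF FG(3,5)] FG(9) by simp
  show "finite_dimensional (kernel_on T V)"
    unfolding finite_dimensional_def using FG(1,5) by blast
qed

text \<open>Choose for every b in \<open>B\<close> a vector of the span of \<open>F\<close>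
  congruent to b modulo \<open>U\<close>, and extend linearly. This map changes vectors of the span
  of \<open>B\<close> only by elements of \<open>U\<close>, so its kernel there lies in
  \<open>U \<inter> C\<close> and it carries \<open>B\<close> injectively to an independent
  set.\<close>

lemma complement_card_le:
  assumes U: "complex_vector.subspace U" and C: "complex_vector.subspace C" "U \<inter> C = {0}"
    and sub: "C \<subseteq> {u + c |u c. u \<in> U \<and> c \<in> complex_vector.span F}" and F: "finite F"
    and B: "complex_vector.independent B" "B \<subseteq> (C :: 'v::complex_vector set)"
  shows "finite B \<and> card B \<le> card F"
proof -
  interpret vector_space_pair "scaleC :: complex \<Rightarrow> 'v \<Rightarrow> 'v" "scaleC :: complex \<Rightarrow> 'v \<Rightarrow> 'v"
    by (rule vector_space_pair_scaleC)
  have "\<exists>c. c \<in> complex_vector.span F \<and> b - c \<in> U" if "b \<in> B" for b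
  proof -
    have "b \<in> {u + c |u c. u \<in> U \<and> c \<in> complex_vector.span F}" using sub B(2) that by blast
    then obtain u c where "b = u + c" "u \<in> U" "c \<in> complex_vector.span F" by blast
    then show ?thesis by (intro exI[of _ c]) simp
  qed
  then obtain g0 where g0: "\<And>b. b \<in> B \<Longrightarrow> g0 b \<in> complex_vector.span F" "\<And>b. b \<in> B \<Longrightarrow> b - g0 b \<in> U"
    by metis
  obtain g where g: "Vector_Spaces.linear scaleC scaleC g" "\<forall>x\<in>B. g x = g0 x"
    using linear_independent_extend[OF B(1)] by blast
  have "complex_vector.span B \<subseteq> {x. g x \<in> complex_vector.span F \<and> x - g x \<in> U}"
  proof (rule complex_vector.span_minimal)
    show "B \<subseteq> {x. g x \<in> complex_vector.span F \<and> x - g x \<in> U}" using g(2) g0 by auto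
    show "complex_vector.subspace {x. g x \<in> complex_vector.span F \<and> x - g x \<in> U}"
      unfolding complex_vector.subspace_def
    proof (intro conjI ballI allI; clarsimp simp: linear_0[OF g(1)] linear_add[OF g(1)] linear_scale[OF g(1)]
          complex_vector.subspace_0[OF U] complex_vector.span_zero complex_vector.span_add complex_vector.span_scale)
      fix x y assume "x - g x \<in> U" "y - g y \<in> U"
      from complex_vector.subspace_add[OF U this] show "x + y - (g x + g y) \<in> U" by (simp add: algebra_simps)
    next
      fix c x assume "x - g x \<in> U"
      from complex_vector.subspace_scale[OF U this, of c] show "c *\<^sub>C x - c *\<^sub>C g x \<in> U"
        by (simp add: complex_vector.scale_right_diff_distrib)
    qed
  qed
  moreover have BC: "complex_vector.span B \<subseteq> C" using B(2) C(1) by (rule complex_vector.span_minimal)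
  ultimately have "\<forall>x\<in>complex_vector.span B. g x = 0 \<longrightarrow> x = 0"
    using C(2) by fastforce
  then have inj: "inj_on g (complex_vector.span B)"
    unfolding linear_inj_on_iff_eq_0[OF g(1) complex_vector.subspace_span] .
  have "complex_vector.independent (g ` B)"
    using B(1) inj by (rule linear_independent_injective_image[OF g(1)])
  moreover have "g ` B \<subseteq> complex_vector.span F" using g(2) g0(1) by auto
  ultimately have "finite (g ` B) \<and> card (g ` B) \<le> card F"
    by (rule complex_vector.independent_span_bound[OF F])
  moreover have "inj_on g B"
    using inj complex_vector.span_superset by (rule inj_on_subset)
  ultimately show ?thesis using card_image finite_imageD by metis
qed

text \<open>The choice operator returns an unspecified complement. The span of \<open>F\<close>
  shows that the choice succeeds, and comparing the two complements in both directions fixes the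
  dimension.\<close>

lemma quotient_complement_dim:
  assumes U: "complex_vector.subspace U" and F: "finite F" "complex_vector.independent F"
    and F0: "U \<inter> complex_vector.span F = {0}" "{u + c |u c. u \<in> U \<and> c \<in> complex_vector.span F} = W"
  shows "finite_dimensional (quotient_complement W U)"
    and "complex_vector.dim (quotient_complement W U) = card (F :: 'v::complex_vector set)"
proof -
  define C where "C = quotient_complement W U"
  have "complex_vector.subspace C \<and> U \<inter> C = {0} \<and> {u + c |u c. u \<in> U \<and> c \<in> C} = W"
    unfolding C_def quotient_complement_def
    by (rule someI[of _ "complex_vector.span F"]) (use F0 complex_vector.subspace_span in blast)
  then have C: "complex_vector.subspace C" "U \<inter> C = {0}" "{u + c |u c. u \<in> U \<and> c \<in> C} = W" by blast+
  have CW: "C \<subseteq> {u + c |u c. u \<in> U \<and> c \<in> complex_vector.span F}"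
    unfolding F0(2) C(3)[symmetric] using complex_vector.subspace_0[OF U] by force
  obtain B where B: "B \<subseteq> C" "complex_vector.independent B" "C \<subseteq> complex_vector.span B"
    using complex_vector.maximal_independent_subset[of C] by blast
  have finB: "finite B" "card B \<le> card F"
    using complement_card_le[OF U C(1,2) CW F(1) B(2,1)] by auto
  have spanB: "complex_vector.span B = C"
    using B C(1) by (simp add: complex_vector.span_minimal subset_antisym)
  have "complex_vector.span F \<subseteq> {u + c |u c. u \<in> U \<and> c \<in> complex_vector.span B}"
    unfolding spanB C(3) F0(2)[symmetric] using complex_vector.subspace_0[OF U] by force
  then have "card F \<le> card B"
    using complement_card_le[OF U complex_vector.subspace_span F0(1) _ finB(1) F(2)]
      complex_vector.span_superset by blast
  then have "complex_vector.dim C = card F"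
    using finB complex_vector.basis_card_eq_dim[OF B(1,3,2)] by simp
  then show "complex_vector.dim (quotient_complement W U) = card F" by (simp add: C_def)
  show "finite_dimensional (quotient_complement W U)"
    unfolding C_def[symmetric] finite_dimensional_def using finB spanB by blast
qed

lemma index_finite_dimensional_reduction:
  assumes T: "bounded_clinear (T :: 'h::chilbert_space \<Rightarrow> 'h)"
    and V: "complex_vector.subspace V" and W: "complex_vector.subspace W" and TV: "T ` V \<subseteq> W"
    and V0: "finite F" "orthonormal F" "complex_vector.span F \<subseteq> V" "kernel_on T V \<subseteq> complex_vector.span F"
    and W0: "finite G" "orthonormal G" "W = {x + y |x y. x \<in> T ` V \<and> y \<in> complex_vector.span G}"
      "T ` complex_vector.span F \<subseteq> complex_vector.span G"
      "T ` V \<inter> complex_vector.span G \<subseteq> T ` complex_vector.span F"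
  shows "fredholm_on T V W" "fredholm_index T V W = int (card F) - int (card G)"
proof -
  interpret vector_space_pair "scaleC :: complex \<Rightarrow> 'h \<Rightarrow> 'h" "scaleC :: complex \<Rightarrow> 'h \<Rightarrow> 'h"
    by (rule vector_space_pair_scaleC)
  let ?V0 = "complex_vector.span F" and ?W0 = "complex_vector.span G"
  have lin: "Vector_Spaces.linear scaleC scaleC T" by (rule bounded_clinear_linear[OF T])
  have ker: "kernel_on T V = kernel_on T ?V0"
    using V0(3,4) by (auto simp: kernel_on_def)
  have kfin: "finite_dimensional (kernel_on T V)"
    and kdim: "int (complex_vector.dim (kernel_on T V)) = int (card F) - int (complex_vector.dim (T ` ?V0))"
    unfolding ker using rank_nullity[OF lin complex_vector.subspace_span V0(1) subset_refl]
      dim_orthonormal[OF V0(2) refl] by auto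
  have sub: "complex_vector.subspace (T ` ?V0)"
    by (rule linear_subspace_image[OF lin complex_vector.subspace_span])
  obtain A C where AC: "finite A" "finite C" "orthonormal A" "orthonormal C"
    "complex_vector.span A = T ` ?V0" "C \<subseteq> ?W0" "T ` ?V0 \<inter> complex_vector.span C = {0}"
    "?W0 = {x + y |x y. x \<in> T ` ?V0 \<and> y \<in> complex_vector.span C}"
    "complex_vector.dim ?W0 = card A + card C"
    by (rule orthonormal_relative_complement[OF sub W0(4) complex_vector.subspace_span W0(1) subset_refl])
  have CW: "complex_vector.span C \<subseteq> ?W0"
    using AC(6) complex_vector.subspace_span by (rule complex_vector.span_minimal)
  have sTV: "complex_vector.subspace (T ` V)" by (rule linear_subspace_image[OF lin V])
  have int: "T ` V \<inter> complex_vector.span C = {0}"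
    using AC(7) CW W0(5) complex_vector.subspace_0[OF sTV] complex_vector.span_zero by blast
  have sum: "{u + c |u c. u \<in> T ` V \<and> c \<in> complex_vector.span C} = W"
  proof
    show "{u + c |u c. u \<in> T ` V \<and> c \<in> complex_vector.span C} \<subseteq> W"
      unfolding W0(3) using CW by blast
    show "W \<subseteq> {u + c |u c. u \<in> T ` V \<and> c \<in> complex_vector.span C}"
    proof
      fix w assume "w \<in> W"
      then obtain u y where uy: "w = u + y" "u \<in> T ` V" "y \<in> ?W0" unfolding W0(3) by blast
      then obtain x c where xc: "y = x + c" "x \<in> T ` ?V0" "c \<in> complex_vector.span C"
        using AC(8) by blast
      have "u + x \<in> T ` V" using uy(2) xc(2) V0(3) by (intro complex_vector.subspace_add[OF sTV]) auto
      then show "w \<in> {u + c |u c. u \<in> T ` V \<and> c \<in> complex_vector.span C}"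
        using uy(1) xc(1,3) by (metis (mono_tags, lifting) add.assoc mem_Collect_eq)
    qed
  qed
  note coker = quotient_complement_dim[OF sTV AC(2) orthonormal_independent[OF AC(4)] int sum]
  obtain K where K: "\<And>x. norm (T x) \<le> K * norm x"
    using bounded_clinear_bound[OF T] by blast
  show fred: "fredholm_on T V W"
    unfolding fredholm_on_def cokernel_on_def
    using V W TV kfin coker(1) K bounded_clinear_simps[OF T] by blast
  have "int (card C) = int (card G) - int (complex_vector.dim (T ` ?V0))"
    using AC(9) dim_orthonormal[OF AC(3,5)] dim_orthonormal[OF W0(2) refl] by simp
  then show "fredholm_index T V W = int (card F) - int (card G)"
    using fred kdim coker(2) by (simp add: fredholm_index_def cokernel_on_def)
qed

text \<open>\<open>V y\<close> is the fixed point of the contraction z \<mapsto> y + X z. Uniqueness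
  of fixed points makes \<open>V\<close> linear and a two-sided inverse of 1 - X.\<close>

lemma neumann_inverse:
  assumes X: "bounded_clinear (X :: 'h::chilbert_space \<Rightarrow> 'h)" "\<And>x. norm (X x) \<le> c * norm x" and c: "0 \<le> c" "c < 1"
  obtains V where "bounded_clinear V" "\<And>x. V (x - X x) = x" "\<And>x. V x - X (V x) = x"
proof -
  note simps = bounded_clinear_simps[OF X(1)]
  have "\<exists>!z. z - X z = y" for y
  proof -
    have "\<exists>!z. y + X z = z"
    proof (rule banach_fix_type[OF c])
      show "\<forall>x z. dist (y + X x) (y + X z) \<le> c * dist x z"
        using X(2) by (metis add_diff_cancel_left dist_norm simps(2))
    qed
    moreover have "y + X z = z \<longleftrightarrow> z - X z = y" for z by (auto simp: algebra_simps)
    ultimately show ?thesis by simp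
  qed
  then obtain V where V: "\<And>y. V y - X (V y) = y" and uniq: "\<And>y z. z - X z = y \<Longrightarrow> z = V y"
    by metis
  have "bounded_clinear V"
  proof (rule bounded_clinearI)
    show "V (x + y) = V x + V y" for x y
    proof (rule uniq[symmetric])
      have "V x + V y - X (V x + V y) = (V x - X (V x)) + (V y - X (V y))" by (simp add: simps)
      then show "V x + V y - X (V x + V y) = x + y" by (simp only: V)
    qed
    show "V (a *\<^sub>C x) = a *\<^sub>C V x" for a x
    proof (rule uniq[symmetric])
      have "a *\<^sub>C V x - X (a *\<^sub>C V x) = a *\<^sub>C (V x - X (V x))"
        by (simp only: simps complex_vector.scale_right_diff_distrib)
      then show "a *\<^sub>C V x - X (a *\<^sub>C V x) = a *\<^sub>C x" by (simp only: V)
    qed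
    show "norm (V x) \<le> 1 / (1 - c) * norm x" for x
    proof -
      have "norm (V x) \<le> norm x + norm (X (V x))"
        using norm_triangle_ineq[of x "X (V x)"] V[of x] by (simp add: diff_eq_eq)
      also have "\<dots> \<le> norm x + c * norm (V x)" using X(2) by simp
      finally show ?thesis using c by (simp add: field_simps)
    qed
  qed
  moreover have "V (x - X x) = x" for x using uniq by metis
  ultimately show ?thesis using that V by blast
qed

section \<open>Index formulas from parametrices\<close>

definition finite_rank :: "('h::chilbert_space \<Rightarrow> 'h) \<Rightarrow> bool" where
  "finite_rank X \<longleftrightarrow> (\<exists>k. rank_at_most k X)"

lemma finite_rank_bounded: "finite_rank X \<Longrightarrow> bounded_clinear X"
  by (auto simp: finite_rank_def rank_at_most_bounded)

lemma finite_rank_nuclear: "finite_rank X \<Longrightarrow> nuclear X"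
  by (auto simp: finite_rank_def rank_at_most_nuclear)

lemma finite_rank_comp_left: "finite_rank X \<Longrightarrow> bounded_clinear S \<Longrightarrow> finite_rank (S \<circ> X)"
  unfolding finite_rank_def using rank_at_most_comp_left by blast

lemma finite_rank_comp_right: "finite_rank X \<Longrightarrow> bounded_clinear S \<Longrightarrow> finite_rank (X \<circ> S)"
  unfolding finite_rank_def using rank_at_most_comp_right by blast

lemma finite_rank_add: "finite_rank X \<Longrightarrow> finite_rank Y \<Longrightarrow> finite_rank (\<lambda>x. X x + Y x)"
  unfolding finite_rank_def using rank_at_most_add by blast

lemma finite_rank_diff: "finite_rank X \<Longrightarrow> finite_rank Y \<Longrightarrow> finite_rank (\<lambda>x. X x - Y x)"
  unfolding finite_rank_def using rank_at_most_diff by blast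

lemma finite_rank_orthonormal_proj: "finite F \<Longrightarrow> orthonormal F \<Longrightarrow> finite_rank (orthonormal_proj F)"
  unfolding finite_rank_def using rank_at_most_orthonormal_proj by blast

lemma subspace_range: "bounded_clinear T \<Longrightarrow> complex_vector.subspace (range T)"
  using span_image_bounded_clinear[of T UNIV] complex_vector.subspace_span[of "range T"] by simp

lemma finite_rank_range:
  assumes "finite_rank (X :: 'h::chilbert_space \<Rightarrow> 'h)"
  obtains F where "finite F" "orthonormal F" "complex_vector.span F = range X"
proof -
  obtain k where "rank_at_most k X" using assms by (auto simp: finite_rank_def)
  then obtain B where "finite B" "range X \<subseteq> complex_vector.span B"
    by (auto simp: rank_at_most_def)
  then show ?thesis
    using finite_dimensional_subspace_orthonormal[OF subspace_range[OF finite_rank_bounded[OF assms]]] that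
    by metis
qed

text \<open>\<open>T\<close> restricts to an operator from \<open>V = range P\<close> to \<open>W = range Q\<close> with a parametrix \<open>S\<close>. Both the
  kernel and the cokernel are already seen on the finite dimensional spaces \<open>range (1 - S T)\<close> and
  \<open>range (1 - T S)\<close>, between which \<open>T\<close> and \<open>S\<close> map back and forth.\<close>

lemma fredholm_index_parametrix:
  assumes P: "bounded_clinear (P :: 'h::chilbert_space \<Rightarrow> 'h)" "\<And>x. P (P x) = P x"
    and Q: "bounded_clinear Q" "\<And>x. Q (Q x) = Q x"
    and T: "bounded_clinear T" "\<And>x. Q (T x) = T x" "\<And>x. T (P x) = T x"
    and S: "bounded_clinear S" "\<And>x. P (S x) = S x" "\<And>x. S (Q x) = S x"
    and a: "finite_rank (\<lambda>x. P x - S (T x))" and b: "finite_rank (\<lambda>x. Q x - T (S x))"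
  shows "fredholm_on T (range P) (range Q)"
    and "\<exists>ta tb. has_trace (\<lambda>x. P x - S (T x)) ta \<and> has_trace (\<lambda>x. Q x - T (S x)) tb \<and>
      of_int (fredholm_index T (range P) (range Q)) = ta - tb"
proof -
  define A where "A x = P x - S (T x)" for x
  define B where "B x = Q x - T (S x)" for x
  have fA: "finite_rank A" and fB: "finite_rank B"
    using a b by (simp_all add: A_def[abs_def] B_def[abs_def])
  note simps = bounded_clinear_simps[OF P(1)] bounded_clinear_simps[OF Q(1)] bounded_clinear_simps[OF T(1)]
    bounded_clinear_simps[OF S(1)] P(2) Q(2) T(2,3) S(2,3)
  obtain F where F: "finite F" "orthonormal F" "complex_vector.span F = range A"
    by (rule finite_rank_range[OF fA])
  obtain G where G: "finite G" "orthonormal G" "complex_vector.span G = range B"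
    by (rule finite_rank_range[OF fB])
  have PA: "P (A x) = A x" and QB: "Q (B x) = B x" for x
    by (simp_all add: A_def B_def simps)
  have TA: "T (A x) = B (T x)" and SB: "S (B x) = A (S x)" for x
    by (simp_all add: A_def B_def simps)
  have TP: "T ` range P = range T"
    using T(3) by (metis image_image image_cong)
  have W: "range Q = {x + y |x y. x \<in> T ` range P \<and> y \<in> complex_vector.span G}"
  proof
    show "range Q \<subseteq> {x + y |x y. x \<in> T ` range P \<and> y \<in> complex_vector.span G}"
    proof
      fix w assume "w \<in> range Q"
      then have "w = T (S w) + B w" using Q(2) by (auto simp: B_def)
      then show "w \<in> {x + y |x y. x \<in> T ` range P \<and> y \<in> complex_vector.span G}"
        unfolding TP G(3) by blast
    qed
    show "{x + y |x y. x \<in> T ` range P \<and> y \<in> complex_vector.span G} \<subseteq> range Q"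
    proof clarsimp
      fix x y assume "y \<in> complex_vector.span G"
      then have "Q y = y" using QB by (auto simp: G(3))
      then have "T (P x) + y = Q (T x + y)" by (simp add: simps)
      then show "T (P x) + y \<in> range Q" by (rule range_eqI)
    qed
  qed
  have kerF: "kernel_on T (range P) \<subseteq> complex_vector.span F"
  proof
    fix x assume "x \<in> kernel_on T (range P)"
    then have "A x = x" by (auto simp: kernel_on_def A_def simps)
    then show "x \<in> complex_vector.span F" unfolding F(3) by (metis rangeI)
  qed
  have inter: "T ` range P \<inter> complex_vector.span G \<subseteq> T ` complex_vector.span F"
    unfolding TP F(3) G(3)
  proof
    fix w assume "w \<in> range T \<inter> range B"
    then obtain v z where vz: "w = T v" "w = B z" by blast
    have "T v = T (P v)" by (simp add: simps)
    also have "P v = A v + S (T v)" by (simp add: A_def)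
    also have "S (T v) = A (S z)" using vz SB by metis
    also have "A v + A (S z) = A (v + S z)"
      by (rule bounded_clinear_add[OF finite_rank_bounded[OF fA], symmetric])
    finally show "w \<in> T ` range A" using vz by blast
  qed
  have TF: "T ` complex_vector.span F \<subseteq> complex_vector.span G"
    unfolding F(3) G(3) using TA by auto
  have FP: "complex_vector.span F \<subseteq> range P"
    unfolding F(3) using PA by (metis image_subsetI rangeI)
  have TQ: "T ` range P \<subseteq> range Q" using T(2) by (metis image_subsetI rangeI)
  note red = index_finite_dimensional_reduction[OF T(1) subspace_range[OF P(1)] subspace_range[OF Q(1)]
      TQ F(1,2) FP kerF G(1,2) W TF inter]
  show "fredholm_on T (range P) (range Q)" by (rule red(1))
  \<comment> \<open>The operators S T and T S need not have traces, so the projections onto the two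
    finite dimensional ranges are inserted. The traces of \<open>A\<close> and \<open>B\<close> then
    become card F - z and card G - z with the same unknown z, the trace of S q T, which cancels in
    the difference.\<close>
  define p where "p = orthonormal_proj F"
  define q where "q = orthonormal_proj G"
  have p: "bounded_clinear p" "nuclear p" "has_trace p (of_nat (card F))"
    and q: "bounded_clinear q" "nuclear q" "has_trace q (of_nat (card G))"
    unfolding p_def q_def using F G
    by (auto intro: bounded_clinear_orthonormal_proj has_trace_orthonormal_proj finite_rank_nuclear
        finite_rank_orthonormal_proj)
  have p_id: "p (A x) = A x" and q_id: "q (B x) = B x" for x
    unfolding p_def q_def using F G by (auto intro: orthonormal_proj_id)
  have p_range: "\<exists>z. p x = A z" and q_range: "\<exists>z. q x = B z" for x
    using orthonormal_proj_in_span[of F x] orthonormal_proj_in_span[of G x] F(3) G(3)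
    by (auto simp: p_def q_def)
  have Pp: "P (p x) = p x" and Qq: "Q (q x) = q x" for x
    using p_range[of x] q_range[of x] PA QB by auto
  have qTp: "q (T (p x)) = T (p x)" for x
    using p_range[of x] TA q_id by auto
  have pSq: "p (S (q x)) = S (q x)" for x
    using q_range[of x] SB p_id by auto
  obtain ta where ta: "has_trace (p \<circ> A) ta" "has_trace (A \<circ> p) ta"
    using nuclear_trace_commute[OF p(2) finite_rank_bounded[OF fA]] by blast
  obtain tb where tb: "has_trace (q \<circ> B) tb" "has_trace (B \<circ> q) tb"
    using nuclear_trace_commute[OF q(2) finite_rank_bounded[OF fB]] by blast
  have Sq: "nuclear (S \<circ> q)" using nuclear_comp_left[OF q(2) S(1)] .
  obtain z where z: "has_trace ((S \<circ> q) \<circ> T) z" "has_trace (T \<circ> (S \<circ> q)) z"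
    using nuclear_trace_commute[OF Sq T(1)] by blast
  have Z: "bounded_clinear ((S \<circ> q) \<circ> T)"
    using S(1) q(1) T(1) by (intro bounded_clinear_compose)
  obtain z' where z': "has_trace (p \<circ> ((S \<circ> q) \<circ> T)) z'" "has_trace (((S \<circ> q) \<circ> T) \<circ> p) z'"
    using nuclear_trace_commute[OF p(2) Z] by blast
  have "p \<circ> ((S \<circ> q) \<circ> T) = (S \<circ> q) \<circ> T" by (auto simp: pSq)
  then have "z' = z" using z(1) z'(1) has_trace_unique by metis
  moreover have "((S \<circ> q) \<circ> T) \<circ> p = (\<lambda>x. S (T (p x)))" by (auto simp: qTp)
  ultimately have "has_trace (\<lambda>x. p x - S (T (p x))) (of_nat (card F) - z)"
    using z'(2) p(3) by (intro has_trace_diff) auto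
  moreover have "A \<circ> p = (\<lambda>x. p x - S (T (p x)))" by (auto simp: A_def Pp)
  ultimately have 1: "ta = of_nat (card F) - z" using ta(2) has_trace_unique by metis
  have "has_trace (\<lambda>x. q x - T (S (q x))) (of_nat (card G) - z)"
    using z(2) q(3) by (intro has_trace_diff) (auto simp: o_def)
  moreover have "B \<circ> q = (\<lambda>x. q x - T (S (q x)))" by (auto simp: B_def Qq)
  ultimately have 2: "tb = of_nat (card G) - z" using tb(2) has_trace_unique by metis
  have "p \<circ> A = A" "q \<circ> B = B" by (auto simp: p_id q_id)
  then have "has_trace A ta" "has_trace B tb" using ta tb by simp_all
  moreover have "of_int (fredholm_index T (range P) (range Q)) = ta - tb"
    by (simp add: red(2) 1 2)
  ultimately show "\<exists>ta tb. has_trace (\<lambda>x. P x - S (T x)) ta \<and> has_trace (\<lambda>x. Q x - T (S x)) tb \<and>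
      of_int (fredholm_index T (range P) (range Q)) = ta - tb"
    by (auto simp: A_def[abs_def] B_def[abs_def])
qed

text \<open>With a = P - R T and b = Q - T S one has R b - a S = R - S, so R - S is a difference of
  nuclear operators. Replacing \<open>S\<close> by \<open>R\<close> changes the two defects by (R -
  S) T and T (R - S) up to a common sign; these have equal traces by cyclicity, so the difference of
  the defect traces stays the same.\<close>

lemma fredholm_index_nuclear_parametrix:
  assumes P: "bounded_clinear (P :: 'h::chilbert_space \<Rightarrow> 'h)" "\<And>x. P (P x) = P x"
    and Q: "bounded_clinear Q" "\<And>x. Q (Q x) = Q x"
    and T: "bounded_clinear T" "\<And>x. Q (T x) = T x" "\<And>x. T (P x) = T x"
    and S: "bounded_clinear S" "\<And>x. P (S x) = S x" "\<And>x. S (Q x) = S x"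
    and S_rank: "finite_rank (\<lambda>x. P x - S (T x))" "finite_rank (\<lambda>x. Q x - T (S x))"
    and R: "bounded_clinear R" "\<And>x. P (R x) = R x" "\<And>x. R (Q x) = R x"
    and R_nuclear: "nuclear (\<lambda>x. P x - R (T x))" "nuclear (\<lambda>x. Q x - T (R x))"
    and tr: "has_trace (\<lambda>x. P x - R (T x)) ra" "has_trace (\<lambda>x. Q x - T (R x)) rb"
  shows "of_int (fredholm_index T (range P) (range Q)) = ra - rb"
proof -
  obtain ta tb where t: "has_trace (\<lambda>x. P x - S (T x)) ta" "has_trace (\<lambda>x. Q x - T (S x)) tb"
      "of_int (fredholm_index T (range P) (range Q)) = ta - tb"
    using fredholm_index_parametrix(2)[OF assms(1-12)] by blast
  note simps = bounded_clinear_simps[OF P(1)] bounded_clinear_simps[OF Q(1)] bounded_clinear_simps[OF T(1)]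
    bounded_clinear_simps[OF S(1)] bounded_clinear_simps[OF R(1)] P(2) Q(2) T(2,3) S(2,3) R(2,3)
  let ?a = "\<lambda>x. P x - R (T x)" and ?b = "\<lambda>x. Q x - T (S x)"
  have n: "nuclear (?a \<circ> S)" "nuclear (R \<circ> ?b)"
    using nuclear_comp_right[OF R_nuclear(1) S(1)] nuclear_comp_left[OF finite_rank_nuclear[OF S_rank(2)] R(1)]
    by auto
  obtain u where u: "has_trace ((?a \<circ> S) \<circ> T) u" "has_trace (T \<circ> (?a \<circ> S)) u"
    using nuclear_trace_commute[OF n(1) T(1)] by blast
  obtain v where v: "has_trace ((R \<circ> ?b) \<circ> T) v" "has_trace (T \<circ> (R \<circ> ?b)) v"
    using nuclear_trace_commute[OF n(2) T(1)] by blast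
  have "has_trace (\<lambda>x. ((R \<circ> ?b) \<circ> T) x - ((?a \<circ> S) \<circ> T) x) (v - u)"
    using v(1) u(1) by (rule has_trace_diff)
  moreover have "(\<lambda>x. ((R \<circ> ?b) \<circ> T) x - ((?a \<circ> S) \<circ> T) x) = (\<lambda>x. (P x - S (T x)) - (P x - R (T x)))"
    by (auto simp: simps algebra_simps)
  ultimately have 1: "v - u = ta - ra"
    using has_trace_diff[OF t(1) tr(1)] has_trace_unique by metis
  have "has_trace (\<lambda>x. (T \<circ> (R \<circ> ?b)) x - (T \<circ> (?a \<circ> S)) x) (v - u)"
    using v(2) u(2) by (rule has_trace_diff)
  moreover have "(\<lambda>x. (T \<circ> (R \<circ> ?b)) x - (T \<circ> (?a \<circ> S)) x) = (\<lambda>x. (Q x - T (S x)) - (Q x - T (R x)))"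
    by (auto simp: simps algebra_simps)
  ultimately have 2: "v - u = tb - rb"
    using has_trace_diff[OF t(2) tr(2)] has_trace_unique by metis
  have "ta = (v - u) + ra" "tb = (v - u) + rb" by (simp_all add: 1) (simp add: 1[symmetric] 2)
  then show ?thesis using t(3) by simp
qed

text \<open>Split off a finite rank \<open>F\<close> from \<open>K\<close> so that X = R (K - F) R
  is a contraction. The inverse \<open>V\<close> of 1 - X commutes with \<open>R\<close> because X
  does, and it inverts R - R K R on the range of \<open>R\<close> up to terms containing
  \<open>F\<close>.\<close>

lemma idempotent_parametrix:
  assumes R: "bounded_clinear (R :: 'h::chilbert_space \<Rightarrow> 'h)" "\<And>x. R (R x) = R x"
    and K: "bounded_clinear K" "\<And>e. e > 0 \<Longrightarrow> \<exists>F. finite_rank F \<and> (\<forall>x. norm (K x - F x) \<le> e * norm x)"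
  obtains V where "bounded_clinear V" "\<And>x. R (V x) = V (R x)"
    "finite_rank (\<lambda>x. R x - V (R x - R (K (R x))))" "finite_rank (\<lambda>x. R x - (R (V x) - R (K (R (V x)))))"
proof -
  obtain M where M: "M > 0" "\<And>x. norm (R x) \<le> M * norm x" using bounded_clinear_bound[OF R(1)] by blast
  \<comment> \<open>This tolerance pays for the two factors \<open>R\<close>, each of norm at most
    \<open>M\<close>, and leaves the contraction constant 1/2.\<close>
  have "1 / (2 * M\<^sup>2) > 0" using M by simp
  then obtain F where F: "finite_rank F" "\<And>x. norm (K x - F x) \<le> 1 / (2 * M\<^sup>2) * norm x"
    using K(2) by blast
  define X where "X x = R (K (R x) - F (R x))" for x
  have bF: "bounded_clinear F" using F(1) by (rule finite_rank_bounded)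
  have bX: "bounded_clinear X"
  proof -
    have "X = R \<circ> ((\<lambda>x. K x - F x) \<circ> R)" by (auto simp: X_def)
    then show ?thesis using R(1) K(1) bF
      by (simp add: bounded_clinear_compose bounded_clinear_minus_op)
  qed
  have "norm (X x) \<le> 1 / 2 * norm x" for x
  proof -
    have "norm (X x) \<le> M * norm (K (R x) - F (R x))" unfolding X_def by (rule M)
    also have "\<dots> \<le> M * (1 / (2 * M\<^sup>2) * norm (R x))" using F(2) M by (intro mult_left_mono) auto
    also have "\<dots> \<le> M * (1 / (2 * M\<^sup>2) * (M * norm x))" using M by (intro mult_left_mono) auto
    finally show ?thesis using M by (simp add: power2_eq_square)
  qed
  then obtain V where V: "bounded_clinear V" "\<And>x. V (x - X x) = x" "\<And>x. V x - X (V x) = x"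
    by (rule neumann_inverse[OF bX]) auto
  note simps = bounded_clinear_simps[OF R(1)] bounded_clinear_simps[OF bF] bounded_clinear_simps[OF K(1)]
    bounded_clinear_simps[OF V(1)] bounded_clinear_simps[OF bX] R(2)
  have RX: "R (X x) = X x" "X (R x) = X x" for x by (simp_all add: X_def simps)
  have comm: "R (V x) = V (R x)" for x
  proof -
    have "V (R (V x) - X (R (V x))) = R (V x)" by (rule V)
    moreover have "R (V x) - X (R (V x)) = R (V x - X (V x))" by (simp add: simps RX)
    ultimately show ?thesis by (simp add: V)
  qed
  have "R x - V (R x - R (K (R x))) = (V \<circ> (R \<circ> (F \<circ> R))) x" for x
  proof -
    have "R x - R (K (R x)) = (R x - X (R x)) - R (F (R x))" by (simp add: X_def simps)
    then have "V (R x - R (K (R x))) = R x - V (R (F (R x)))"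
      using V(2) by (simp only: bounded_clinear_diff[OF V(1)])
    then show ?thesis by simp
  qed
  moreover have "R x - (R (V x) - R (K (R (V x)))) = (R \<circ> (F \<circ> (R \<circ> V))) x" for x
  proof -
    have "R (V x) - R (K (R (V x))) = R (V x - X (V x)) - R (F (R (V x)))" by (simp add: X_def simps)
    then show ?thesis by (simp add: V)
  qed
  moreover have "finite_rank (V \<circ> (R \<circ> (F \<circ> R)))" "finite_rank (R \<circ> (F \<circ> (R \<circ> V)))"
    by (intro finite_rank_comp_left finite_rank_comp_right[OF F(1)] bounded_clinear_compose R(1) V(1))+
  ultimately show ?thesis
    using that[OF V(1) comm] by presburger
qed

text \<open>The parametrix \<open>P Q\<close> has the defect \<open>K = A\<^sup>2\<close>; the finite Neumann sum \<open>R m\<close> below lowers it to \<open>K\<^sup>m\<close>.\<close>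

lemma fredholm_index_idempotents:
  assumes P: "bounded_clinear (P :: 'h::chilbert_space \<Rightarrow> 'h)" "\<And>x. P (P x) = P x"
    and Q: "bounded_clinear Q" "\<And>x. Q (Q x) = Q x"
    and approx: "approximable (1 / real n) (\<lambda>x. P x - Q x)" and n: "even n" "n > 0"
  shows "has_trace ((\<lambda>x. P x - Q x) ^^ Suc n) (of_int (fredholm_index (Q \<circ> P) (range P) (range Q)))"
proof -
  define A where "A = (\<lambda>x. P x - Q x)"
  define K where "K = A \<circ> A"
  define T where "T = Q \<circ> P"
  have bA: "bounded_clinear A" unfolding A_def by (intro bounded_clinear_minus_op P Q)
  have bK: "bounded_clinear K" unfolding K_def by (intro bounded_clinear_compose bA)
  have bT: "bounded_clinear T" unfolding T_def by (intro bounded_clinear_compose P Q)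
  note simps = bounded_clinear_simps[OF P(1)] bounded_clinear_simps[OF Q(1)] P(2) Q(2)
  have K_P: "K (P x) = P x - P (Q (P x))" "K (P x) = P (K x)"
    and K_Q: "K (Q x) = Q x - Q (P (Q x))" "K (Q x) = Q (K x)" for x
    by (simp_all add: K_def A_def simps)
  have aA: "approximable (1 / real n) A" using approx by (simp add: A_def)
  have "approximable (1 / real n + 1 / real n) K"
    unfolding K_def by (rule approximable_compose[OF aA aA])
  then have K_fin: "\<exists>F. finite_rank F \<and> (\<forall>x. norm (K x - F x) \<le> e * norm x)" if "e > 0" for e
    using approximable_finite_rank[of "1 / real n + 1 / real n" K e] n that by (auto simp: finite_rank_def)
  obtain V1 where V1: "bounded_clinear V1" "\<And>x. P (V1 x) = V1 (P x)"
      "finite_rank (\<lambda>x. P x - V1 (P x - P (K (P x))))"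
    using idempotent_parametrix[OF P bK K_fin] by metis
  obtain V2 where V2: "bounded_clinear V2"
      "finite_rank (\<lambda>x. Q x - (Q (V2 x) - Q (K (Q (V2 x)))))"
    using idempotent_parametrix[OF Q bK K_fin] by metis
  \<comment> \<open>Inverting P Q P on the range of \<open>P\<close> up to finite rank gives a left
    parametrix of \<open>T\<close>; inverting Q P Q on the range of \<open>Q\<close> gives the right
    parametrix \<open>S2\<close>.\<close>
  define S where "S = V1 \<circ> (P \<circ> Q)"
  define S2 where "S2 = P \<circ> (Q \<circ> V2)"
  have bS: "bounded_clinear S" unfolding S_def by (intro bounded_clinear_compose P Q V1)
  have bS2: "bounded_clinear S2" unfolding S2_def by (intro bounded_clinear_compose P Q V2)
  have T: "Q (T x) = T x" "T (P x) = T x" and S: "P (S x) = S x" "S (Q x) = S x" for x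
    by (simp_all add: T_def S_def simps V1(2))
  have f1: "finite_rank (\<lambda>x. P x - S (T x))"
    using V1(3) by (simp add: S_def T_def K_P(1) simps)
  have f2: "finite_rank (\<lambda>x. Q x - T (S2 x))"
    using V2(2) by (simp add: S2_def T_def K_Q(1) simps)
  \<comment> \<open>Comparison of a left with a right inverse: the sum equals Q - T S, so the left
    parametrix \<open>S\<close> also serves on the right.\<close>
  have "finite_rank (\<lambda>x. (Q x - T (S2 x)) + ((T \<circ> ((\<lambda>x. P x - S (T x)) \<circ> S2)) x -
      (T \<circ> (S \<circ> (\<lambda>x. Q x - T (S2 x)))) x))"
    by (intro finite_rank_add finite_rank_diff finite_rank_comp_left finite_rank_comp_right f1 f2 bT bS bS2)
  also have "(\<lambda>x. (Q x - T (S2 x)) + ((T \<circ> ((\<lambda>x. P x - S (T x)) \<circ> S2)) x -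
      (T \<circ> (S \<circ> (\<lambda>x. Q x - T (S2 x)))) x)) = (\<lambda>x. Q x - T (S x))"
  proof
    fix x
    have "P (S2 x) = S2 x" by (simp add: S2_def simps)
    then show "(Q x - T (S2 x)) + ((T \<circ> ((\<lambda>x. P x - S (T x)) \<circ> S2)) x -
      (T \<circ> (S \<circ> (\<lambda>x. Q x - T (S2 x)))) x) = Q x - T (S x)"
      by (simp add: bounded_clinear_diff[OF bT] bounded_clinear_diff[OF bS] S T)
  qed
  finally have f3: "finite_rank (\<lambda>x. Q x - T (S x))" .
  define R where "R m = ((\<lambda>R x. P (Q x) + K (R x)) ^^ m) (\<lambda>x. 0)" for m
  have R_0: "R 0 = (\<lambda>x. 0)" and R_Suc: "R (Suc m) = (\<lambda>x. P (Q x) + K (R m x))" for m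
    by (simp_all add: R_def)
  have R: "bounded_clinear (R m) \<and> (\<forall>x. P (R m x) = R m x \<and> R m (Q x) = R m x \<and>
      P x - R m (T x) = (K ^^ m) (P x) \<and> Q x - T (R m x) = (K ^^ m) (Q x))" for m
  proof (induction m)
    case 0
    show ?case by (simp add: R_0 bounded_clinear_zero simps bounded_clinear_0[OF bT])
  next
    case (Suc m)
    have "bounded_clinear (\<lambda>x. (P \<circ> Q) x + (K \<circ> R m) x)"
      using Suc by (intro bounded_clinear_plus bounded_clinear_compose P Q bK) blast
    moreover have "P (R (Suc m) x) = R (Suc m) x" "R (Suc m) (Q x) = R (Suc m) x" for x
      using Suc by (simp_all add: R_Suc simps K_P(2)[symmetric])
    moreover have "P x - R (Suc m) (T x) = (K ^^ Suc m) (P x)" for x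
    proof -
      have "P (Q (T x)) = P x - K (P x)" by (simp add: T_def K_P(1) simps)
      then have "P x - R (Suc m) (T x) = K (P x - R m (T x))"
        by (simp add: R_Suc bounded_clinear_diff[OF bK])
      then show ?thesis using Suc by simp
    qed
    moreover have "Q x - T (R (Suc m) x) = (K ^^ Suc m) (Q x)" for x
    proof -
      have "T (P (Q x)) = Q x - K (Q x)" by (simp add: T_def K_Q(1) simps)
      moreover have "T (K (R m x)) = K (T (R m x))" by (simp add: T_def K_P(2) K_Q(2))
      ultimately have "Q x - T (R (Suc m) x) = K (Q x - T (R m x))"
        by (simp add: R_Suc bounded_clinear_diff[OF bK] bounded_clinear_add[OF bT])
      then show ?thesis using Suc by simp
    qed
    ultimately show ?case by (simp add: R_Suc o_def)
  qed
  obtain j where j: "n = 2 * j" using n(1) by (auto elim: evenE)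
  \<comment> \<open>The approximation numbers of A^n are only known to be O(1/k), which does not
    give a convergent sum. Therefore \<open>Suc j\<close> terms of the Neumann sum are taken, with
    defects of exponent n + 2.\<close>
  have "K ^^ Suc j = A ^^ (2 * Suc j)"
    unfolding K_def funpow_mult[symmetric] by (simp add: numeral_2_eq_2 o_def)
  then have KA: "K ^^ Suc j = A ^^ Suc (Suc n)" by (simp add: j)
  have nuc1: "nuclear (A ^^ Suc n)"
    using approximable_funpow[OF aA, of n] n by (intro approximable_nuclear) auto
  then have nuc2: "nuclear (A ^^ Suc (Suc n))"
    unfolding funpow.simps(2)[of "Suc n"] by (rule nuclear_comp_left[OF _ bA])
  have nucP: "nuclear (\<lambda>x. P x - R (Suc j) (T x))" and nucQ: "nuclear (\<lambda>x. Q x - T (R (Suc j) x))"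
    using R[of "Suc j"] nuclear_comp_right[OF nuc2 P(1)] nuclear_comp_right[OF nuc2 Q(1)]
    by (simp_all only: KA o_def)
  obtain ra rb where r: "has_trace (\<lambda>x. P x - R (Suc j) (T x)) ra" "has_trace (\<lambda>x. Q x - T (R (Suc j) x)) rb"
    using nuclear_has_trace[OF nucP] nuclear_has_trace[OF nucQ] by blast
  have index: "of_int (fredholm_index T (range P) (range Q)) = ra - rb"
    using R[of "Suc j"]
    by (intro fredholm_index_nuclear_parametrix[OF P Q bT T bS S f1 f3 _ _ _ nucP nucQ r]) blast+
  have "has_trace (\<lambda>x. (P x - R (Suc j) (T x)) - (Q x - T (R (Suc j) x))) (ra - rb)"
    using r by (rule has_trace_diff)
  also have "(\<lambda>x. (P x - R (Suc j) (T x)) - (Q x - T (R (Suc j) x))) = A ^^ Suc (Suc (Suc n))"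
  proof
    fix x
    have "(P x - R (Suc j) (T x)) - (Q x - T (R (Suc j) x)) = (A ^^ Suc (Suc n)) (P x) - (A ^^ Suc (Suc n)) (Q x)"
      using R[of "Suc j"] by (simp only: KA)
    also have "\<dots> = (A ^^ Suc (Suc n)) (A x)"
      unfolding A_def[THEN fun_cong, of x] by (rule bounded_clinear_diff[OF bounded_clinear_funpow[OF bA], symmetric])
    finally show "(P x - R (Suc j) (T x)) - (Q x - T (R (Suc j) x)) = (A ^^ Suc (Suc (Suc n))) x"
      by (simp only: funpow_Suc_right[of "Suc (Suc n)"] o_apply)
  qed
  finally have tr3: "has_trace (A ^^ Suc (Suc (Suc n))) (ra - rb)" .
  obtain t where t: "has_trace (A ^^ Suc n) t" using nuclear_has_trace[OF nuc1] by blast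
  define B where "B x = x - P x - Q x" for x
  have bB: "bounded_clinear B"
    unfolding B_def by (intro bounded_clinear_minus_op bounded_clinear_ident P Q)
  have AB: "B (A x) = - A (B x)" and BB: "B (B x) = x - A (A x)" for x
    by (simp_all add: A_def B_def simps)
  have sgn: "B ((A ^^ k) x) = (if even k then (A ^^ k) (B x) else - (A ^^ k) (B x))" for k x
    by (induction k) (simp_all add: AB bounded_clinear_minus[OF bA])
  \<comment> \<open>As n + 1 is odd, \<open>B\<close> anticommutes with A^{n+1}, and cyclicity
    yields u = - u for the trace u of A^{n+1} B^2. Since this operator is A^{n+1} - A^{n+3}, the two
    powers have the same trace.\<close>
  let ?Y = "A ^^ Suc n \<circ> B"
  obtain u where u: "has_trace (?Y \<circ> B) u" "has_trace (B \<circ> ?Y) u"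
    using nuclear_trace_commute[OF nuclear_comp_right[OF nuc1 bB] bB] by blast
  have BY: "B \<circ> ?Y = (\<lambda>x. - (?Y \<circ> B) x)"
    using sgn[of "Suc n"] n(1) by (intro ext) (simp del: funpow.simps)
  have "has_trace (B \<circ> ?Y) (- u)"
    unfolding BY by (rule has_trace_uminus[OF u(1)])
  then have "u = - u" by (rule has_trace_unique[OF u(2)])
  then have "2 * u = 0" by (simp only: mult_2 eq_neg_iff_add_eq_0)
  then have "u = 0" by simp
  have YB: "?Y \<circ> B = (\<lambda>x. (A ^^ Suc n) x - (A ^^ Suc (Suc (Suc n))) x)"
  proof
    fix x
    have "(A ^^ Suc (Suc (Suc n))) x = (A ^^ Suc n) (A (A x))" by (simp add: funpow_swap1)
    then show "(?Y \<circ> B) x = (A ^^ Suc n) x - (A ^^ Suc (Suc (Suc n))) x"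
      by (simp only: o_apply BB bounded_clinear_diff[OF bounded_clinear_funpow[OF bA]])
  qed
  have "u = t - (ra - rb)"
    using u(1) has_trace_diff[OF t tr3] unfolding YB by (rule has_trace_unique)
  then have "t = ra - rb" using \<open>u = 0\<close> by simp
  then show ?thesis
    using t index unfolding A_def T_def by simp
qed

section \<open>Graded operators with bounded twisted commutator\<close>

lemma bounded_clinear_scaleR: "bounded_clinear T \<Longrightarrow> T (r *\<^sub>R x) = r *\<^sub>R T x"
  using bounded_linear.linear[OF bounded_clinear_bounded_linear] linear_scale by blast

section \<open>Operators determined on a dense subspace\<close>

lemma bounded_linear_eq_on_dense:
  assumes "bounded_linear f" "bounded_linear g" "\<And>x. x \<in> V \<Longrightarrow> f x = g x" "x \<in> closure V"
  shows "f x = g x"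
proof -
  have "closed {x. f x = g x}"
    using linear_continuous_on[OF assms(1), of UNIV] linear_continuous_on[OF assms(2), of UNIV]
    by (intro closed_Collect_eq)
  then have "closure V \<subseteq> {x. f x = g x}"
    using assms(3) by (intro closure_minimal) auto
  then show ?thesis using assms(4) by blast
qed

text \<open>The graph of \<open>F\<close> is closed and contains the graph of \<open>T\<close> on
  \<open>V\<close>, which gives uniqueness in the definite description; a sequence in
  \<open>V\<close> tending to x gives existence.\<close>

lemma operator_closure_eq:
  assumes F: "bounded_linear F" and T: "\<And>z. z \<in> V \<Longrightarrow> T z = F z" and x: "x \<in> closure V"
  shows "operator_closure V T x = F x"
  unfolding operator_closure_def
proof (rule the_equality)
  obtain s where s: "\<And>k. s k \<in> V" "s \<longlonglongrightarrow> x"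
    using x unfolding closure_sequential by blast
  then have "(\<lambda>k. (s k, T (s k))) \<longlonglongrightarrow> (x, F x)"
    using T bounded_linear.tendsto[OF F s(2)] by (intro tendsto_Pair) auto
  moreover have "\<forall>k. (s k, T (s k)) \<in> (\<lambda>z. (z, T z)) ` V" using s(1) by blast
  ultimately show "(x, F x) \<in> closure ((\<lambda>z. (z, T z)) ` V)"
    unfolding closure_sequential by (intro exI[of _ "\<lambda>k. (s k, T (s k))"] conjI)
next
  fix y assume "(x, y) \<in> closure ((\<lambda>z. (z, T z)) ` V)"
  moreover have "closed {p. snd p = F (fst p)}"
    by (intro closed_Collect_eq continuous_on_snd continuous_on_id
        continuous_on_compose2[OF linear_continuous_on[OF F, of UNIV]] continuous_on_fst) auto
  then have "closure ((\<lambda>z. (z, T z)) ` V) \<subseteq> {p. snd p = F (fst p)}"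
    using T by (intro closure_minimal) auto
  ultimately show "y = F x" by auto
qed

text \<open>The cokernel is an arbitrarily chosen complement, but the choice is a function of the
  image, so equal images give the very same complement.\<close>

lemma fredholm_on_cong:
  assumes "\<And>x. x \<in> V \<Longrightarrow> T x = T' x"
  shows "fredholm_on T V W = fredholm_on T' V W"
proof -
  have *: "fredholm_on T' V W" if f: "fredholm_on T V W" and eq: "\<And>x. x \<in> V \<Longrightarrow> T x = T' x" for T T'
  proof -
    have im: "T ` V = T' ` V" using eq by (rule image_cong[OF refl])
    have ker: "kernel_on T V = kernel_on T' V" using eq by (auto simp: kernel_on_def)
    have V: "complex_vector.subspace V" using f by (simp add: fredholm_on_def)
    have add: "x + y \<in> V" if "x \<in> V" "y \<in> V" for x y using complex_vector.subspace_add[OF V that] .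
    have scale: "c *\<^sub>C x \<in> V" if "x \<in> V" for c x using complex_vector.subspace_scale[OF V that] .
    show ?thesis
      using f unfolding fredholm_on_def cokernel_on_def im ker
      by (simp add: eq add scale cong: ball_cong)
  qed
  show ?thesis using *[of T T'] *[of T' T] assms by auto
qed

lemma fredholm_index_cong:
  assumes "\<And>x. x \<in> V \<Longrightarrow> T x = T' x"
  shows "fredholm_index T V W = fredholm_index T' V W"
proof -
  have "T ` V = T' ` V" using assms by (rule image_cong[OF refl])
  moreover have "kernel_on T V = kernel_on T' V" using assms by (auto simp: kernel_on_def)
  ultimately show ?thesis
    using fredholm_on_cong[of V T T' W] assms by (simp add: fredholm_index_def cokernel_on_def)
qed

text \<open>A single idempotent on the amplified space, with the algebra stripped away:
  \<open>G\<close> is the inverse of \<open>D\<close>, \<open>E\<close> and \<open>S\<close> are the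
  actions of e and \<sigma>(e), and \<open>T\<close> is the bounded extension of D e - \<sigma>(e)
  D. Summability enters only through approximability of \<open>G\<close>.\<close>

locale invertible_odd_operator =
  fixes Dom :: "'k::chilbert_space set" and D G \<gamma> E S T :: "'k \<Rightarrow> 'k" and n :: nat
  assumes bounded_G: "bounded_clinear G" and G_Dom: "G x \<in> Dom" and D_G: "D (G x) = x"
    and G_D: "x \<in> Dom \<Longrightarrow> G (D x) = x"
    and Dom_dense: "closure Dom = UNIV" and Dom_subspace: "complex_vector.subspace Dom"
    and D_symmetric: "x \<in> Dom \<Longrightarrow> y \<in> Dom \<Longrightarrow> cinner (D x) y = cinner x (D y)"
    and bounded_\<gamma>: "bounded_clinear \<gamma>" and \<gamma>_self_adjoint: "cinner (\<gamma> x) y = cinner x (\<gamma> y)"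
    and \<gamma>_\<gamma>: "\<gamma> (\<gamma> x) = x" and \<gamma>_Dom: "x \<in> Dom \<Longrightarrow> \<gamma> x \<in> Dom"
    and D_\<gamma>: "x \<in> Dom \<Longrightarrow> D (\<gamma> x) = - \<gamma> (D x)"
    and bounded_E: "bounded_clinear E" and E_E: "E (E x) = E x" and E_\<gamma>: "E (\<gamma> x) = \<gamma> (E x)"
    and E_Dom: "x \<in> Dom \<Longrightarrow> E x \<in> Dom"
    and bounded_S: "bounded_clinear S" and S_S: "S (S x) = S x" and S_\<gamma>: "S (\<gamma> x) = \<gamma> (S x)"
    and bounded_T: "bounded_clinear T" and T_eq: "x \<in> Dom \<Longrightarrow> T x = D (E x) - S (D x)"
    and approximable_G: "approximable (1 / real n) G" and even_n: "even n" and n_pos: "n > 0"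
begin

lemmas G_simps = bounded_clinear_simps[OF bounded_G] bounded_clinear_scaleR[OF bounded_G]
lemmas \<gamma>_simps = bounded_clinear_simps[OF bounded_\<gamma>] bounded_clinear_scaleR[OF bounded_\<gamma>]
lemmas S_simps = bounded_clinear_simps[OF bounded_S] bounded_clinear_scaleR[OF bounded_S]
lemmas T_simps = bounded_clinear_simps[OF bounded_T] bounded_clinear_scaleR[OF bounded_T]

lemma G_symmetric: "cinner (G x) y = cinner x (G y)"
  using D_symmetric[OF G_Dom G_Dom, of x y] by (simp add: D_G)

lemma G_\<gamma>: "G (\<gamma> x) = - \<gamma> (G x)"
proof -
  have "D (\<gamma> (G x)) = - \<gamma> x" by (simp add: D_\<gamma> G_Dom D_G)
  then have "\<gamma> (G x) = G (- \<gamma> x)" using G_D[OF \<gamma>_Dom[OF G_Dom]] by metis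
  then show ?thesis by (simp add: G_simps)
qed

lemma eq_on_Dom:
  assumes "bounded_clinear f" "bounded_clinear g" "\<And>x. x \<in> Dom \<Longrightarrow> f x = g x"
  shows "f = g"
  using bounded_linear_eq_on_dense[OF assms(1,2)[THEN bounded_clinear_bounded_linear] assms(3)] Dom_dense
  by auto

lemma T_\<gamma>: "T (\<gamma> x) = - \<gamma> (T x)"
proof -
  have "T \<circ> \<gamma> = (\<lambda>x. - (\<gamma> \<circ> T) x)"
  proof (rule eq_on_Dom)
    fix x assume "x \<in> Dom"
    then show "(T \<circ> \<gamma>) x = - (\<gamma> \<circ> T) x"
      by (simp add: T_eq \<gamma>_Dom D_\<gamma> E_\<gamma> E_Dom S_\<gamma> S_simps \<gamma>_simps)
  qed (intro bounded_clinear_compose bounded_clinear_uminus bounded_T bounded_\<gamma>)+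
  from fun_cong[OF this, of x] show ?thesis by simp
qed

definition A :: "'k \<Rightarrow> 'k" where "A x = G (T x)"

text \<open>The bounded closure of D^{-1} \<sigma>(e) D, obtained without a limit: the right side is
  bounded and everywhere defined, and \<open>Q_Dom\<close> shows that it extends G S D.\<close>

definition Q :: "'k \<Rightarrow> 'k" where "Q x = E x - A x"

lemma bounded_A: "bounded_clinear A"
  using bounded_clinear_compose[OF bounded_G bounded_T] by (simp add: A_def[abs_def] o_def)

lemma bounded_Q: "bounded_clinear Q"
  unfolding Q_def by (intro bounded_clinear_minus_op bounded_E bounded_A)

lemma Q_Dom: "x \<in> Dom \<Longrightarrow> Q x = G (S (D x))"
  by (simp add: Q_def A_def T_eq G_simps G_D E_Dom)

lemma Q_Q: "Q (Q x) = Q x"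
proof -
  have "Q \<circ> Q = Q"
    by (rule eq_on_Dom) (simp_all add: Q_Dom G_Dom D_G S_S bounded_clinear_compose bounded_Q)
  from fun_cong[OF this, of x] show ?thesis by simp
qed

lemma A_\<gamma>: "A (\<gamma> x) = \<gamma> (A x)"
  by (simp add: A_def T_\<gamma> G_\<gamma> G_simps)

lemma Q_\<gamma>: "Q (\<gamma> x) = \<gamma> (Q x)"
  by (simp add: Q_def A_\<gamma> E_\<gamma> \<gamma>_simps)

abbreviation pr :: "real \<Rightarrow> 'k \<Rightarrow> 'k" where "pr \<equiv> graded_proj \<gamma>"
abbreviation H :: "real \<Rightarrow> 'k set" where "H \<equiv> graded_part \<gamma>"

lemma bounded_pr: "bounded_clinear (pr \<epsilon>)"
proof -
  have eq: "pr \<epsilon> = (\<lambda>x. complex_of_real (1/2) *\<^sub>C x) \<circ> (\<lambda>x. x + ((\<lambda>x. complex_of_real \<epsilon> *\<^sub>C x) \<circ> \<gamma>) x)"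
    by (auto simp: graded_proj_def scaleR_scaleC)
  show ?thesis
    unfolding eq by (intro bounded_clinear_compose bounded_clinear_plus bounded_clinear_ident
        bounded_clinear_scale_vector bounded_\<gamma>)
qed

lemma commute_pr:
  assumes "bounded_clinear F" "\<And>x. F (\<gamma> x) = \<gamma> (F x)"
  shows "F (pr \<epsilon> x) = pr \<epsilon> (F x)"
  by (simp add: graded_proj_def bounded_clinear_scaleR[OF assms(1)] bounded_clinear_add[OF assms(1)] assms(2))

text \<open>\<open>D\<close> is odd and both actions are even, so \<open>T\<close> exchanges the two
  halves. This is what exchanges the two indices in \<open>trace_adjoint\<close>.\<close>

lemma T_pr: "T (pr \<epsilon> x) = pr (- \<epsilon>) (T x)"
  by (simp add: graded_proj_def T_simps T_\<gamma>)

lemma A_pr: "A (pr \<epsilon> x) = pr \<epsilon> (A x)"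
  by (rule commute_pr[OF bounded_A A_\<gamma>])

lemma funpow_A_pr: "(A ^^ k) (pr \<epsilon> x) = pr \<epsilon> ((A ^^ k) x)"
  by (induction k) (simp_all add: A_pr)

lemma pr_self_adjoint: "cinner (pr \<epsilon> x) y = cinner x (pr \<epsilon> y)"
  by (simp add: graded_proj_def scaleR_scaleC cinner_scaleC_left cinner_scaleC_right cinner_add_left
      cinner_add_right \<gamma>_self_adjoint)

lemma approximable_A: "approximable (1 / real n) A"
  using approximable_comp_right[OF approximable_G bounded_T] by (simp add: A_def[abs_def] o_def)

context
  fixes \<epsilon> :: real
  assumes \<epsilon>: "\<epsilon> = 1 \<or> \<epsilon> = - 1"
begin

lemma pr_in_H: "pr \<epsilon> x \<in> H \<epsilon>"
  using \<epsilon> by (auto simp: graded_part_def graded_proj_def \<gamma>_simps \<gamma>_\<gamma> algebra_simps)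

lemma pr_id: "x \<in> H \<epsilon> \<Longrightarrow> pr \<epsilon> x = x"
  using \<epsilon> by (auto simp: graded_part_def graded_proj_def simp flip: scaleR_2)

lemma H_eq_range: "H \<epsilon> = range (pr \<epsilon>)"
  using pr_in_H pr_id by (metis image_subset_iff rangeI subsetI subset_antisym)

text \<open>The grading projection is continuous and preserves \<open>Dom\<close>, so it moves a
  sequence of domain vectors tending to x into the graded part without changing the limit.\<close>

lemma H_closure: "x \<in> H \<epsilon> \<Longrightarrow> x \<in> closure (Dom \<inter> H \<epsilon>)"
proof -
  assume x: "x \<in> H \<epsilon>"
  obtain s where s: "\<And>k. s k \<in> Dom" "s \<longlonglongrightarrow> x"
    using Dom_dense unfolding closure_sequential[symmetric] by (metis UNIV_I closure_sequential)
  have "(\<lambda>k. pr \<epsilon> (s k)) \<longlonglongrightarrow> x"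
    using bounded_linear.tendsto[OF bounded_clinear_bounded_linear[OF bounded_pr] s(2), of \<epsilon>] pr_id[OF x] by simp
  moreover have "pr \<epsilon> (s k) \<in> Dom \<inter> H \<epsilon>" for k
    using s(1) \<gamma>_Dom pr_in_H Dom_subspace unfolding graded_proj_def scaleR_scaleC
    by (auto intro!: complex_vector.subspace_scale complex_vector.subspace_add)
  ultimately show ?thesis
    unfolding closure_sequential by (intro exI[of _ "\<lambda>k. pr \<epsilon> (s k)"] conjI allI)
qed

text \<open>\<open>G\<close> anticommutes with the grading and hence maps
  \<open>H (- \<epsilon>)\<close> into \<open>H \<epsilon>\<close>, which makes it the inverse of
  the restricted \<open>D\<close> as well.\<close>

lemma graded_inverse_eq: "y \<in> H (- \<epsilon>) \<Longrightarrow> graded_inverse Dom D \<gamma> \<epsilon> y = G y"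
  unfolding graded_inverse_def
proof (rule inv_into_f_eq)
  show "inj_on D (Dom \<inter> H \<epsilon>)" by (rule inj_onI) (metis G_D IntD1)
  assume "y \<in> H (- \<epsilon>)"
  then have "\<gamma> y = - (\<epsilon> *\<^sub>R y)" by (simp add: graded_part_def)
  then have "\<gamma> (G y) = \<epsilon> *\<^sub>R G y" using G_\<gamma>[of y] by (simp add: G_simps)
  then show "G y \<in> Dom \<inter> H \<epsilon>" by (simp add: G_Dom graded_part_def)
qed (rule D_G)

lemma D_H: "x \<in> Dom \<inter> H \<epsilon> \<Longrightarrow> S (D x) \<in> H (- \<epsilon>)"
proof -
  assume x: "x \<in> Dom \<inter> H \<epsilon>"
  then have "G (\<gamma> (D x)) = G (- \<epsilon> *\<^sub>R D x)"
    by (simp add: G_\<gamma> G_simps G_D graded_part_def)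
  then have "\<gamma> (D x) = - \<epsilon> *\<^sub>R D x" by (metis D_G)
  then show ?thesis by (simp add: graded_part_def S_\<gamma>[symmetric] S_simps)
qed

lemma conjugated_operator_eq: "x \<in> H \<epsilon> \<Longrightarrow> conjugated_operator Dom D \<gamma> \<epsilon> S x = Q x"
  unfolding conjugated_operator_def
  using D_H by (intro operator_closure_eq bounded_clinear_bounded_linear[OF bounded_Q] H_closure)
    (simp_all add: graded_inverse_eq Q_Dom)

lemma twisted_commutator_eq: "x \<in> H \<epsilon> \<Longrightarrow> twisted_commutator Dom D \<gamma> \<epsilon> E S x = T x"
  unfolding twisted_commutator_def
  by (intro operator_closure_eq bounded_clinear_bounded_linear[OF bounded_T] H_closure)
    (simp_all add: T_eq)

lemma cocycle_factor_eq:
  assumes x: "x \<in> H \<epsilon>"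
  shows "graded_inverse Dom D \<gamma> \<epsilon> (twisted_commutator Dom D \<gamma> \<epsilon> E S x) = A x"
proof -
  have "T x \<in> H (- \<epsilon>)"
    using x T_\<gamma>[of x] by (simp add: graded_part_def T_simps)
  then show ?thesis
    by (simp add: twisted_commutator_eq[OF x] graded_inverse_eq A_def)
qed

text \<open>A factor is known to agree with \<open>A\<close> only on \<open>H \<epsilon>\<close>.
  The projection at the right end starts there and \<open>A\<close> preserves this space, so every
  factor may be replaced.\<close>

lemma foldr_cocycle:
  "foldr (\<lambda>k X. (\<lambda>x. graded_inverse Dom D \<gamma> \<epsilon> (twisted_commutator Dom D \<gamma> \<epsilon> E S x)) \<circ> X) xs (pr \<epsilon>)
    = A ^^ length xs \<circ> pr \<epsilon>"
proof (induction xs)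
  case (Cons k xs)
  have "(A ^^ length xs) (pr \<epsilon> x) \<in> H \<epsilon>" for x
    by (simp add: funpow_A_pr pr_in_H)
  then show ?case using Cons by (auto simp: cocycle_factor_eq)
qed auto

text \<open>Composed with the grading projection, \<open>E\<close> and \<open>Q\<close> are
  idempotents of the whole space whose ranges are the two subspaces of the index, with difference
  \<open>A \<circ> pr \<epsilon>\<close>. So \<open>fredholm_index_idempotents\<close> applies
  without making the half a space of its own.\<close>

lemma index_trace:
  "has_trace (A ^^ Suc n \<circ> pr \<epsilon>)
     (of_int (fredholm_index (\<lambda>x. conjugated_operator Dom D \<gamma> \<epsilon> S (E x)) (E ` H \<epsilon>)
        (conjugated_operator Dom D \<gamma> \<epsilon> S ` H \<epsilon>)))"
proof -
  let ?P = "E \<circ> pr \<epsilon>" and ?Q = "Q \<circ> pr \<epsilon>"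
  have pp: "pr \<epsilon> (pr \<epsilon> x) = pr \<epsilon> x" for x using pr_id[OF pr_in_H] .
  have E_pr: "E (pr \<epsilon> x) = pr \<epsilon> (E x)" and Q_pr: "Q (pr \<epsilon> x) = pr \<epsilon> (Q x)" for x
    using commute_pr bounded_E E_\<gamma> bounded_Q Q_\<gamma> by auto
  have diff: "(\<lambda>x. ?P x - ?Q x) = A \<circ> pr \<epsilon>" by (auto simp: Q_def)
  have "has_trace ((\<lambda>x. ?P x - ?Q x) ^^ Suc n) (of_int (fredholm_index (?Q \<circ> ?P) (range ?P) (range ?Q)))"
  proof (rule fredholm_index_idempotents)
    show "bounded_clinear ?P" "bounded_clinear ?Q"
      by (intro bounded_clinear_compose bounded_E bounded_Q bounded_pr)+
    show "?P (?P x) = ?P x" for x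
      by (simp only: o_apply E_pr[symmetric] E_E pp)
    show "?Q (?Q x) = ?Q x" for x
      by (simp only: o_apply Q_pr[symmetric] Q_Q pp)
    show "approximable (1 / real n) (\<lambda>x. ?P x - ?Q x)"
      unfolding diff by (rule approximable_comp_right[OF approximable_A bounded_pr])
  qed (rule even_n n_pos)+
  also have "((\<lambda>x. ?P x - ?Q x) ^^ Suc n) = A ^^ Suc n \<circ> pr \<epsilon>"
  proof -
    have "((A \<circ> pr \<epsilon>) ^^ Suc k) x = (A ^^ Suc k) (pr \<epsilon> x)" for k x
      by (induction k) (simp_all add: A_pr funpow_A_pr pp)
    then show ?thesis unfolding diff by auto
  qed
  also have "range ?P = E ` H \<epsilon>" by (simp add: H_eq_range image_comp)
  also have "range ?Q = conjugated_operator Dom D \<gamma> \<epsilon> S ` H \<epsilon>"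
  proof -
    have "conjugated_operator Dom D \<gamma> \<epsilon> S ` H \<epsilon> = Q ` H \<epsilon>"
      by (rule image_cong[OF refl conjugated_operator_eq])
    then show ?thesis by (simp add: H_eq_range image_comp)
  qed
  also have "fredholm_index (?Q \<circ> ?P) (E ` H \<epsilon>) (conjugated_operator Dom D \<gamma> \<epsilon> S ` H \<epsilon>) =
      fredholm_index (\<lambda>x. conjugated_operator Dom D \<gamma> \<epsilon> S (E x)) (E ` H \<epsilon>)
        (conjugated_operator Dom D \<gamma> \<epsilon> S ` H \<epsilon>)"
  proof (rule fredholm_index_cong)
    fix x assume "x \<in> E ` H \<epsilon>"
    then obtain y where y: "x = E y" "y \<in> H \<epsilon>" by blast
    then have "E x = x" "x = pr \<epsilon> x" using E_E E_pr[of y] pr_id by auto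
    moreover then have "x \<in> H \<epsilon>" using pr_in_H by metis
    ultimately show "(?Q \<circ> ?P) x = conjugated_operator Dom D \<gamma> \<epsilon> S (E x)"
      by (simp add: conjugated_operator_eq)
  qed
  finally show ?thesis .
qed

end

text \<open>The adjoint of A = G T is - T G, and as n + 1 is odd, its power of that exponent is - T
  A^n G. Cyclicity moves \<open>T\<close> to the other end, which restores A^{n+1}; as
  \<open>T\<close> is odd, the projection onto the other half appears on the way.\<close>

lemma trace_adjoint:
  assumes adj: "\<And>x y. cinner (E x) y = cinner x (S y)"
    and t: "has_trace (A ^^ Suc n \<circ> pr 1) t"
  shows "has_trace (A ^^ Suc n \<circ> pr (- 1)) (- cnj t)"
proof -
  have A_Dom: "cinner (A x) y = cinner x (- T (G y))" if x: "x \<in> Dom" for x y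
  proof -
    have "cinner (A x) y = cinner (D (E x) - S (D x)) (G y)"
      by (simp add: A_def T_eq x G_symmetric)
    also have "\<dots> = cinner (E x) (D (G y)) - cinner (D x) (E (G y))"
    proof -
      have "cinner (S (D x)) (G y) = cinner (D x) (E (G y))"
        using adj[of "G y" "D x"] cinner_commute by metis
      then show ?thesis using D_symmetric[OF E_Dom[OF x] G_Dom] by (simp add: cinner_diff_left)
    qed
    also have "\<dots> = cinner x (S y) - cinner x (D (E (G y)))"
      by (simp add: adj D_G D_symmetric[OF x E_Dom[OF G_Dom]])
    also have "\<dots> = cinner x (- T (G y))"
      by (simp add: T_eq G_Dom D_G cinner_diff_right)
    finally show ?thesis .
  qed
  have A_adj: "cinner (A x) y = cinner x (- T (G y))" for x y
  proof -
    have "cnj (cinner y (A x)) = cnj (cinner (- T (G y)) x)"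
    proof (rule arg_cong[of _ _ cnj], rule bounded_linear_eq_on_dense[of _ _ Dom])
      show "bounded_linear (\<lambda>x. cinner y (A x))"
        using bounded_linear_compose[OF bounded_linear_cinner_right bounded_clinear_bounded_linear[OF bounded_A]] .
      show "bounded_linear (cinner (- T (G y)))" by (rule bounded_linear_cinner_right)
      show "cinner y (A x) = cinner (- T (G y)) x" if "x \<in> Dom" for x
        using A_Dom[OF that, of y] cinner_commute by metis
    qed (use Dom_dense in simp)
    then show ?thesis using cinner_commute by metis
  qed
  define B where "B y = - T (G y)" for y
  have pow_adj: "cinner ((A ^^ k) x) y = cinner x ((B ^^ k) y)" for k x y
    by (induction k arbitrary: x y) (simp_all add: funpow_swap1 A_adj B_def[symmetric])
  have B_pow: "(B ^^ Suc k) y = (if even k then - T ((A ^^ k) (G y)) else T ((A ^^ k) (G y)))" for k y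
  proof (induction k)
    case 0
    show ?case by (simp add: B_def)
  next
    case (Suc k)
    have "(B ^^ Suc (Suc k)) y = B ((B ^^ Suc k) y)" by simp
    then show ?case
      unfolding Suc.IH by (simp add: B_def[of "T _"] B_def[of "- T _"] A_def[of "(A ^^ k) (G y)"] G_simps T_simps)
  qed
  \<comment> \<open>What remains of T A^n G when \<open>T\<close> is split off has to be nuclear for
    cyclicity: A^n G is approximable of order n (1/n) + 1/n > 1.\<close>
  define Y where "Y = pr (- 1) \<circ> (A ^^ n \<circ> G)"
  obtain m where m: "n = Suc m" using n_pos by (cases n) auto
  have "approximable (real n * (1 / real n) + 1 / real n) (A ^^ n \<circ> G)"
    using approximable_compose[OF approximable_funpow[OF approximable_A, of m] approximable_G]
    by (simp only: m)
  then have "nuclear (A ^^ n \<circ> G)"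
    by (rule approximable_nuclear) (use n_pos in simp)
  then have Y: "nuclear Y"
    unfolding Y_def by (rule nuclear_comp_left[OF _ bounded_pr])
  obtain u where u: "has_trace (Y \<circ> T) u" "has_trace (T \<circ> Y) u"
    using nuclear_trace_commute[OF Y bounded_T] by blast
  have "has_trace (\<lambda>x. - (T \<circ> Y) x) (cnj t)"
  proof (rule has_trace_adjoint[OF t])
    fix x y
    have "cinner ((A ^^ Suc n \<circ> pr 1) x) y = cinner x (pr 1 ((B ^^ Suc n) y))"
      by (simp only: o_apply pow_adj pr_self_adjoint)
    also have "(B ^^ Suc n) y = - T ((A ^^ n) (G y))"
      using B_pow[of n y] even_n by simp
    also have "pr 1 (- T ((A ^^ n) (G y))) = - T (Y y)"
      using T_pr[of "- 1" "(A ^^ n) (G y)"] by (simp add: Y_def bounded_clinear_minus[OF bounded_pr])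
    finally show "cinner ((A ^^ Suc n \<circ> pr 1) x) y = cinner x (- (T \<circ> Y) y)"
      by (simp only: o_apply)
  qed
  then have "cnj t = - u"
    using has_trace_unique has_trace_uminus[OF u(2)] by blast
  moreover have "Y \<circ> T = A ^^ Suc n \<circ> pr (- 1)"
    by (auto simp: Y_def funpow_swap1 A_def[symmetric] funpow_A_pr A_pr)
  ultimately show ?thesis using u(1) by simp
qed

end

section \<open>Matrix amplification\<close>

lemma bounded_clinear_nth: "bounded_clinear (\<lambda>x :: 'h::chilbert_space ^ 'n. x $ i)"
  by (rule bounded_clinearI[where K=1])
    (simp_all add: scaleC_vec_def Finite_Cartesian_Product.norm_nth_le)

lemma bounded_clinear_sum_op:
  assumes "\<And>i. i \<in> I \<Longrightarrow> bounded_clinear (f i)"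
  shows "bounded_clinear (\<lambda>x. \<Sum>i\<in>I. f i x)"
  using assms by (induction I rule: infinite_finite_induct)
    (simp_all add: bounded_clinear_zero bounded_clinear_plus)

lemma bounded_clinear_componentwise:
  assumes "\<And>i. bounded_clinear (\<lambda>x. f x $ i)"
  shows "bounded_clinear (f :: 'h::chilbert_space \<Rightarrow> 'k::chilbert_space ^ 'n)"
proof -
  have "\<exists>K. \<forall>x. norm (f x $ i) \<le> K * norm x" for i
    using bounded_clinear_bound[OF assms[of i]] by metis
  then obtain K where K: "\<And>i x. norm (f x $ i) \<le> K i * norm x"
    by metis
  show ?thesis
  proof (rule bounded_clinearI[where K = "\<Sum>i\<in>UNIV. K i"])
    show "norm (f x) \<le> (\<Sum>i\<in>UNIV. K i) * norm x" for x
    proof -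
      have "norm (f x) \<le> (\<Sum>i\<in>UNIV. norm (f x $ i))"
        unfolding norm_vec_def by (rule L2_set_le_sum) simp
      also have "\<dots> \<le> (\<Sum>i\<in>UNIV. K i * norm x)" by (rule sum_mono) (rule K)
      finally show ?thesis by (simp add: sum_distrib_right)
    qed
  qed (simp_all add: vec_eq_iff scaleC_vec_def bounded_clinear_simps[OF assms])
qed

lemma bounded_clinear_matrix:
  fixes M :: "'n::finite \<Rightarrow> 'n \<Rightarrow> 'h::chilbert_space \<Rightarrow> 'h"
  assumes "\<And>i j. bounded_clinear (M i j)"
  shows "bounded_clinear (\<lambda>x :: 'h ^ 'n. \<chi> i. \<Sum>j\<in>UNIV. M i j (x $ j))"
proof (rule bounded_clinear_componentwise)
  fix i
  have "bounded_clinear (\<lambda>x :: 'h ^ 'n. \<Sum>j\<in>UNIV. (M i j \<circ> (\<lambda>x. x $ j)) x)"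
    by (intro bounded_clinear_sum_op bounded_clinear_compose assms bounded_clinear_nth)
  then show "bounded_clinear (\<lambda>x :: 'h ^ 'n. (\<chi> i. \<Sum>j\<in>UNIV. M i j (x $ j)) $ i)" by simp
qed

lemma bounded_clinear_amplify:
  assumes "bounded_clinear T"
  shows "bounded_clinear (amplify T :: 'h::chilbert_space ^ 'n \<Rightarrow> 'h ^ 'n)"
proof (rule bounded_clinear_componentwise)
  fix i
  show "bounded_clinear (\<lambda>x :: 'h ^ 'n. amplify T x $ i)"
    using bounded_clinear_compose[OF assms bounded_clinear_nth[of i]] by (simp add: amplify_def o_def)
qed

lemma norm_amplify_le:
  assumes "\<And>x. norm (T x) \<le> K * norm x" "K \<ge> 0"
  shows "norm (amplify T (x :: 'h::chilbert_space ^ 'n)) \<le> K * norm x"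
proof -
  have "norm (amplify T x) \<le> L2_set (\<lambda>i. K * norm (x $ i)) UNIV"
    unfolding norm_vec_def by (rule L2_set_mono) (simp_all add: amplify_def assms)
  also have "\<dots> = K * norm x"
    unfolding norm_vec_def using assms(2) by (simp add: L2_set_right_distrib)
  finally show ?thesis .
qed

lemma bounded_clinear_axis: "bounded_clinear (axis i :: 'h::chilbert_space \<Rightarrow> 'h ^ 'n)"
proof (rule bounded_clinear_componentwise)
  fix j
  show "bounded_clinear (\<lambda>x :: 'h. axis i x $ j)"
    by (cases "i = j") (simp_all add: axis_def bounded_clinear_ident bounded_clinear_zero)
qed

lemma rank_at_most_amplify:
  assumes "rank_at_most k F"
  shows "rank_at_most (CARD('n) * k) (amplify F :: 'h::chilbert_space ^ 'n \<Rightarrow> 'h ^ 'n)"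
proof -
  obtain B where B: "finite B" "card B \<le> k" "range F \<subseteq> complex_vector.span B"
    and F: "bounded_clinear F"
    using assms by (auto simp: rank_at_most_def)
  define C :: "('h ^ 'n) set" where "C = (\<Union>i. axis i ` B)"
  have "card C \<le> (\<Sum>i\<in>(UNIV :: 'n set). card (axis i ` B :: ('h ^ 'n) set))"
    unfolding C_def by (rule card_UN_le) simp
  also have "\<dots> \<le> (\<Sum>i\<in>(UNIV :: 'n set). k)"
    by (intro sum_mono order_trans[OF card_image_le[OF B(1)] B(2)])
  finally have "card C \<le> CARD('n) * k" by simp
  moreover have "amplify F x \<in> complex_vector.span C" for x
  proof -
    have "axis i (F (x $ i)) \<in> complex_vector.span C" for i
    proof -
      have "axis i (F (x $ i)) \<in> complex_vector.span (axis i ` B)"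
        unfolding span_image_bounded_clinear[OF bounded_clinear_axis] using B(3) by blast
      then show ?thesis
        using complex_vector.span_mono[of "axis i ` B" C] by (auto simp: C_def)
    qed
    then have "(\<Sum>i\<in>UNIV. axis i (F (x $ i))) \<in> complex_vector.span C"
      by (intro complex_vector.span_sum) auto
    also have "(\<Sum>i\<in>UNIV. axis i (F (x $ i))) = amplify F x"
      by (simp add: vec_eq_iff axis_def amplify_def)
    finally show ?thesis .
  qed
  ultimately show ?thesis
    unfolding rank_at_most_def using B(1) bounded_clinear_amplify[OF F]
    by (intro conjI exI[of _ C]) (auto simp: C_def)
qed

text \<open>Acting coordinatewise preserves the error bound and multiplies ranks by the number of
  coordinates, which goes into the rank factor. The singular values of the amplification are never
  computed.\<close>

lemma approximable_amplify:
  assumes "approximable p X"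
  shows "approximable p (amplify X :: 'h::chilbert_space ^ 'n \<Rightarrow> 'h ^ 'n)"
proof -
  obtain C r where C: "C \<ge> 0" "\<And>k. k \<ge> (1::nat) \<Longrightarrow> \<exists>F.
     rank_at_most (r * k) F \<and> (\<forall>x. norm (X x - F x) \<le> C * real k powr (- p) * norm x)"
    using assms unfolding approximable_def by blast
  have "\<exists>F. rank_at_most ((CARD('n) * r) * k) F \<and>
      (\<forall>x :: 'h ^ 'n. norm (amplify X x - F x) \<le> C * real k powr (- p) * norm x)" if k: "k \<ge> 1" for k
  proof -
    obtain F where F: "rank_at_most (r * k) F" "\<And>x. norm (X x - F x) \<le> C * real k powr (- p) * norm x"
      using C(2)[OF k] by blast
    have "norm (amplify X x - amplify F x) \<le> C * real k powr (- p) * norm x" for x :: "'h ^ 'n"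
    proof -
      have "amplify X x - amplify F x = amplify (\<lambda>x. X x - F x) x"
        by (simp add: vec_eq_iff amplify_def)
      then show ?thesis using norm_amplify_le[OF F(2), of x] C(1) by simp
    qed
    then show ?thesis
      using rank_at_most_amplify[OF F(1)] by (intro exI[of _ "amplify F"]) (simp add: mult.assoc)
  qed
  then show ?thesis
    using C(1) bounded_clinear_amplify[OF approximable_bounded[OF assms]]
    unfolding approximable_def by blast
qed

lemma closure_amplify_dom:
  assumes "closure V = UNIV"
  shows "closure (amplify_dom V :: ('h::chilbert_space ^ 'n) set) = UNIV"
proof -
  have "x \<in> closure (amplify_dom V)" for x :: "'h ^ 'n"
  proof -
    have "\<exists>s. (\<forall>k. s k \<in> V) \<and> s \<longlonglongrightarrow> x $ i" for i
      using assms closure_sequential[of "x $ i" V] by auto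
    then obtain s where s: "\<And>i k. s i k \<in> V" "\<And>i. s i \<longlonglongrightarrow> x $ i" by metis
    have "(\<lambda>k. \<chi> i. s i k) \<longlonglongrightarrow> x" by (rule vec_tendstoI) (simp add: s)
    then show ?thesis
      unfolding closure_sequential
      by (intro exI[of _ "\<lambda>k. \<chi> i. s i k"] conjI allI) (simp_all add: amplify_dom_def s)
  qed
  then show ?thesis by blast
qed

section \<open>Actions of matrices over the algebra\<close>

lemma matrix_action_product:
  assumes "bounded_action \<pi>"
  shows "matrix_action \<pi> (matrix_product a b) x = matrix_action \<pi> a (matrix_action \<pi> b x)"
proof -
  have add: "\<pi> (c + d) y = \<pi> c y + \<pi> d y" and mult: "\<pi> (c * d) y = \<pi> c (\<pi> d y)" for c d y
    using assms by (auto simp: bounded_action_def)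
  have bnd: "bounded_clinear (\<pi> c)" for c using assms by (auto simp: bounded_action_def)
  have zero: "\<pi> 0 y = 0" for y using add[of 0 0 y] by simp
  have sum: "\<pi> (\<Sum>k\<in>I. f k) y = (\<Sum>k\<in>I. \<pi> (f k) y)" for I f y
    by (induction I rule: infinite_finite_induct) (simp_all add: add zero)
  have "(\<Sum>j\<in>UNIV. \<Sum>k\<in>UNIV. \<pi> (a $ i $ k) (\<pi> (b $ k $ j) (x $ j))) =
      (\<Sum>k\<in>UNIV. \<pi> (a $ i $ k) (\<Sum>j\<in>UNIV. \<pi> (b $ k $ j) (x $ j)))" for i
    unfolding bounded_clinear_sum[OF bnd] by (rule sum.swap)
  then show ?thesis
    by (simp add: vec_eq_iff matrix_action_def matrix_product_def sum mult)
qed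

lemma matrix_map_product:
  assumes "algebra_automorphism \<sigma>"
  shows "matrix_map \<sigma> (matrix_product a b) = matrix_product (matrix_map \<sigma> a) (matrix_map \<sigma> b)"
proof -
  have add: "\<sigma> (c + d) = \<sigma> c + \<sigma> d" and mult: "\<sigma> (c * d) = \<sigma> c * \<sigma> d" for c d
    using assms by (auto simp: algebra_automorphism_def)
  have zero: "\<sigma> 0 = 0" using add[of 0 0] by simp
  have sum: "\<sigma> (\<Sum>k\<in>I. f k) = (\<Sum>k\<in>I. \<sigma> (f k))" for I f
    by (induction I rule: infinite_finite_induct) (simp_all add: add zero)
  show ?thesis by (simp add: vec_eq_iff matrix_map_def matrix_product_def sum mult)
qed

lemma bounded_clinear_matrix_action:
  assumes "bounded_action \<pi>"
  shows "bounded_clinear (matrix_action \<pi> (a :: 'a::complex_algebra ^ 'n ^ 'n))"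
  using bounded_clinear_matrix[of "\<lambda>i j. \<pi> (a $ i $ j)"] assms
  by (simp add: matrix_action_def[abs_def] bounded_action_def)

lemma matrix_action_adjoint:
  assumes "involutive_action star \<pi>" "matrix_star star e = f"
  shows "cinner (matrix_action \<pi> e x) y = cinner x (matrix_action \<pi> f y)"
proof -
  have "cinner (matrix_action \<pi> e x) y = (\<Sum>i\<in>UNIV. \<Sum>j\<in>UNIV. cinner (x $ j) (\<pi> (star (e $ i $ j)) (y $ i)))"
    using assms(1) by (simp add: cinner_vec_def matrix_action_def cinner_sum_left involutive_action_def)
  also have "\<dots> = (\<Sum>j\<in>UNIV. \<Sum>i\<in>UNIV. cinner (x $ j) (\<pi> (star (e $ i $ j)) (y $ i)))"
    by (rule sum.swap)
  also have "\<dots> = cinner x (matrix_action \<pi> f y)"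
    unfolding assms(2)[symmetric] by (simp add: cinner_vec_def matrix_action_def cinner_sum_right matrix_star_def)
  finally show ?thesis .
qed

text \<open>The operator \<open>T\<close> is the matrix of the bounded twisted commutators of the
  entries of e. The singular value bound concerns the inverse before amplification, so it is
  converted into approximability there and amplified afterwards.\<close>

lemma amplified_triple_operator:
  assumes "graded_twisted_spectral_triple \<sigma> \<pi> Dom D \<gamma>" and n: "even n" "n > 0"
    and bij: "bij_betw D Dom UNIV" and schatten: "inv_into Dom D \<in> weak_schatten (real n)"
    and e: "matrix_product e e = (e :: 'a::complex_algebra ^ 'n ^ 'n)"
  obtains T where "invertible_odd_operator (amplify_dom Dom) (amplify D) (amplify (inv_into Dom D))
    (amplify \<gamma>) (matrix_action \<pi> e) (matrix_action \<pi> (matrix_map \<sigma> e)) T n"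
proof -
  interpret graded_twisted_spectral_triple \<sigma> \<pi> Dom D \<gamma> by fact
  have Dom: "complex_vector.subspace Dom" "closure Dom = UNIV"
    and D_add: "\<And>x y. x \<in> Dom \<Longrightarrow> y \<in> Dom \<Longrightarrow> D (x + y) = D x + D y"
    and D_adj: "\<And>y z. (\<forall>x\<in>Dom. cinner (D x) y = cinner x z) \<longleftrightarrow> y \<in> Dom \<and> z = D y"
    using self_adjoint unfolding self_adjoint_on_def by blast+
  have D_symmetric: "cinner (D x) y = cinner x (D y)" if "x \<in> Dom" "y \<in> Dom" for x y
    using D_adj[of y "D y"] that by blast
  have "0 \<in> Dom" using Dom(1) by (rule complex_vector.subspace_0)
  have D_0: "D 0 = 0" using D_add[OF \<open>0 \<in> Dom\<close> \<open>0 \<in> Dom\<close>] by simp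
  \<comment> \<open>\<open>D\<close> is additive only on \<open>Dom\<close>, so membership in the
    domain is carried through the induction.\<close>
  have D_sum: "(\<Sum>j\<in>J. f j) \<in> Dom \<and> D (\<Sum>j\<in>J. f j) = (\<Sum>j\<in>J. D (f j))" if "\<And>j. f j \<in> Dom" for f and J :: "'n set"
    by (induction J rule: infinite_finite_induct)
      (simp_all add: D_0 \<open>0 \<in> Dom\<close> D_add that complex_vector.subspace_add[OF Dom(1)])
  define G where "G = inv_into Dom D"
  have G: "G x \<in> Dom" "D (G x) = x" for x
    using bij f_inv_into_f[of x D Dom] inv_into_into[of x D Dom] by (auto simp: G_def bij_betw_def)
  have G_D: "G (D x) = x" if "x \<in> Dom" for x
    using bij that by (simp add: G_def bij_betw_def inv_into_f_f)
  have bG: "bounded_clinear G"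
    using schatten by (simp add: G_def weak_schatten_def compact_operator_def)
  have G_symmetric: "cinner (G x) y = cinner x (G y)" for x y
    using D_symmetric[OF G(1) G(1), of x y] by (simp add: G(2))
  have "approximable (1 / real n) G"
    using weak_schatten_approximable[OF schatten[folded G_def] G_symmetric] n by simp
  then have approx: "approximable (1 / real n) (amplify G :: 'b ^ 'n \<Rightarrow> 'b ^ 'n)"
    by (rule approximable_amplify)
  have "\<forall>i j. \<exists>T. bounded_clinear T \<and> (\<forall>x\<in>Dom. T x = D (\<pi> (e $ i $ j) x) - \<pi> (\<sigma> (e $ i $ j)) (D x))"
    using bounded_twisted_commutator by blast
  then obtain T0 where T0: "\<And>i j. bounded_clinear (T0 i j)"
      "\<And>i j x. x \<in> Dom \<Longrightarrow> T0 i j x = D (\<pi> (e $ i $ j) x) - \<pi> (\<sigma> (e $ i $ j)) (D x)"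
    by metis
  define T where "T = (\<lambda>x :: 'b ^ 'n. \<chi> i. \<Sum>j\<in>UNIV. T0 i j (x $ j))"
  note simps = bounded_clinear_simps[OF grading_bounded] bounded_clinear_sum[OF grading_bounded]
  have "invertible_odd_operator (amplify_dom Dom) (amplify D) (amplify G) (amplify \<gamma>)
    (matrix_action \<pi> e) (matrix_action \<pi> (matrix_map \<sigma> e)) T n"
  proof
    fix x y :: "'b ^ 'n"
    show "bounded_clinear (amplify G :: 'b ^ 'n \<Rightarrow> _)" "bounded_clinear (amplify \<gamma> :: 'b ^ 'n \<Rightarrow> _)"
      by (intro bounded_clinear_amplify bG grading_bounded)+
    show "amplify G x \<in> amplify_dom Dom" "amplify D (amplify G x) = x"
      by (simp_all add: amplify_def amplify_dom_def G vec_eq_iff)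
    show "closure (amplify_dom Dom :: ('b ^ 'n) set) = UNIV" using Dom(2) by (rule closure_amplify_dom)
    show "complex_vector.subspace (amplify_dom Dom :: ('b ^ 'n) set)"
      using Dom(1) by (simp add: complex_vector.subspace_def amplify_dom_def scaleC_vec_def)
    show "cinner (amplify \<gamma> x) y = cinner x (amplify \<gamma> y)" "amplify \<gamma> (amplify \<gamma> x) = x"
      by (simp_all add: cinner_vec_def amplify_def grading_self_adjoint grading_involutive vec_eq_iff)
    show "bounded_clinear (matrix_action \<pi> e)" "bounded_clinear (matrix_action \<pi> (matrix_map \<sigma> e))"
      by (intro bounded_clinear_matrix_action action)+
    show "matrix_action \<pi> e (matrix_action \<pi> e x) = matrix_action \<pi> e x"
      by (simp add: matrix_action_product[OF action, symmetric] e)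
    show "matrix_action \<pi> (matrix_map \<sigma> e) (matrix_action \<pi> (matrix_map \<sigma> e) x) = matrix_action \<pi> (matrix_map \<sigma> e) x"
      by (simp add: matrix_action_product[OF action, symmetric] matrix_map_product[OF automorphism, symmetric] e)
    show "matrix_action \<pi> e (amplify \<gamma> x) = amplify \<gamma> (matrix_action \<pi> e x)"
        "matrix_action \<pi> (matrix_map \<sigma> e) (amplify \<gamma> x) = amplify \<gamma> (matrix_action \<pi> (matrix_map \<sigma> e) x)"
      by (simp_all add: matrix_action_def amplify_def vec_eq_iff simps grading_commutes)
    show "bounded_clinear T" unfolding T_def by (rule bounded_clinear_matrix[OF T0(1)])
    show "approximable (1 / real n) (amplify G :: 'b ^ 'n \<Rightarrow> _)" by (rule approx)
    assume x: "x \<in> amplify_dom Dom"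
    then have xi: "x $ i \<in> Dom" for i by (simp add: amplify_dom_def)
    show "amplify G (amplify D x) = x"
      by (simp add: amplify_def G_D xi vec_eq_iff)
    show "amplify \<gamma> x \<in> amplify_dom Dom" "amplify D (amplify \<gamma> x) = - amplify \<gamma> (amplify D x)"
      by (simp_all add: amplify_def amplify_dom_def grading_preserves_domain grading_anticommutes xi vec_eq_iff)
    show "matrix_action \<pi> e x \<in> amplify_dom Dom"
      by (simp add: matrix_action_def amplify_dom_def D_sum preserves_domain xi)
    show "T x = amplify D (matrix_action \<pi> e x) - matrix_action \<pi> (matrix_map \<sigma> e) (amplify D x)"
      by (simp add: T_def T0(2) xi vec_eq_iff amplify_def matrix_action_def matrix_map_def D_sum
          preserves_domain sum_subtractf)
    assume "y \<in> amplify_dom Dom"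
    then show "cinner (amplify D x) y = cinner x (amplify D y)"
      by (simp add: cinner_vec_def amplify_def D_symmetric xi amplify_dom_def)
  qed (use n in simp_all)
  then show ?thesis using that by (simp add: G_def)
qed

theorem proposition3p7:
  fixes \<sigma> :: "'a::complex_algebra \<Rightarrow> 'a"
    and \<pi> :: "'a \<Rightarrow> 'h::chilbert_space \<Rightarrow> 'h"
    and Dom :: "'h set"
    and D \<gamma> :: "'h \<Rightarrow> 'h"
    and n :: nat
    and e :: "'a ^ 'n ^ 'n"
  assumes "graded_twisted_spectral_triple \<sigma> \<pi> Dom D \<gamma>"
    and "even n" and "n > 0"
    and "bij_betw D Dom UNIV"
    and "inv_into Dom D \<in> weak_schatten (real n)"
    and "matrix_product e e = e"
  shows "of_int (index_map \<sigma> \<pi> Dom D \<gamma> 1 e) = index_cocycle \<sigma> \<pi> Dom D \<gamma> 1 n (\<lambda>_. e) \<and>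
    of_int (index_map \<sigma> \<pi> Dom D \<gamma> (-1) e) = index_cocycle \<sigma> \<pi> Dom D \<gamma> (-1) n (\<lambda>_. e) \<and>
    (\<forall>star. algebra_involution star \<and> involutive_action star \<pi> \<and>
       (\<forall>a. \<sigma> (star a) = star (inv \<sigma> a)) \<and> matrix_star star e = matrix_map \<sigma> e \<longrightarrow>
       index_map \<sigma> \<pi> Dom D \<gamma> 1 e = - index_map \<sigma> \<pi> Dom D \<gamma> (-1) e)"
proof -
  obtain T where "invertible_odd_operator (amplify_dom Dom) (amplify D) (amplify (inv_into Dom D))
    (amplify \<gamma>) (matrix_action \<pi> e) (matrix_action \<pi> (matrix_map \<sigma> e)) T n"
    using amplified_triple_operator[OF assms] .
  then interpret invertible_odd_operator "amplify_dom Dom" "amplify D" "amplify (inv_into Dom D)"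
    "amplify \<gamma>" "matrix_action \<pi> e" "matrix_action \<pi> (matrix_map \<sigma> e)" T n .
  have trace: "has_trace (A ^^ Suc n \<circ> pr \<epsilon>) (of_int (index_map \<sigma> \<pi> Dom D \<gamma> \<epsilon> e))"
    if "\<epsilon> = 1 \<or> \<epsilon> = - 1" for \<epsilon>
    using index_trace[OF that] by (simp only: index_map_def Let_def)
  have index: "of_int (index_map \<sigma> \<pi> Dom D \<gamma> \<epsilon> e) = index_cocycle \<sigma> \<pi> Dom D \<gamma> \<epsilon> n (\<lambda>_. e)"
    if "\<epsilon> = 1 \<or> \<epsilon> = - 1" for \<epsilon>
  proof -
    have "index_cocycle \<sigma> \<pi> Dom D \<gamma> \<epsilon> n (\<lambda>_. e) = trace_operator (A ^^ Suc n \<circ> pr \<epsilon>)"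
      unfolding index_cocycle_def cocycle_factor_def foldr_cocycle[OF that] by simp
    then show ?thesis using trace_operator_eq[OF trace[OF that]] by simp
  qed
  have "index_map \<sigma> \<pi> Dom D \<gamma> 1 e = - index_map \<sigma> \<pi> Dom D \<gamma> (-1) e"
    if "involutive_action star \<pi>" "matrix_star star e = matrix_map \<sigma> e" for star
  proof -
    \<comment> \<open>The conjugated trace is an integer, so the conjugation disappears when this
      value is compared with the index for the other sign.\<close>
    have "has_trace (A ^^ Suc n \<circ> pr (- 1)) (- cnj (of_int (index_map \<sigma> \<pi> Dom D \<gamma> 1 e)))"
      by (rule trace_adjoint[OF matrix_action_adjoint[OF that] trace]) simp
    then have "(of_int (index_map \<sigma> \<pi> Dom D \<gamma> (-1) e) :: complex) = of_int (- index_map \<sigma> \<pi> Dom D \<gamma> 1 e)"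
      using has_trace_unique[OF trace[of "- 1"]] by simp
    then show ?thesis by (simp only: of_int_eq_iff)
  qed
  then show ?thesis using index by auto
qed

end
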